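(* Let $\dot X$ be a symmetric pure jump Lévy white noise on a Borel set $S\subset\mathbb{R}^d$ with characteristic triplet $(0,0,\nu)$, and let $\mathcal{L}$ be a partial differential operator on $\mathbb{R}^d$ with a fixed fundamental solution $\rho$. Assume that for any $t\in\mathbb{R}^d$, $\rho(t-\cdot)\in L(\dot X,S)$. Let $u_{\text{mild}}$ be a (jointly) measurable version of the mild solution $u_{\text{mild}}(t)=\langle\dot X,\rho(t-\cdot)\rangle$, $t\in\mathbb{R}^d$, to $\mathcal{L}u=\dot X$. Suppose that the sample paths of $u_{\text{mild}}$ are almost surely locally integrable with respect to Lebesgue measure. Then $u_{\text{mild}}=u_{\text{gen}}$ in the sense of generalized stochastic processes, where $u_{\text{gen}}$ is the generalized solution $\langle u_{\text{gen}},\varphi\rangle=\langle\dot X,\varphi*\check\rho\rangle$, $\varphi\in\mathcal{D}(\mathbb{R}^d)$.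
   Context: $\mathcal{D}(\mathbb{R}^d)$ is the space of (real-valued) $C^\infty$ compactly supported functions and $\mathcal{D}'(\mathbb{R}^d)$ the space of Schwartz distributions. A fundamental solution of $\mathcal{L}$ is a distribution $\rho\in\mathcal{D}'(\mathbb{R}^d)$ with $\mathcal{L}\rho=\delta_0$; one choice of $\rho$ is fixed. For $\varphi\in\mathcal{D}(\mathbb{R}^d)$, $\check\varphi(t)=\varphi(-t)$, $\langle\check\rho,\varphi\rangle=\langle\rho,\check\varphi\rangle$, and $(\varphi*\check\rho)(s)=\langle\rho,\varphi(s+\cdot)\rangle$, a $C^\infty$ function of $s$ (restricted to $S$ when integrated against the noise). The hypothesis $\rho(t-\cdot)\in L(\dot X,S)$ for any $t$ presupposes that $\rho$ is represented by a (Borel measurable, locally integrable) function, still denoted $\rho$; then $(\varphi*\check\rho)(s)=\int_{\mathbb{R}^d}\rho(t-s)\varphi(t)\,\mathrm{d}t$. Symmetric pure jump Lévy white noise with characteristic triplet $(0,0,\nu)$ on $S$: $\nu$ is a nonzero symmetric Lévy measure on $\mathbb{R}$ (i.e. $\nu(\{0\})=0$, $\int_{\mathbb{R}}(z^2\wedge1)\,\nu(\mathrm{d}z)<\infty$), $J$ is a Poisson random measure on $S\times\mathbb{R}$ with intensity measure $\mathrm{d}s\,\nu(\mathrm{d}z)$, $\tilde J=J-\mathrm{d}s\,\nu(\mathrm{d}z)$ is its compensated version, and $$X(\mathrm{d}s)=\int_{|z|\le1}z\,\tilde J(\mathrm{d}s,\mathrm{d}z)+\int_{|z|>1}z\,J(\mathrm{d}s,\mathrm{d}z).$$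 The space of deterministic functions integrable with respect to it (Rajput–Rosiński) is $$L(\dot X,S)=\left\{f:S\to\mathbb{R}\text{ measurable}:\int_{S\times\mathbb{R}}\left(|f(s)z|^2\wedge1\right)\mathrm{d}s\,\nu(\mathrm{d}z)<+\infty\right\},$$ and for $f\in L(\dot X,S)$ the stochastic integral is denoted $\langle\dot X,f\rangle$ (extension, by limits in probability, of $\sum_ia_i\mathbf{1}_{A_i}\mapsto\sum_ia_iX(A_i)$; a.s. linear in $f$; $\mathbb{E}(e^{iu\langle\dot X,f\rangle})=\exp(-\int_{S\times\mathbb{R}}(1-\cos(uf(s)z))\,\mathrm{d}s\,\nu(\mathrm{d}z))$). The mild solution has a jointly measurable version in $(t,\omega)$. The generalized solution is defined when $\varphi*\check\rho\in L(\dot X,S)$ for every $\varphi\in\mathcal{D}(\mathbb{R}^d)$. A generalized stochastic process is a linear map from $\mathcal{D}(\mathbb{R}^d)$ into the space $L^0(\Omega)$ of a.s. finite random variables. "$u_{\text{mild}}=u_{\text{gen}}$ in the sense of generalized stochastic processes" means that $u_{\text{gen}}$ is well defined and, with $\langle u_{\text{mild}},\varphi\rangle:=\int_{\mathbb{R}^d}u_{\text{mild}}(t)\varphi(t)\,\mathrm{d}t$, one has $\langle u_{\text{mild}},\varphi\rangle=\langle u_{\text{gen}},\varphi\rangle$ a.s. for every $\varphi\in\mathcal{D}(\mathbb{R}^d)$. *)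

theory Defs
  imports "HOL-Probability.Probability"
begin

fun iter_deriv :: "'a::euclidean_space list \<Rightarrow> ('a \<Rightarrow> real) \<Rightarrow> 'a \<Rightarrow> real" where
  "iter_deriv [] f = f"
| "iter_deriv (v # vs) f = (\<lambda>x. frechet_derivative (iter_deriv vs f) (at x) v)"

text \<open>A function is \<open>C\<^sup>\<infinity>\<close> iff all its iterated partial derivatives (words in the
  standard basis play the role of multi-indices) exist and are differentiable everywhere;
  their continuity is then automatic.\<close>

definition smooth :: "('a::euclidean_space \<Rightarrow> real) \<Rightarrow> bool" where
  "smooth f \<longleftrightarrow> (\<forall>vs. set vs \<subseteq> Basis \<longrightarrow> (\<forall>x. iter_deriv vs f differentiable (at x)))"

definition test_functions :: "('a::euclidean_space \<Rightarrow> real) set" where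
  "test_functions = {\<phi>. smooth \<phi> \<and> compact (closure {x. \<phi> x \<noteq> 0})}"

definition test_converges ::
    "(nat \<Rightarrow> 'a::euclidean_space \<Rightarrow> real) \<Rightarrow> ('a \<Rightarrow> real) \<Rightarrow> bool" where
  "test_converges \<Phi> \<phi> \<longleftrightarrow>
     (\<exists>K. compact K \<and> (\<forall>n. {x. \<Phi> n x \<noteq> 0} \<subseteq> K)) \<and>
     (\<forall>vs. set vs \<subseteq> Basis \<longrightarrow>
        uniform_limit UNIV (\<lambda>n. iter_deriv vs (\<Phi> n)) (iter_deriv vs \<phi>) sequentially)"

text \<open>For linear functionals on the space of test functions, sequential continuity is
  equivalent to continuity. Values outside \<open>test_functions\<close> are irrelevant.\<close>

definition distribution :: "(('a::euclidean_space \<Rightarrow> real) \<Rightarrow> real) \<Rightarrow> bool" where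
  "distribution T \<longleftrightarrow>
     (\<forall>\<phi>\<in>test_functions. \<forall>\<psi>\<in>test_functions. \<forall>a b.
        T (\<lambda>x. a * \<phi> x + b * \<psi> x) = a * T \<phi> + b * T \<psi>) \<and>
     (\<forall>\<Phi> \<phi>. (\<forall>n. \<Phi> n \<in> test_functions) \<longrightarrow> \<phi> \<in> test_functions \<longrightarrow> test_converges \<Phi> \<phi> \<longrightarrow>
        (\<lambda>n. T (\<Phi> n)) \<longlonglongrightarrow> T \<phi>)"

text \<open>The list \<open>[(a\<^sub>1, vs\<^sub>1), \<dots>, (a\<^sub>m, vs\<^sub>m)]\<close> stands for the linear partial differential operator
  \<open>u \<mapsto> \<Sum>\<^sub>k a\<^sub>k \<partial>\<^bsub>vs\<^sub>k\<^esub> u\<close> with smooth (in particular possibly constant) coefficients.\<close>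

type_synonym 'a pdo = "(('a \<Rightarrow> real) \<times> 'a list) list"

definition partial_differential_operator :: "'a::euclidean_space pdo \<Rightarrow> bool" where
  "partial_differential_operator L \<longleftrightarrow> (\<forall>(a, vs)\<in>set L. smooth a \<and> set vs \<subseteq> Basis)"

definition formal_adjoint ::
    "'a::euclidean_space pdo \<Rightarrow> ('a \<Rightarrow> real) \<Rightarrow> 'a \<Rightarrow> real" where
  "formal_adjoint L \<phi> x =
     (\<Sum>(a, vs)\<leftarrow>L. (-1) ^ length vs * iter_deriv (rev vs) (\<lambda>y. a y * \<phi> y) x)"

definition pdo_distribution ::
    "'a::euclidean_space pdo \<Rightarrow> (('a \<Rightarrow> real) \<Rightarrow> real) \<Rightarrow> ('a \<Rightarrow> real) \<Rightarrow> real" where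
  "pdo_distribution L T \<phi> = T (formal_adjoint L \<phi>)"

definition dirac_delta :: "'a::euclidean_space \<Rightarrow> ('a \<Rightarrow> real) \<Rightarrow> real" where
  "dirac_delta x \<phi> = \<phi> x"

definition fundamental_solution ::
    "'a::euclidean_space pdo \<Rightarrow> (('a \<Rightarrow> real) \<Rightarrow> real) \<Rightarrow> bool" where
  "fundamental_solution L T \<longleftrightarrow>
     distribution T \<and> (\<forall>\<phi>\<in>test_functions. pdo_distribution L T \<phi> = dirac_delta 0 \<phi>)"

definition locally_integrable :: "('a::euclidean_space \<Rightarrow> real) \<Rightarrow> bool" where
  "locally_integrable f \<longleftrightarrow> (\<forall>K. compact K \<longrightarrow> set_integrable lborel K f)"

definition represented_by ::
    "(('a::euclidean_space \<Rightarrow> real) \<Rightarrow> real) \<Rightarrow> ('a \<Rightarrow> real) \<Rightarrow> bool" where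
  "represented_by T \<rho> \<longleftrightarrow>
     \<rho> \<in> borel_measurable borel \<and> locally_integrable \<rho> \<and>
     (\<forall>\<phi>\<in>test_functions. T \<phi> = (\<integral>x. \<rho> x * \<phi> x \<partial>lborel))"

text \<open>The convolution of \<open>\<phi>\<close> with the reflection of \<open>\<rho>\<close>, that is \<open>s \<mapsto> \<langle>\<rho>, \<phi>(s + \<cdot>)\<rangle>\<close>.\<close>

definition conv_reflected ::
    "('a::euclidean_space \<Rightarrow> real) \<Rightarrow> (('a \<Rightarrow> real) \<Rightarrow> real) \<Rightarrow> 'a \<Rightarrow> real" where
  "conv_reflected \<phi> T s = T (\<lambda>x. \<phi> (s + x))"

definition symmetric_levy_measure :: "real measure \<Rightarrow> bool" where
  "symmetric_levy_measure \<nu> \<longleftrightarrow>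
     sets \<nu> = sets borel \<and> emeasure \<nu> UNIV \<noteq> 0 \<and> emeasure \<nu> {0} = 0 \<and>
     (\<integral>\<^sup>+z. ennreal (min (z\<^sup>2) 1) \<partial>\<nu>) < \<infinity> \<and>
     distr \<nu> borel uminus = \<nu>"

definition intensity :: "'a::euclidean_space set \<Rightarrow> real measure \<Rightarrow> ('a \<times> real) measure" where
  "intensity S \<nu> = restrict_space lborel S \<Otimes>\<^sub>M \<nu>"

definition poisson_random_measure ::
    "'w measure \<Rightarrow> 'b measure \<Rightarrow> ('w \<Rightarrow> 'b measure) \<Rightarrow> bool" where
  "poisson_random_measure M \<mu> J \<longleftrightarrow>
     (\<forall>\<omega>\<in>space M. sets (J \<omega>) = sets \<mu>) \<and>
     (\<forall>A\<in>sets \<mu>. (\<lambda>\<omega>. emeasure (J \<omega>) A) \<in> borel_measurable M) \<and>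
     (\<forall>A\<in>sets \<mu>. emeasure \<mu> A < \<infinity> \<longrightarrow>
        (\<forall>k::nat. measure M {\<omega> \<in> space M. emeasure (J \<omega>) A = of_nat k} =
           measure \<mu> A ^ k / fact k * exp (- measure \<mu> A))) \<and>
     (\<forall>A\<in>sets \<mu>. emeasure \<mu> A = \<infinity> \<longrightarrow> (AE \<omega> in M. emeasure (J \<omega>) A = \<infinity>)) \<and>
     (\<forall>A :: nat \<Rightarrow> 'b set. range A \<subseteq> sets \<mu> \<longrightarrow> disjoint_family A \<longrightarrow>
        prob_space.indep_vars M (\<lambda>_. borel) (\<lambda>i \<omega>. emeasure (J \<omega>) (A i)) UNIV)"

text \<open>\<open>Y\<close> is a version of \<open>\<integral> g d(J - \<mu>)\<close>, as the \<open>L\<^sup>2\<close>-limit of the compensated integrals of the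
  truncations \<open>g 1\<^bsub>|g| > 1/(n+1)\<^esub>\<close>; if \<open>g\<close> is square integrable with respect to \<open>\<mu>\<close>, these are
  integrable with respect to \<open>\<mu>\<close>.\<close>

definition is_compensated_integral ::
    "'w measure \<Rightarrow> 'b measure \<Rightarrow> ('w \<Rightarrow> 'b measure) \<Rightarrow> ('b \<Rightarrow> real) \<Rightarrow> ('w \<Rightarrow> real) \<Rightarrow> bool" where
  "is_compensated_integral M \<mu> J g Y \<longleftrightarrow>
     Y \<in> borel_measurable M \<and>
     (let g' = (\<lambda>n p. if 1 / real (Suc n) < \<bar>g p\<bar> then g p else 0) in
       (\<lambda>n. \<integral>\<^sup>+\<omega>. ennreal ((((\<integral>p. g' n p \<partial>J \<omega>) - (\<integral>p. g' n p \<partial>\<mu>)) - Y \<omega>)\<^sup>2) \<partial>M)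
         \<longlonglongrightarrow> 0)"

definition noise_sets :: "'a::euclidean_space set \<Rightarrow> 'a set set" where
  "noise_sets S = {A \<in> sets borel. A \<subseteq> S \<and> emeasure lborel A < \<infinity>}"

definition levy_white_noise ::
    "'w measure \<Rightarrow> 'a::euclidean_space set \<Rightarrow> real measure \<Rightarrow> ('w \<Rightarrow> ('a \<times> real) measure) \<Rightarrow>
     ('a set \<Rightarrow> 'w \<Rightarrow> real) \<Rightarrow> bool" where
  "levy_white_noise M S \<nu> J X \<longleftrightarrow>
     symmetric_levy_measure \<nu> \<and>
     poisson_random_measure M (intensity S \<nu>) J \<and>
     (\<forall>A\<in>noise_sets S. X A \<in> borel_measurable M \<and>
        (\<exists>Y. is_compensated_integral M (intensity S \<nu>) J
               (\<lambda>(s, z). if s \<in> A \<and> \<bar>z\<bar> \<le> 1 then z else 0) Y \<and>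
             (AE \<omega> in M. X A \<omega> =
                Y \<omega> + (\<integral>(s, z). (if s \<in> A \<and> 1 < \<bar>z\<bar> then z else 0) \<partial>J \<omega>))))"

definition noise_integrable ::
    "'a::euclidean_space set \<Rightarrow> real measure \<Rightarrow> ('a \<Rightarrow> real) set" where
  "noise_integrable S \<nu> =
     {f. f \<in> borel_measurable (restrict_space borel S) \<and>
         (\<integral>\<^sup>+(s, z). ennreal (min (\<bar>f s * z\<bar>\<^sup>2) 1) \<partial>intensity S \<nu>) < \<infinity>}"

definition converges_in_prob ::
    "'w measure \<Rightarrow> (nat \<Rightarrow> 'w \<Rightarrow> real) \<Rightarrow> ('w \<Rightarrow> real) \<Rightarrow> bool" where
  "converges_in_prob M Z Y \<longleftrightarrow>
     (\<forall>n. Z n \<in> borel_measurable M) \<and> Y \<in> borel_measurable M \<and>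
     (\<forall>e>0. (\<lambda>n. measure M {\<omega> \<in> space M. e < \<bar>Z n \<omega> - Y \<omega>\<bar>}) \<longlonglongrightarrow> 0)"

text \<open>The list \<open>[(a\<^sub>1, A\<^sub>1), \<dots>, (a\<^sub>m, A\<^sub>m)]\<close> stands for the simple function \<open>\<Sum>\<^sub>i a\<^sub>i 1\<^bsub>A\<^sub>i\<^esub>\<close>.\<close>

definition simple_fun :: "(real \<times> 'a set) list \<Rightarrow> 'a \<Rightarrow> real" where
  "simple_fun F s = (\<Sum>(a, A)\<leftarrow>F. a * indicator A s)"

definition simple_integral ::
    "('a set \<Rightarrow> 'w \<Rightarrow> real) \<Rightarrow> 'a set \<Rightarrow> (real \<times> 'a set) list \<Rightarrow> 'w \<Rightarrow> real" where
  "simple_integral X B F \<omega> = (\<Sum>(a, A)\<leftarrow>F. a * X (A \<inter> B) \<omega>)"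

text \<open>The Rajput--Rosinski definition of the integral with respect to an independently
  scattered random measure.\<close>

definition is_stochastic_integral ::
    "'w measure \<Rightarrow> 'a::euclidean_space set \<Rightarrow> ('a set \<Rightarrow> 'w \<Rightarrow> real) \<Rightarrow> ('a \<Rightarrow> real) \<Rightarrow>
     ('w \<Rightarrow> real) \<Rightarrow> bool" where
  "is_stochastic_integral M S X f Y \<longleftrightarrow>
     (\<exists>F :: nat \<Rightarrow> (real \<times> 'a set) list.
        (\<forall>n. set (F n) \<subseteq> UNIV \<times> noise_sets S) \<and>
        (AE s in restrict_space lborel S. (\<lambda>n. simple_fun (F n) s) \<longlonglongrightarrow> f s) \<and>
        (\<forall>B\<in>sets borel. B \<subseteq> S \<longrightarrow>
           (\<exists>Z. converges_in_prob M (\<lambda>n. simple_integral X B (F n)) Z)) \<and>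
        converges_in_prob M (\<lambda>n. simple_integral X S (F n)) Y)"

text \<open>A version of the integral, which is determined up to almost sure equality.\<close>

definition stochastic_integral ::
    "'w measure \<Rightarrow> 'a::euclidean_space set \<Rightarrow> ('a set \<Rightarrow> 'w \<Rightarrow> real) \<Rightarrow> ('a \<Rightarrow> real) \<Rightarrow>
     'w \<Rightarrow> real" where
  "stochastic_integral M S X f = (SOME Y. is_stochastic_integral M S X f Y)"

definition measurable_mild_solution ::
    "'w measure \<Rightarrow> 'a::euclidean_space set \<Rightarrow> ('a set \<Rightarrow> 'w \<Rightarrow> real) \<Rightarrow> ('a \<Rightarrow> real) \<Rightarrow>
     ('a \<Rightarrow> 'w \<Rightarrow> real) \<Rightarrow> bool" where
  "measurable_mild_solution M S X \<rho> u \<longleftrightarrow>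
     (\<lambda>(t, \<omega>). u t \<omega>) \<in> borel_measurable (borel \<Otimes>\<^sub>M M) \<and>
     (\<forall>t. AE \<omega> in M. u t \<omega> = stochastic_integral M S X (\<lambda>s. \<rho> (t - s)) \<omega>)"

definition mild_functional ::
    "('a::euclidean_space \<Rightarrow> 'w \<Rightarrow> real) \<Rightarrow> ('a \<Rightarrow> real) \<Rightarrow> 'w \<Rightarrow> real" where
  "mild_functional u \<phi> \<omega> = (\<integral>t. u t \<omega> * \<phi> t \<partial>lborel)"

definition generalized_solution_defined ::
    "'a::euclidean_space set \<Rightarrow> real measure \<Rightarrow> (('a \<Rightarrow> real) \<Rightarrow> real) \<Rightarrow> bool" where
  "generalized_solution_defined S \<nu> T \<longleftrightarrow>
     (\<forall>\<phi>\<in>test_functions. conv_reflected \<phi> T \<in> noise_integrable S \<nu>)"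

definition generalized_solution ::
    "'w measure \<Rightarrow> 'a::euclidean_space set \<Rightarrow> ('a set \<Rightarrow> 'w \<Rightarrow> real) \<Rightarrow>
     (('a \<Rightarrow> real) \<Rightarrow> real) \<Rightarrow> ('a \<Rightarrow> real) \<Rightarrow> 'w \<Rightarrow> real" where
  "generalized_solution M S X T \<phi> = stochastic_integral M S X (conv_reflected \<phi> T)"

definition generalized_process ::
    "'w measure \<Rightarrow> (('a::euclidean_space \<Rightarrow> real) \<Rightarrow> 'w \<Rightarrow> real) \<Rightarrow> bool" where
  "generalized_process M U \<longleftrightarrow>
     (\<forall>\<phi>\<in>test_functions. U \<phi> \<in> borel_measurable M) \<and>
     (\<forall>\<phi>\<in>test_functions. \<forall>\<psi>\<in>test_functions. \<forall>a b.
        AE \<omega> in M. U (\<lambda>x. a * \<phi> x + b * \<psi> x) \<omega> = a * U \<phi> \<omega> + b * U \<psi> \<omega>)"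

definition eq_generalized_process ::
    "'w measure \<Rightarrow> (('a::euclidean_space \<Rightarrow> real) \<Rightarrow> 'w \<Rightarrow> real) \<Rightarrow>
     (('a \<Rightarrow> real) \<Rightarrow> 'w \<Rightarrow> real) \<Rightarrow> bool" where
  "eq_generalized_process M U V \<longleftrightarrow>
     generalized_process M U \<and> generalized_process M V \<and>
     (\<forall>\<phi>\<in>test_functions. AE \<omega> in M. U \<phi> \<omega> = V \<phi> \<omega>)"

end

theory Submission
  imports Defs
begin

text \<open>
  For a simple function \<open>F\<close> the integral \<open>I(F)\<close> against the noise satisfies
  \<open>E cos(\<theta> I(F)) = exp(- \<integral> (1 - cos(\<theta> F(s) z)) ds \<nu>(dz))\<close>. Averaging over \<open>\<theta> \<in> [0,1]\<close> bounds
  \<open>E min(I(F)\<^sup>2, 1)\<close> and the modular \<open>\<integral> min((F(s) z)\<^sup>2, 1) ds \<nu>(dz)\<close> by constant multiples of each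
  other, as long as the former is small. Hence convergence in probability of integrals is the same as
  convergence of the integrands for the modular, and Fatou's lemma yields: if \<open>g\<^sub>k \<rightarrow> g\<close> almost
  everywhere and \<open>I(g\<^sub>k) \<rightarrow> U\<close> almost surely, then \<open>g\<close> is integrable and \<open>I(g) = U\<close>.

  This is applied to the averages \<open>g\<^sub>k = (V/N) \<Sum>\<^sub>j \<phi>(t\<^sub>j) \<rho>(t\<^sub>j - \<cdot>)\<close> with \<open>t\<^sub>j\<close> in a ball of volume \<open>V\<close>
  containing the support of \<open>\<phi>\<close>. If the \<open>t\<^sub>j\<close> are drawn uniformly, the weak law of large numbers holds
  for almost every \<open>s\<close> and almost every path, so there are deterministic points for which \<open>g\<^sub>k\<close>
  converges to \<open>\<phi> * \<rho>\<close> reflected and \<open>I(g\<^sub>k) = (V/N) \<Sum>\<^sub>j \<phi>(t\<^sub>j) u(t\<^sub>j)\<close> converges to \<open>\<integral> u \<phi> dt\<close>.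
\<close>

section \<open>A modular for convergence in probability\<close>

text \<open>The obstacle is that only almost sure local integrability of the paths is available:
  \<open>u_mild t\<close> may have no moments, and nothing bounds the modulars of
  \<open>\<rho> (t - s)\<close> jointly in t. A Fubini theorem through the Poisson measure is
  therefore out of reach, and even the noise integrability of the averaged integrand has to be
  proved. It is obtained from the convergence of the integrals, which is why the comparison is
  needed in the direction from integrals back to integrands. That direction holds only for small
  values because \<open>1 - exp (- \<Psi>)\<close> saturates at 1 and stops controlling
  \<open>\<Psi>\<close>; for Cauchy sequences smallness costs nothing. Symmetry of \<nu> makes the
  exponent real and the compensator zero, so cosines suffice. The sampling points must be
  deterministic because \<open>u_mild t\<close> is the integral of its integrand only almost surely
  for each fixed t, an identity that survives finite sums over fixed points. Squares replace the
  triangle inequality by one with factor 2, the source of several numerical constants.\<close>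

lemma tendsto_0_ennreal_iff:
  "(f \<longlongrightarrow> (0::ennreal)) F \<longleftrightarrow> (\<forall>e>0. \<forall>\<^sub>F x in F. f x \<le> ennreal e)"
proof
  assume f: "(f \<longlongrightarrow> 0) F"
  show "\<forall>e>0. \<forall>\<^sub>F x in F. f x \<le> ennreal e"
  proof (intro allI impI)
    fix e :: real assume "e > 0"
    then have "\<forall>\<^sub>F x in F. f x < ennreal e" using f by (intro order_tendstoD) auto
    then show "\<forall>\<^sub>F x in F. f x \<le> ennreal e" by eventually_elim (rule less_imp_le)
  qed
next
  assume *: "\<forall>e>0. \<forall>\<^sub>F x in F. f x \<le> ennreal e"
  show "(f \<longlongrightarrow> 0) F"
  proof (rule order_tendstoI)
    fix a :: ennreal assume "0 < a"
    then obtain b' where "0 < b'" "b' < a" using dense by blast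
    then obtain b where b: "0 < b" "ennreal b < a" by (cases b') auto
    from *[rule_format, OF b(1)] show "\<forall>\<^sub>F x in F. f x < a"
      by eventually_elim (metis b(2) le_less_trans)
  qed simp
qed

text \<open>One functional on two measures: on \<open>M\<close> it describes convergence in
  probability; on the intensity measure, applied to \<open>f s * z\<close>, its finiteness is the
  integrability condition of \<open>noise_integrable\<close>. Values in \<open>ennreal\<close> spare
  side conditions of integrability.\<close>

definition modular :: "'b measure \<Rightarrow> ('b \<Rightarrow> real) \<Rightarrow> ennreal" where
  "modular P h = (\<integral>\<^sup>+x. ennreal (min ((h x)\<^sup>2) 1) \<partial>P)"

lemma min_sq_add_le: "min ((a + b)\<^sup>2) 1 \<le> 2 * min (a\<^sup>2) 1 + 2 * min (b\<^sup>2) (1::real)"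
proof -
  have "(a + b)\<^sup>2 \<le> 2 * a\<^sup>2 + 2 * b\<^sup>2"
    using zero_le_power2[of "a - b"] by (simp add: power2_eq_square algebra_simps)
  then show ?thesis
    using zero_le_power2[of a] zero_le_power2[of b] unfolding min_def by (smt (verit))
qed

lemma min_sq_mult_le: "min ((c * a)\<^sup>2) 1 \<le> max (c\<^sup>2) 1 * min (a\<^sup>2) (1::real)"
proof (cases "a\<^sup>2 \<le> 1")
  case True
  have "(c * a)\<^sup>2 \<le> max (c\<^sup>2) 1 * a\<^sup>2"
    by (simp add: power_mult_distrib mult_right_mono)
  then show ?thesis using True by (auto simp: min_def)
next
  case False
  then show ?thesis by (auto simp: min_def)
qed

lemma modular_add_le:
  assumes [measurable]: "f \<in> borel_measurable P" "g \<in> borel_measurable P"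
  shows "modular P (\<lambda>x. f x + g x) \<le> 2 * modular P f + 2 * modular P g"
proof -
  have "modular P (\<lambda>x. f x + g x) \<le>
      (\<integral>\<^sup>+x. 2 * ennreal (min ((f x)\<^sup>2) 1) + 2 * ennreal (min ((g x)\<^sup>2) 1) \<partial>P)"
    unfolding modular_def
  proof (rule nn_integral_mono)
    fix x
    have "ennreal (min ((f x + g x)\<^sup>2) 1) \<le> ennreal (2 * min ((f x)\<^sup>2) 1 + 2 * min ((g x)\<^sup>2) 1)"
      by (rule ennreal_leI) (rule min_sq_add_le)
    also have "\<dots> = 2 * ennreal (min ((f x)\<^sup>2) 1) + 2 * ennreal (min ((g x)\<^sup>2) 1)"
      by (simp add: ennreal_plus ennreal_mult')
    finally show "ennreal (min ((f x + g x)\<^sup>2) 1) \<le> \<dots>" .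
  qed
  also have "\<dots> = 2 * modular P f + 2 * modular P g"
    unfolding modular_def by (subst nn_integral_add) (auto simp: nn_integral_cmult)
  finally show ?thesis .
qed

lemma modular_cmult_le:
  assumes [measurable]: "f \<in> borel_measurable P"
  shows "modular P (\<lambda>x. c * f x) \<le> ennreal (max (c\<^sup>2) 1) * modular P f"
proof -
  have "modular P (\<lambda>x. c * f x) \<le> (\<integral>\<^sup>+x. ennreal (max (c\<^sup>2) 1) * ennreal (min ((f x)\<^sup>2) 1) \<partial>P)"
    unfolding modular_def
    by (intro nn_integral_mono)
      (metis ennreal_leI ennreal_mult' max.coboundedI2 min_sq_mult_le zero_le_one)
  then show ?thesis
    unfolding modular_def by (simp add: nn_integral_cmult)
qed

lemma modular_minus_commute: "modular P (\<lambda>x. f x - g x) = modular P (\<lambda>x. g x - f x)"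
  by (simp add: modular_def power2_commute)

lemma modular_diff_le:
  assumes [measurable]: "f \<in> borel_measurable P" "g \<in> borel_measurable P" "h \<in> borel_measurable P"
  shows "modular P (\<lambda>x. f x - h x) \<le>
    2 * modular P (\<lambda>x. f x - g x) + 2 * modular P (\<lambda>x. g x - h x)"
  using modular_add_le[of "\<lambda>x. f x - g x" P "\<lambda>x. g x - h x"] by simp

lemma modular_mono:
  assumes "\<And>x. x \<in> space P \<Longrightarrow> \<bar>f x\<bar> \<le> \<bar>g x\<bar>"
  shows "modular P f \<le> modular P g"
  unfolding modular_def
proof (intro nn_integral_mono ennreal_leI)
  fix x assume "x \<in> space P"
  then have "(f x)\<^sup>2 \<le> (g x)\<^sup>2" using assms by (simp add: abs_le_square_iff)
  then show "min ((f x)\<^sup>2) 1 \<le> min ((g x)\<^sup>2) 1" by auto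
qed

lemma modular_cong_AE:
  assumes "AE x in P. f x = g x"
  shows "modular P f = modular P g"
  unfolding modular_def using assms by (intro nn_integral_cong_AE) auto

lemma modular_eq_0_iff:
  assumes [measurable]: "f \<in> borel_measurable P"
  shows "modular P f = 0 \<longleftrightarrow> (AE x in P. f x = 0)"
proof -
  have *: "ennreal (min ((f x)\<^sup>2) 1) = 0 \<longleftrightarrow> f x = 0" for x
    by (auto simp: min_def ennreal_eq_0_iff)
  show ?thesis
    unfolding modular_def by (subst nn_integral_0_iff_AE) (auto simp only: *, measurable)
qed

lemma min_sq_tendsto_0:
  assumes "f \<longlonglongrightarrow> (0::real)"
  shows "(\<lambda>n. ennreal (min ((f n)\<^sup>2) 1)) \<longlonglongrightarrow> 0"
proof -
  have "(\<lambda>n. min ((f n)\<^sup>2) 1) \<longlonglongrightarrow> min (0\<^sup>2) (1::real)"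
    by (intro tendsto_intros assms)
  then have "(\<lambda>n. ennreal (min ((f n)\<^sup>2) 1)) \<longlonglongrightarrow> ennreal 0"
    by (intro tendsto_ennrealI) simp
  then show ?thesis by simp
qed

lemma modular_dominated_tendsto_0:
  assumes [measurable]: "\<And>n. f n \<in> borel_measurable P" "w \<in> borel_measurable P"
    and "modular P w < \<infinity>"
    and "\<And>n x. x \<in> space P \<Longrightarrow> \<bar>f n x\<bar> \<le> \<bar>w x\<bar>"
    and "AE x in P. (\<lambda>n. f n x) \<longlonglongrightarrow> 0"
  shows "(\<lambda>n. modular P (f n)) \<longlonglongrightarrow> 0"
proof -
  have "(\<lambda>n. \<integral>\<^sup>+x. ennreal (min ((f n x)\<^sup>2) 1) \<partial>P) \<longlonglongrightarrow> (\<integral>\<^sup>+x. 0 \<partial>P)"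
  proof (rule nn_integral_dominated_convergence[where w="\<lambda>x. ennreal (min ((w x)\<^sup>2) 1)"])
    show "AE x in P. ennreal (min ((f n x)\<^sup>2) 1) \<le> ennreal (min ((w x)\<^sup>2) 1)" for n
    proof (rule AE_I2)
      fix x assume "x \<in> space P"
      then have "(f n x)\<^sup>2 \<le> (w x)\<^sup>2" using assms(4) by (simp add: abs_le_square_iff)
      then show "ennreal (min ((f n x)\<^sup>2) 1) \<le> ennreal (min ((w x)\<^sup>2) 1)"
        by (intro ennreal_leI) auto
    qed
    show "(\<integral>\<^sup>+x. ennreal (min ((w x)\<^sup>2) 1) \<partial>P) < \<infinity>" using assms(3) by (simp add: modular_def)
    show "AE x in P. (\<lambda>i. ennreal (min ((f i x)\<^sup>2) 1)) \<longlonglongrightarrow> 0"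
      using assms(5) by eventually_elim (rule min_sq_tendsto_0)
  qed auto
  then show ?thesis by (simp add: modular_def)
qed

lemma (in finite_measure) modular_AE_tendsto_0:
  assumes [measurable]: "\<And>n. f n \<in> borel_measurable M"
    and "AE x in M. (\<lambda>n. f n x) \<longlonglongrightarrow> 0"
  shows "(\<lambda>n. modular M (f n)) \<longlonglongrightarrow> 0"
proof -
  have "(\<lambda>n. \<integral>\<^sup>+x. ennreal (min ((f n x)\<^sup>2) 1) \<partial>M) \<longlonglongrightarrow> (\<integral>\<^sup>+x. 0 \<partial>M)"
  proof (rule nn_integral_dominated_convergence[where w="\<lambda>x. 1"])
    show "(\<integral>\<^sup>+x. 1 \<partial>M) < \<infinity>" by (simp add: less_top[symmetric] emeasure_finite)
    show "AE x in M. (\<lambda>i. ennreal (min ((f i x)\<^sup>2) 1)) \<longlonglongrightarrow> 0"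
      using assms(2) by eventually_elim (rule min_sq_tendsto_0)
  qed (auto intro!: ennreal_le_1[THEN iffD2])
  then show ?thesis by (simp add: modular_def)
qed

text \<open>Turns a Cauchy estimate into a limit estimate: with one index fixed, a bound valid for
  all large values of the other index passes to the almost everywhere limit.\<close>

lemma modular_Fatou:
  assumes [measurable]: "\<And>n. f n \<in> borel_measurable P"
    and "AE x in P. (\<lambda>n. f n x) \<longlonglongrightarrow> g x"
    and "\<forall>\<^sub>F n in sequentially. modular P (f n) \<le> e"
  shows "modular P g \<le> e"
proof -
  have "modular P g = (\<integral>\<^sup>+x. liminf (\<lambda>n. ennreal (min ((f n x)\<^sup>2) 1)) \<partial>P)"
    unfolding modular_def
  proof (rule nn_integral_cong_AE)
    show "AE x in P. ennreal (min ((g x)\<^sup>2) 1) = liminf (\<lambda>n. ennreal (min ((f n x)\<^sup>2) 1))"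
      using assms(2)
    proof eventually_elim
      case (elim x)
      have "(\<lambda>n. ennreal (min ((f n x)\<^sup>2) 1)) \<longlonglongrightarrow> ennreal (min ((g x)\<^sup>2) 1)"
        by (intro tendsto_ennrealI tendsto_intros elim)
      from lim_imp_Liminf[OF _ this] show ?case by simp
    qed
  qed
  also have "\<dots> \<le> liminf (\<lambda>n. modular P (f n))"
    unfolding modular_def by (rule nn_integral_liminf) simp
  also have "\<dots> \<le> liminf (\<lambda>n::nat. e)"
    by (rule Liminf_mono) (rule assms(3))
  finally show ?thesis by (simp add: Liminf_const)
qed

text \<open>The truncated squares tend to 0 in L1, so a subsequence does so almost everywhere. The
  measure may be infinite and finitely many early modulars may be infinite as well; the shift by
  \<open>n0\<close> drops them, leaving integrable functions.\<close>

lemma modular_subseq_AE: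
  assumes [measurable]: "\<And>n. f n \<in> borel_measurable P"
    and "(\<lambda>n. modular P (f n)) \<longlonglongrightarrow> 0"
  obtains r :: "nat \<Rightarrow> nat" where "strict_mono r" "AE x in P. (\<lambda>n. f (r n) x) \<longlonglongrightarrow> 0"
proof -
  obtain n0 where n0: "\<And>n. n \<ge> n0 \<Longrightarrow> modular P (f n) < 1"
    using order_tendstoD(2)[OF assms(2), of 1] by (auto simp: eventually_sequentially)
  define h where "h n x = min ((f (n + n0) x)\<^sup>2) 1" for n x
  have [measurable]: "h n \<in> borel_measurable P" for n unfolding h_def by simp
  have h0: "h n x \<ge> 0" for n x by (simp add: h_def)
  have int: "integrable P (h n)" for n
  proof (rule integrableI_nonneg)
    show "(\<integral>\<^sup>+x. ennreal (h n x) \<partial>P) < \<infinity>"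
      using n0[of "n + n0"] by (auto simp: modular_def h_def intro: less_trans)
  qed (auto simp: h0)
  have "(\<lambda>n. modular P (f (n + n0))) \<longlonglongrightarrow> 0"
    using assms(2) by (rule LIMSEQ_ignore_initial_segment)
  then have "(\<lambda>n. \<integral>\<^sup>+x. norm (h n x) \<partial>P) \<longlonglongrightarrow> 0"
    using h0 by (simp add: modular_def h_def)
  then have "(\<lambda>n. (LINT x|P. norm (h n x))) \<longlonglongrightarrow> 0"
    by (subst (asm) nn_integral_eq_integral) (auto intro!: int simp: tendsto_ennreal_iff
       simp flip: ennreal_0)
  from tendsto_L1_AE_subseq[of P h, OF int this]
  obtain r where r: "strict_mono r" "AE x in P. (\<lambda>n. h (r n) x) \<longlonglongrightarrow> 0" by blast
  \<comment> \<open>Once the minimum is below 1 it is the square itself.\<close>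
  have sq: "(\<lambda>n. g n) \<longlonglongrightarrow> 0" if g: "(\<lambda>n. min ((g n)\<^sup>2) 1) \<longlonglongrightarrow> (0::real)" for g :: "nat \<Rightarrow> real"
  proof -
    have "\<forall>\<^sub>F n in sequentially. min ((g n)\<^sup>2) 1 < 1" using order_tendstoD(2)[OF g, of 1] by simp
    then have "\<forall>\<^sub>F n in sequentially. min ((g n)\<^sup>2) 1 = (g n)\<^sup>2" by eventually_elim auto
    from Lim_transform_eventually[OF g this] have "(\<lambda>n. (g n)\<^sup>2) \<longlonglongrightarrow> 0" .
    then have "(\<lambda>n. sqrt ((g n)\<^sup>2)) \<longlonglongrightarrow> sqrt 0" by (rule tendsto_real_sqrt)
    then show ?thesis by (simp add: tendsto_rabs_zero_iff)
  qed
  show ?thesis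
  proof (rule that[of "\<lambda>n. r n + n0"])
    show "strict_mono (\<lambda>n. r n + n0)" using r(1) by (simp add: strict_mono_def)
    show "AE x in P. (\<lambda>n. f (r n + n0) x) \<longlonglongrightarrow> 0"
      using r(2) by eventually_elim (rule sq, simp add: h_def)
  qed
qed

text \<open>The rate 1/8 leaves room for the weight \<open>4 ^ n\<close>: the weighted truncated
  squares of the increments still have a summable integral, so almost everywhere they tend to 0,
  which forces increments of size at most \<open>(1/2) ^ n\<close> eventually. The sequence then
  converges as a telescoping sum.\<close>

lemma modular_geometric_convergent:
  assumes [measurable]: "\<And>n. f n \<in> borel_measurable P"
    and le: "\<And>n. modular P (\<lambda>x. f (Suc n) x - f n x) \<le> ennreal (C * (1/8) ^ n)" and "C \<ge> 0"
  shows "AE x in P. convergent (\<lambda>n. f n x)"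
proof -
  define d where "d n x = f (Suc n) x - f n x" for n x
  have [measurable]: "d n \<in> borel_measurable P" for n unfolding d_def by simp
  have "(\<integral>\<^sup>+x. (\<Sum>n. ennreal (4 ^ n * min ((d n x)\<^sup>2) 1)) \<partial>P) =
      (\<Sum>n. \<integral>\<^sup>+x. ennreal (4 ^ n * min ((d n x)\<^sup>2) 1) \<partial>P)"
    by (rule nn_integral_suminf) simp
  also have "\<dots> \<le> (\<Sum>n. ennreal (C * (1/2) ^ n))"
  proof (rule suminf_le)
    fix n
    have "(\<integral>\<^sup>+x. ennreal (4 ^ n * min ((d n x)\<^sup>2) 1) \<partial>P) = ennreal (4 ^ n) * modular P (d n)"
      by (simp add: modular_def ennreal_mult' nn_integral_cmult)
    also have "\<dots> \<le> ennreal (4 ^ n) * ennreal (C * (1/8) ^ n)"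
      using le[of n] by (intro mult_left_mono) (simp_all add: d_def[abs_def])
    also have "\<dots> = ennreal (C * (1/2) ^ n)"
    proof -
      have "(4::real) ^ n * (1/8) ^ n = (1/2) ^ n" by (simp flip: power_mult_distrib)
      then show ?thesis using \<open>C \<ge> 0\<close> by (simp flip: ennreal_mult' add: mult.left_commute)
    qed
    finally show "(\<integral>\<^sup>+x. ennreal (4 ^ n * min ((d n x)\<^sup>2) 1) \<partial>P) \<le> ennreal (C * (1/2) ^ n)" .
  qed auto
  also have "\<dots> = ennreal (\<Sum>n. C * (1/2) ^ n)"
    using \<open>C \<ge> 0\<close> by (intro suminf_ennreal_eq summable_sums summable_mult summable_geometric) auto
  also have "\<dots> < \<infinity>" by simp
  finally have fin: "(\<integral>\<^sup>+x. (\<Sum>n. ennreal (4 ^ n * min ((d n x)\<^sup>2) 1)) \<partial>P) \<noteq> \<infinity>"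
    by (simp only: less_top infinity_ennreal_def)
  have "AE x in P. (\<Sum>n. ennreal (4 ^ n * min ((d n x)\<^sup>2) 1)) \<noteq> \<infinity>"
    by (rule nn_integral_PInf_AE[OF _ fin]) measurable
  then show ?thesis
  proof eventually_elim
    case (elim x)
    have "summable (\<lambda>n. 4 ^ n * min ((d n x)\<^sup>2) 1)"
      by (rule summable_suminf_not_top[OF _ elim[unfolded infinity_ennreal_def]]) simp
    then have "(\<lambda>n. 4 ^ n * min ((d n x)\<^sup>2) 1) \<longlonglongrightarrow> 0" by (rule summable_LIMSEQ_zero)
    then have "\<forall>\<^sub>F n in sequentially. 4 ^ n * min ((d n x)\<^sup>2) 1 < 1"
      by (rule order_tendstoD) simp
    then have "\<forall>\<^sub>F n in sequentially. norm (d n x) \<le> (1/2) ^ n"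
    proof eventually_elim
      case (elim n)
      have "(1::real) \<le> 4 ^ n" by simp
      then have "\<not> 1 \<le> (d n x)\<^sup>2" using elim by (metis min_absorb2 mult.right_neutral not_less)
      then have "4 ^ n * (d n x)\<^sup>2 < 1" using elim by (auto simp: min_def)
      then have "(2 ^ n * \<bar>d n x\<bar>)\<^sup>2 \<le> 1\<^sup>2"
        by (simp add: power_mult_distrib power_mult[symmetric] mult.commute[of n 2])
          (simp add: power_mult)
      then have "2 ^ n * \<bar>d n x\<bar> \<le> 1" by (rule power2_le_imp_le) simp
      then show ?case by (simp add: power_one_over field_simps)
    qed
    then have "summable (\<lambda>n. d n x)"
      by (rule summable_comparison_test_ev) (simp add: summable_geometric)
    then have "convergent (\<lambda>n. \<Sum>i<n. d i x)" by (simp add: summable_iff_convergent)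
    moreover have "(\<Sum>i<n. d i x) = f n x - f 0 x" for n
      unfolding d_def by (rule sum_lessThan_telescope)
    ultimately have "convergent (\<lambda>n. f n x - f 0 x)" by simp
    then show ?case by (simp add: convergent_diff_const_right_iff)
  qed
qed

text \<open>With p the probability of a deviation above e and m the modular, Markov's inequality
  gives one half, \<open>min (e\<^sup>2) 1 * p \<le> m\<close>, and splitting at the level e gives
  the other, \<open>m \<le> e\<^sup>2 + p\<close>.\<close>

lemma (in prob_space) converges_in_prob_iff_modular:
  "converges_in_prob M Z Y \<longleftrightarrow>
    (\<forall>n. Z n \<in> borel_measurable M) \<and> Y \<in> borel_measurable M \<and>
    (\<lambda>n. modular M (\<lambda>\<omega>. Z n \<omega> - Y \<omega>)) \<longlonglongrightarrow> 0"
proof (cases "(\<forall>n. Z n \<in> borel_measurable M) \<and> Y \<in> borel_measurable M")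
  case True
  then have [measurable]: "\<And>n. Z n \<in> borel_measurable M" "Y \<in> borel_measurable M" by auto
  define p where "p e n = measure M {\<omega> \<in> space M. e < \<bar>Z n \<omega> - Y \<omega>\<bar>}" for e n
  define m where "m n = modular M (\<lambda>\<omega>. Z n \<omega> - Y \<omega>)" for n
  have 1: "ennreal (min (e\<^sup>2) 1) * ennreal (p e n) \<le> m n" if "e > 0" for e n
  proof -
    have "ennreal (min (e\<^sup>2) 1) * ennreal (p e n) =
        (\<integral>\<^sup>+\<omega>. ennreal (min (e\<^sup>2) 1) * indicator {\<omega> \<in> space M. e < \<bar>Z n \<omega> - Y \<omega>\<bar>} \<omega> \<partial>M)"
      by (subst nn_integral_cmult_indicator) (auto simp: p_def emeasure_eq_measure)
    also have "\<dots> \<le> m n" unfolding m_def modular_def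
    proof (rule nn_integral_mono)
      fix \<omega>
      have "min (e\<^sup>2) 1 \<le> min ((Z n \<omega> - Y \<omega>)\<^sup>2) 1" if "e < \<bar>Z n \<omega> - Y \<omega>\<bar>"
      proof -
        have "e\<^sup>2 \<le> (Z n \<omega> - Y \<omega>)\<^sup>2"
          using that \<open>e > 0\<close> by (intro abs_le_square_iff[THEN iffD1]) auto
        then show ?thesis by auto
      qed
      then show "ennreal (min (e\<^sup>2) 1) * indicator {\<omega> \<in> space M. e < \<bar>Z n \<omega> - Y \<omega>\<bar>} \<omega> \<le>
          ennreal (min ((Z n \<omega> - Y \<omega>)\<^sup>2) 1)"
        by (auto simp: indicator_def intro: ennreal_leI)
    qed
    finally show ?thesis .
  qed
  have 2: "m n \<le> ennreal (e\<^sup>2) + ennreal (p e n)" for e n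
  proof -
    have "m n \<le> (\<integral>\<^sup>+\<omega>. ennreal (e\<^sup>2) + indicator {\<omega> \<in> space M. e < \<bar>Z n \<omega> - Y \<omega>\<bar>} \<omega> \<partial>M)"
      unfolding m_def modular_def
    proof (rule nn_integral_mono)
      fix \<omega> assume "\<omega> \<in> space M"
      have "min ((Z n \<omega> - Y \<omega>)\<^sup>2) 1 \<le> e\<^sup>2" if "\<not> e < \<bar>Z n \<omega> - Y \<omega>\<bar>"
      proof -
        have "(Z n \<omega> - Y \<omega>)\<^sup>2 \<le> e\<^sup>2"
          using that by (intro abs_le_square_iff[THEN iffD1]) auto
        then show ?thesis by auto
      qed
      moreover have "ennreal (min ((Z n \<omega> - Y \<omega>)\<^sup>2) 1) \<le> ennreal (e\<^sup>2) + 1"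
        by (rule order_trans[of _ 1]) (auto intro!: ennreal_le_1[THEN iffD2])
      ultimately show "ennreal (min ((Z n \<omega> - Y \<omega>)\<^sup>2) 1) \<le>
          ennreal (e\<^sup>2) + indicator {\<omega> \<in> space M. e < \<bar>Z n \<omega> - Y \<omega>\<bar>} \<omega>"
        using \<open>\<omega> \<in> space M\<close> by (auto simp: indicator_def intro: ennreal_leI)
    qed
    also have "\<dots> = ennreal (e\<^sup>2) + ennreal (p e n)"
      by (subst nn_integral_add) (auto simp: p_def emeasure_eq_measure emeasure_space_1 prob_space)
    finally show ?thesis .
  qed
  have "(\<forall>e>0. p e \<longlonglongrightarrow> 0) \<longleftrightarrow> m \<longlonglongrightarrow> 0"
  proof
    assume p: "\<forall>e>0. p e \<longlonglongrightarrow> 0"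
    show "m \<longlonglongrightarrow> 0"
      unfolding tendsto_0_ennreal_iff
    proof (intro allI impI)
      fix b :: real assume b: "0 < b"
      \<comment> \<open>The level \<open>sqrt (b/2)\<close> makes the squared level in the bound
        \<open>2\<close> equal to half of b.\<close>
      have "\<forall>\<^sub>F n in sequentially. p (sqrt (b/2)) n < b/2"
        using p b order_tendstoD(2)[of "p (sqrt (b/2))" 0 sequentially "b/2"] by auto
      then show "\<forall>\<^sub>F n in sequentially. m n \<le> ennreal b"
      proof eventually_elim
        case (elim n)
        have "m n \<le> ennreal (b/2) + ennreal (p (sqrt (b/2)) n)"
          using 2[of n "sqrt (b/2)"] b by simp
        also have "\<dots> \<le> ennreal (b/2) + ennreal (b/2)"
          using elim by (intro add_left_mono ennreal_leI) simp
        also have "\<dots> = ennreal b" using b by (simp flip: ennreal_plus)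
        finally show ?case .
      qed
    qed
  next
    assume m: "m \<longlonglongrightarrow> 0"
    show "\<forall>e>0. p e \<longlonglongrightarrow> 0"
    proof (intro allI impI)
      fix e :: real assume "e > 0"
      define c where "c = min (e\<^sup>2) 1"
      have c: "c > 0" using \<open>e > 0\<close> by (simp add: c_def)
      have "ennreal (p e n) \<le> ennreal (1/c) * m n" for n
      proof -
        have "ennreal (p e n) = ennreal (1/c) * (ennreal c * ennreal (p e n))"
          using c by (simp add: p_def flip: ennreal_mult')
        also have "\<dots> \<le> ennreal (1/c) * m n"
          using 1[OF \<open>e > 0\<close>, of n] by (intro mult_left_mono) (auto simp: c_def)
        finally show ?thesis .
      qed
      moreover have "(\<lambda>n. ennreal (1/c) * m n) \<longlonglongrightarrow> ennreal (1/c) * 0"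
        by (intro ennreal_tendsto_cmult m) simp
      ultimately have "(\<lambda>n. ennreal (p e n)) \<longlonglongrightarrow> ennreal 0"
        using tendsto_sandwich[of "\<lambda>_. 0" "\<lambda>n. ennreal (p e n)" sequentially
            "\<lambda>n. ennreal (1/c) * m n" 0] by simp
      then show "p e \<longlonglongrightarrow> 0" by (subst (asm) tendsto_ennreal_iff) (auto simp: p_def)
    qed
  qed
  then show ?thesis using True by (simp add: converges_in_prob_def p_def[abs_def] m_def[abs_def])
next
  case False
  then show ?thesis by (auto simp: converges_in_prob_def)
qed

section \<open>Truncated squares compared with averaged cosines\<close>

lemma one_minus_cos_le: "1 - cos x \<le> 2 * min (x\<^sup>2) (1::real)"
proof -
  have "1 - cos x \<le> 2 * x\<^sup>2"
  proof -
    have "1 - cos x = 2 * (sin (x / 2))\<^sup>2"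
      using cos_double_sin[of "x/2"] by simp
    also have "(sin (x / 2))\<^sup>2 \<le> (x / 2)\<^sup>2"
      using abs_sin_x_le_abs_x[of "x/2"] by (simp only: abs_le_square_iff)
    finally have "2 - 2 * cos x \<le> x\<^sup>2" by (simp add: power_divide)
    then show ?thesis using zero_le_power2[of x] by linarith
  qed
  moreover have "1 - cos x \<le> 2" using cos_ge_minus_one[of x] by linarith
  ultimately show ?thesis by (simp add: min_def)
qed

text \<open>The right side is 8 times the mean of \<open>1 - cos (\<theta> * x)\<close> over
  \<theta> in [0,1]. For |x| \<le> 2 the Taylor bound of order five gives sin x / x \<le> 1 - x^2/6
  + x^4/120, and x^2 \<le> 4 leaves a coefficient 1/6 - 1/30 \<ge> 1/8, the origin of the factor 8.
  For |x| > 2 the quotient is at most 1/2.\<close>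

lemma min_sq_le_sinc:
  assumes "x \<noteq> 0"
  shows "min (x\<^sup>2) 1 \<le> 8 * (1 - sin x / (x::real))"
proof -
  define y where "y = \<bar>x\<bar>"
  have y: "y > 0" using assms by (simp add: y_def)
  have xy: "sin x / x = sin y / y" "x\<^sup>2 = y\<^sup>2" by (auto simp: y_def abs_if)
  show ?thesis
  proof (cases "y \<le> 2")
    case True
    have "\<bar>sin y - (\<Sum>m<5. sin_coeff m * y ^ m)\<bar> \<le> inverse (fact 5) * \<bar>y\<bar> ^ 5"
      by (rule Maclaurin_sin_bound)
    moreover have "(\<Sum>m<5. sin_coeff m * y ^ m) = y - y ^ 3 / 6"
    proof -
      have "{..<5} = {0, 1, 2, 3, 4::nat}" by auto
      then show ?thesis by (simp add: sin_coeff_def fact_numeral)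
    qed
    moreover have "inverse (fact 5) = (1/120::real)" by (simp add: fact_numeral)
    ultimately have "\<bar>sin y - (y - y ^ 3 / 6)\<bar> \<le> y ^ 5 / 120" using y by simp
    then have "sin y \<le> y - y ^ 3 / 6 + y ^ 5 / 120" by linarith
    then have "sin y / y \<le> (y - y ^ 3 / 6 + y ^ 5 / 120) / y"
      using y by (simp add: divide_right_mono)
    also have "\<dots> = 1 - y\<^sup>2 / 6 + y\<^sup>2 * y\<^sup>2 / 120"
      using y by (simp add: field_simps eval_nat_numeral)
    also have "y\<^sup>2 * y\<^sup>2 \<le> y\<^sup>2 * 4"
    proof -
      have "y\<^sup>2 \<le> 2\<^sup>2" using True y by (intro power_mono) auto
      then show ?thesis by (intro mult_left_mono) auto
    qed
    finally have "sin y / y \<le> 1 - y\<^sup>2 / 8" using zero_le_power2[of y] by linarith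
    then show ?thesis unfolding xy by simp
  next
    case False
    have "sin y / y \<le> 1 / 2"
    proof -
      have "sin y * 2 \<le> y" using False sin_le_one[of y] by linarith
      then show ?thesis using y by (simp add: field_simps)
    qed
    then show ?thesis unfolding xy by simp
  qed
qed

text \<open>No single \<theta> would do, since \<open>1 - cos (\<theta> * x)\<close> has zeros at
  nonzero x; averaging removes them. The integral is evaluated with the antiderivative
  \<open>\<theta> - sin (\<theta> * x) / x\<close>.\<close>

lemma min_sq_le_cos_average:
  "ennreal (min (x\<^sup>2) 1) \<le> 8 * (\<integral>\<^sup>+\<theta>. ennreal (1 - cos (\<theta> * x)) * indicator {0..1} \<theta> \<partial>lborel)"
proof (cases "x = 0")
  case False
  have "(\<integral>\<^sup>+\<theta>. ennreal (1 - cos (\<theta> * x)) * indicator {0..1} \<theta> \<partial>lborel) =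
      ennreal ((1 - sin (1 * x) / x) - (0 - sin (0 * x) / x))"
    by (rule nn_integral_FTC_Icc) (use False in \<open>auto intro!: derivative_eq_intros\<close>)
  then have "8 * (\<integral>\<^sup>+\<theta>. ennreal (1 - cos (\<theta> * x)) * indicator {0..1} \<theta> \<partial>lborel) =
      ennreal (8 * (1 - sin x / x))"
    by (subst ennreal_mult'[of 8]) simp_all
  then show ?thesis using min_sq_le_sinc[OF False] by (simp add: ennreal_leI)
qed simp

text \<open>Tonelli's theorem. The setting is a sigma-finite measure because the bound is applied
  both to \<open>M\<close> and to the intensity measure.\<close>

lemma (in sigma_finite_measure) modular_le_cos_average:
  assumes [measurable]: "f \<in> borel_measurable M"
  shows "modular M f \<le>
    8 * (\<integral>\<^sup>+\<theta>. (\<integral>\<^sup>+x. ennreal (1 - cos (\<theta> * f x)) \<partial>M) * indicator {0..1} \<theta> \<partial>lborel)"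
proof -
  interpret L: pair_sigma_finite lborel M
    by (intro pair_sigma_finite.intro sigma_finite_lborel sigma_finite_measure_axioms)
  have "modular M f \<le>
      (\<integral>\<^sup>+x. 8 * (\<integral>\<^sup>+\<theta>. ennreal (1 - cos (\<theta> * f x)) * indicator {0..1} \<theta> \<partial>lborel) \<partial>M)"
    unfolding modular_def by (intro nn_integral_mono min_sq_le_cos_average)
  also have "\<dots> = 8 * (\<integral>\<^sup>+x. (\<integral>\<^sup>+\<theta>. ennreal (1 - cos (\<theta> * f x)) * indicator {0..1} \<theta> \<partial>lborel) \<partial>M)"
    by (rule nn_integral_cmult) measurable
  also have "(\<integral>\<^sup>+x. (\<integral>\<^sup>+\<theta>. ennreal (1 - cos (\<theta> * f x)) * indicator {0..1} \<theta> \<partial>lborel) \<partial>M) =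
      (\<integral>\<^sup>+\<theta>. (\<integral>\<^sup>+x. ennreal (1 - cos (\<theta> * f x)) * indicator {0..1} \<theta> \<partial>M) \<partial>lborel)"
    by (rule L.Fubini') measurable
  also have "\<dots> = (\<integral>\<^sup>+\<theta>. (\<integral>\<^sup>+x. ennreal (1 - cos (\<theta> * f x)) \<partial>M) * indicator {0..1} \<theta> \<partial>lborel)"
    by (intro nn_integral_cong nn_integral_multc) measurable
  finally show ?thesis .
qed

lemma one_minus_cos_scaled_le:
  assumes "\<theta> \<in> {0..1}"
  shows "1 - cos (\<theta> * x) \<le> 2 * min (x\<^sup>2) (1::real)"
proof -
  have "\<bar>\<theta> * x\<bar> \<le> \<bar>x\<bar>" using assms by (simp add: abs_mult mult_left_le_one_le)
  then have "(\<theta> * x)\<^sup>2 \<le> x\<^sup>2" by (simp only: abs_le_square_iff)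
  with one_minus_cos_le[of "\<theta> * x"] show ?thesis by (auto simp: min_def split: if_splits)
qed

lemma nn_integral_one_minus_cos_le:
  assumes [measurable]: "f \<in> borel_measurable P" and "\<theta> \<in> {0..1}"
  shows "(\<integral>\<^sup>+x. ennreal (1 - cos (\<theta> * f x)) \<partial>P) \<le> 2 * modular P f"
proof -
  have "(\<integral>\<^sup>+x. ennreal (1 - cos (\<theta> * f x)) \<partial>P) \<le> (\<integral>\<^sup>+x. 2 * ennreal (min ((f x)\<^sup>2) 1) \<partial>P)"
  proof (rule nn_integral_mono)
    fix x
    have "ennreal (1 - cos (\<theta> * f x)) \<le> ennreal (2 * min ((f x)\<^sup>2) 1)"
      using one_minus_cos_scaled_le[OF assms(2)] by (rule ennreal_leI)
    then show "ennreal (1 - cos (\<theta> * f x)) \<le> 2 * ennreal (min ((f x)\<^sup>2) 1)"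
      by (simp add: ennreal_mult')
  qed
  also have "\<dots> = 2 * modular P f" by (simp add: modular_def nn_integral_cmult)
  finally show ?thesis .
qed

section \<open>Sampling of integrals\<close>

text \<open>Expanding the square, the off-diagonal terms factor into products of means and vanish;
  each of the N diagonal terms is at most the square of m.\<close>

lemma (in prob_space) iid_sum_second_moment_le:
  assumes [measurable]: "g \<in> borel_measurable M" and bd: "\<And>t. t \<in> space M \<Longrightarrow> \<bar>g t\<bar> \<le> (m::real)"
    and mean: "(\<integral>t. g t \<partial>M) = 0"
  shows "(\<integral>\<tau>. (\<Sum>j<N. g (\<tau> j))\<^sup>2 \<partial>PiM {..<N::nat} (\<lambda>_. M)) \<le> real N * m\<^sup>2"
proof -
  interpret PP: prob_space "PiM {..<N} (\<lambda>_::nat. M)" by (intro prob_space_PiM prob_space_axioms)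
  interpret P: product_prob_space "\<lambda>_::nat. M" "{..<N}" ..
  let ?P = "PiM {..<N} (\<lambda>_::nat. M)"
  have [measurable]: "(\<lambda>\<tau>. \<tau> j) \<in> measurable ?P M" if "j < N" for j
    using that by (intro measurable_component_singleton) auto
  have m0: "0 \<le> m" using bd not_empty by (metis abs_ge_zero all_not_in_conv order_trans)
  have g_in: "\<bar>g (\<tau> j)\<bar> \<le> m" if "\<tau> \<in> space ?P" "j < N" for \<tau> j
    using that by (intro bd) (auto simp: space_PiM)
  have int2: "integrable ?P (\<lambda>\<tau>. g (\<tau> j) * g (\<tau> k))" if "j < N" "k < N" for j k
  proof (rule PP.integrable_const_bound[where B="m * m"])
    show "AE \<tau> in ?P. norm (g (\<tau> j) * g (\<tau> k)) \<le> m * m"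
      using g_in that m0 by (intro AE_I2) (auto simp: abs_mult intro!: mult_mono)
  qed (use that in measurable)
  have int1: "integrable M g" by (rule integrable_const_bound[where B=m]) (auto simp: bd)
  have cross: "(\<integral>\<tau>. g (\<tau> j) * g (\<tau> k) \<partial>?P) = 0" if "j < N" "k < N" "j \<noteq> k" for j k
  proof -
    \<comment> \<open>Constant factors 1 in the remaining coordinates let the product formula over
      all of \<open>{..<N}\<close> handle a product of two coordinates.\<close>
    define f where "f i = (if i \<in> {j, k} then g else (\<lambda>_. 1))" for i
    have "(\<Prod>i<N. f i (\<tau> i)) = g (\<tau> j) * g (\<tau> k)" for \<tau>
    proof -
      have "(\<Prod>i<N. f i (\<tau> i)) = (\<Prod>i\<in>{j, k}. f i (\<tau> i))"
        using that by (intro prod.mono_neutral_right) (auto simp: f_def)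
      then show ?thesis using that by (simp add: f_def)
    qed
    then have "(\<integral>\<tau>. g (\<tau> j) * g (\<tau> k) \<partial>?P) = (\<Prod>i<N. integral\<^sup>L M (f i))"
      using P.product_integral_prod[of "{..<N}" f] int1 by (simp add: f_def)
    also have "\<dots> = 0" using that mean by (intro prod_zero) (auto simp: f_def intro!: bexI[of _ j])
    finally show ?thesis .
  qed
  have diag: "(\<integral>\<tau>. g (\<tau> j) * g (\<tau> j) \<partial>?P) \<le> m\<^sup>2" if "j < N" for j
  proof -
    have "(\<integral>\<tau>. g (\<tau> j) * g (\<tau> j) \<partial>?P) \<le> (\<integral>\<tau>. m\<^sup>2 \<partial>?P)"
    proof (rule integral_mono)
      show "integrable ?P (\<lambda>\<tau>. g (\<tau> j) * g (\<tau> j))" by (rule int2[OF that that])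
      show "g (\<tau> j) * g (\<tau> j) \<le> m\<^sup>2" if "\<tau> \<in> space ?P" for \<tau>
        using g_in[OF that \<open>j < N\<close>] by (metis abs_le_square_iff abs_of_nonneg m0 power2_eq_square)
    qed simp
    then show ?thesis by (simp add: PP.prob_space)
  qed
  have "(\<integral>\<tau>. (\<Sum>j<N. g (\<tau> j))\<^sup>2 \<partial>?P) = (\<integral>\<tau>. (\<Sum>j<N. \<Sum>k<N. g (\<tau> j) * g (\<tau> k)) \<partial>?P)"
    by (simp add: power2_eq_square sum_product)
  also have "\<dots> = (\<Sum>j<N. \<Sum>k<N. \<integral>\<tau>. g (\<tau> j) * g (\<tau> k) \<partial>?P)"
    by (subst Bochner_Integration.integral_sum) (auto intro!: sum.cong Bochner_Integration.integral_sum int2)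
  also have "\<dots> = (\<Sum>j<N. \<Sum>k<N. if k = j then \<integral>\<tau>. g (\<tau> j) * g (\<tau> j) \<partial>?P else 0)"
    using cross by (intro sum.cong) auto
  also have "\<dots> = (\<Sum>j<N. \<integral>\<tau>. g (\<tau> j) * g (\<tau> j) \<partial>?P)" by simp
  also have "\<dots> \<le> (\<Sum>j<N. m\<^sup>2)" by (intro sum_mono diag) simp
  finally show ?thesis by simp
qed

text \<open>The bound depends on \<open>f\<close> only through m, so it can later be integrated over
  a parameter on which \<open>f\<close> depends. Centring doubles the bound m, hence
  \<open>4 * m\<^sup>2\<close>.\<close>

lemma (in prob_space) iid_average_deviation_le:
  assumes [measurable]: "f \<in> borel_measurable M" and bd: "\<And>t. t \<in> space M \<Longrightarrow> \<bar>f t\<bar> \<le> (m::real)"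
    and "N > 0"
  shows "(\<integral>\<^sup>+\<tau>. ennreal \<bar>(\<Sum>j<N. f (\<tau> j)) / N - (\<integral>t. f t \<partial>M)\<bar> \<partial>PiM {..<N::nat} (\<lambda>_. M)) \<le>
    ennreal ((1 + 4 * m\<^sup>2) / sqrt N)"
proof -
  interpret PP: prob_space "PiM {..<N} (\<lambda>_::nat. M)" by (intro prob_space_PiM prob_space_axioms)
  interpret P: product_prob_space "\<lambda>_::nat. M" "{..<N}" ..
  let ?P = "PiM {..<N} (\<lambda>_::nat. M)"
  define a where "a = (\<integral>t. f t \<partial>M)"
  define g where "g t = f t - a" for t
  have [measurable]: "g \<in> borel_measurable M" unfolding g_def by measurable
  have int: "integrable M f" by (rule integrable_const_bound[where B=m]) (auto simp: bd)
  have "\<bar>a\<bar> \<le> m"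
  proof -
    have "\<bar>a\<bar> \<le> (\<integral>t. \<bar>f t\<bar> \<partial>M)" unfolding a_def by (rule integral_abs_bound)
    also have "\<dots> \<le> (\<integral>t. m \<partial>M)" using int bd by (intro integral_mono) auto
    finally show ?thesis by (simp add: prob_space)
  qed
  then have gb: "\<bar>g t\<bar> \<le> 2 * m" if "t \<in> space M" for t using bd[OF that] by (simp add: g_def)
  have g0: "(\<integral>t. g t \<partial>M) = 0" using int by (simp add: g_def a_def prob_space)
  define Z where "Z \<tau> = (\<Sum>j<N. g (\<tau> j))" for \<tau>
  have [measurable]: "Z \<in> borel_measurable ?P" unfolding Z_def by measurable
  have Zb: "\<bar>Z \<tau>\<bar> \<le> N * (2 * m)" if "\<tau> \<in> space ?P" for \<tau>
  proof -
    have "\<bar>Z \<tau>\<bar> \<le> (\<Sum>j<N. \<bar>g (\<tau> j)\<bar>)" unfolding Z_def by (rule sum_abs)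
    also have "\<dots> \<le> (\<Sum>j<N. 2 * m)"
      using that by (intro sum_mono gb) (auto simp: space_PiM)
    finally show ?thesis by simp
  qed
  have intZ: "integrable ?P (\<lambda>\<tau>. (Z \<tau>)\<^sup>2)"
  proof (rule PP.integrable_const_bound[where B="(N * (2 * m))\<^sup>2"])
    show "AE \<tau> in ?P. norm ((Z \<tau>)\<^sup>2) \<le> (N * (2 * m))\<^sup>2"
    proof (rule AE_I2)
      fix \<tau> assume "\<tau> \<in> space ?P"
      from Zb[OF this] have "\<bar>Z \<tau>\<bar>\<^sup>2 \<le> (N * (2 * m))\<^sup>2" by (intro power_mono) auto
      then show "norm ((Z \<tau>)\<^sup>2) \<le> (N * (2 * m))\<^sup>2" by simp
    qed
  qed simp
  \<comment> \<open>With \<open>s = sqrt N\<close>, the inequality |Z| s \<le> s^2 + Z^2 trades the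
    absolute value for a square, so the second moment gives an L1 bound without taking the root of
    an integral.\<close>
  have "\<bar>(\<Sum>j<N. f (\<tau> j)) / N - a\<bar> \<le> 1 / sqrt N + (Z \<tau>)\<^sup>2 / (N * sqrt N)" for \<tau>
  proof -
    define s where "s = sqrt N"
    have s: "s > 0" "real N = s * s" using \<open>N > 0\<close> by (auto simp: s_def)
    have "(\<Sum>j<N. f (\<tau> j)) / N - a = Z \<tau> / N"
      using \<open>N > 0\<close> by (simp add: Z_def g_def sum_subtractf field_simps)
    moreover have "\<bar>Z \<tau>\<bar> / (s * s) \<le> 1 / s + (Z \<tau>)\<^sup>2 / (s * s * s)"
    proof -
      have "0 \<le> (s - \<bar>Z \<tau>\<bar>)\<^sup>2 + s * \<bar>Z \<tau>\<bar>" using s by simp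
      then have "\<bar>Z \<tau>\<bar> * s \<le> s * s + (Z \<tau>)\<^sup>2"
        by (simp add: power2_eq_square algebra_simps)
      then have "\<bar>Z \<tau>\<bar> * s / (s * s * s) \<le> (s * s + (Z \<tau>)\<^sup>2) / (s * s * s)"
        using s by (intro divide_right_mono) auto
      then show ?thesis using s by (simp add: add_divide_distrib)
    qed
    ultimately show ?thesis using s by (simp add: s_def[symmetric])
  qed
  then have "(\<integral>\<^sup>+\<tau>. ennreal \<bar>(\<Sum>j<N. f (\<tau> j)) / N - a\<bar> \<partial>?P) \<le>
      (\<integral>\<^sup>+\<tau>. ennreal (1 / sqrt N + (Z \<tau>)\<^sup>2 / (N * sqrt N)) \<partial>?P)"
    by (intro nn_integral_mono ennreal_leI)
  also have "\<dots> = ennreal (\<integral>\<tau>. 1 / sqrt N + (Z \<tau>)\<^sup>2 / (N * sqrt N) \<partial>?P)"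
    using intZ by (intro nn_integral_eq_integral) auto
  finally have 1: "(\<integral>\<^sup>+\<tau>. ennreal \<bar>(\<Sum>j<N. f (\<tau> j)) / N - a\<bar> \<partial>?P) \<le>
      ennreal (\<integral>\<tau>. 1 / sqrt N + (Z \<tau>)\<^sup>2 / (N * sqrt N) \<partial>?P)" .
  have "(\<integral>\<tau>. 1 / sqrt N + (Z \<tau>)\<^sup>2 / (N * sqrt N) \<partial>?P) =
      1 / sqrt N + (\<integral>\<tau>. (Z \<tau>)\<^sup>2 \<partial>?P) / (N * sqrt N)"
    using intZ by (simp add: PP.prob_space)
  also have "\<dots> \<le> 1 / sqrt N + (N * (2 * m)\<^sup>2) / (N * sqrt N)"
    using iid_sum_second_moment_le[of g "2 * m" N, OF _ gb g0] \<open>N > 0\<close>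
    by (intro add_left_mono divide_right_mono) (auto simp: Z_def)
  also have "\<dots> = (1 + 4 * m\<^sup>2) / sqrt N"
    using \<open>N > 0\<close> by (simp add: power_mult_distrib add_divide_distrib)
  finally have "(\<integral>\<tau>. 1 / sqrt N + (Z \<tau>)\<^sup>2 / (N * sqrt N) \<partial>?P) \<le> (1 + 4 * m\<^sup>2) / sqrt N" .
  from order_trans[OF 1 ennreal_leI[OF this]] show ?thesis by (simp add: a_def)
qed

section \<open>A law of large numbers in L1 for integrands with a parameter\<close>

lemma nn_integral_truncation_tendsto_0:
  fixes v :: "'b \<Rightarrow> real"
  assumes "integrable P v"
  shows "(\<lambda>m::nat. \<integral>\<^sup>+p. ennreal \<bar>if \<bar>v p\<bar> \<le> m then 0 else v p\<bar> \<partial>P) \<longlonglongrightarrow> 0"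
proof -
  have [measurable]: "v \<in> borel_measurable P" using assms by auto
  have "(\<lambda>m::nat. \<integral>\<^sup>+p. ennreal \<bar>if \<bar>v p\<bar> \<le> m then 0 else v p\<bar> \<partial>P) \<longlonglongrightarrow> (\<integral>\<^sup>+p. 0 \<partial>P)"
  proof (rule nn_integral_dominated_convergence[where w="\<lambda>p. ennreal \<bar>v p\<bar>"])
    show "(\<integral>\<^sup>+p. ennreal \<bar>v p\<bar> \<partial>P) < \<infinity>" using assms by (simp add: integrable_iff_bounded)
    show "AE p in P. (\<lambda>m. ennreal \<bar>if \<bar>v p\<bar> \<le> real m then 0 else v p\<bar>) \<longlonglongrightarrow> 0"
    proof (rule AE_I2)
      fix p
      obtain k :: nat where "\<bar>v p\<bar> \<le> k" using real_arch_simple by blast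
      then have "\<forall>\<^sub>F m in sequentially. ennreal \<bar>if \<bar>v p\<bar> \<le> real m then 0 else v p\<bar> = 0"
        unfolding eventually_sequentially by (intro exI[of _ k]) auto
      then show "(\<lambda>m. ennreal \<bar>if \<bar>v p\<bar> \<le> real m then 0 else v p\<bar>) \<longlonglongrightarrow> 0"
        by (rule tendsto_eventually)
    qed
  qed (auto simp: AE_I2)
  then show ?thesis by simp
qed

text \<open>Only first moments of \<open>v\<close> are finite, so \<open>v\<close> is cut at a level
  m. The bounded part \<open>b\<close> has deviation of order 1 / sqrt N, uniformly in x; the
  remainder \<open>w\<close> has small L1 norm W, which enters twice, once through the sampled mean
  and once through the true mean. Hence the thirds of e.\<close>

lemma iid_average_L1:
  fixes v :: "'b \<times> 'c \<Rightarrow> real"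
  assumes "prob_space \<mu>" "finite_measure Q" and int: "integrable (\<mu> \<Otimes>\<^sub>M Q) v" and "e > 0"
  shows "\<forall>\<^sub>F N in sequentially.
    (\<integral>\<^sup>+\<tau>. (\<integral>\<^sup>+x. ennreal \<bar>(\<Sum>j<N. v (\<tau> j, x)) / N - (\<integral>t. v (t, x) \<partial>\<mu>)\<bar> \<partial>Q) \<partial>PiM {..<N::nat} (\<lambda>_. \<mu>))
      \<le> ennreal e"
proof -
  interpret \<mu>: prob_space \<mu> by fact
  interpret Q: finite_measure Q by fact
  interpret \<mu>Q: pair_sigma_finite \<mu> Q ..
  have v [measurable]: "v \<in> borel_measurable (\<mu> \<Otimes>\<^sub>M Q)" using int by auto
  obtain m :: nat where m: "(\<integral>\<^sup>+p. ennreal \<bar>if \<bar>v p\<bar> \<le> m then 0 else v p\<bar> \<partial>(\<mu> \<Otimes>\<^sub>M Q)) < ennreal (e / 3)"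
    using order_tendstoD(2)[OF nn_integral_truncation_tendsto_0[OF int], of "ennreal (e / 3)"] \<open>e > 0\<close>
    by (auto simp: eventually_sequentially)
  define w where "w p = (if \<bar>v p\<bar> \<le> m then 0 else v p)" for p
  define b where "b p = (if \<bar>v p\<bar> \<le> m then v p else 0)" for p
  have [measurable]: "w \<in> borel_measurable (\<mu> \<Otimes>\<^sub>M Q)" "b \<in> borel_measurable (\<mu> \<Otimes>\<^sub>M Q)"
    unfolding w_def b_def by measurable
  have vbw: "v p = b p + w p" for p by (simp add: w_def b_def)
  define W where "W = (\<integral>\<^sup>+p. ennreal \<bar>w p\<bar> \<partial>(\<mu> \<Otimes>\<^sub>M Q))"
  have W: "W \<le> ennreal (e / 3)" using m by (simp add: W_def w_def)
  define B where "B N = measure Q (space Q) * ((1 + 4 * (real m)\<^sup>2) / sqrt N)" for N :: nat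
  have "B \<longlonglongrightarrow> measure Q (space Q) * 0"
    unfolding B_def
    by (intro tendsto_intros real_tendsto_divide_at_top[of _ "1 + 4 * (real m)\<^sup>2"]
        filterlim_compose[OF sqrt_at_top] filterlim_real_sequentially)
  then have "\<forall>\<^sub>F N in sequentially. B N < e / 3" using \<open>e > 0\<close> by (intro order_tendstoD) auto
  moreover have "\<forall>\<^sub>F N::nat in sequentially. N > 0" by (rule eventually_gt_at_top)
  ultimately show ?thesis
  proof eventually_elim
    case (elim N)
    let ?P = "PiM {..<N} (\<lambda>_::nat. \<mu>)"
    interpret PP: prob_space ?P by (intro prob_space_PiM assms(1))
    interpret P: product_prob_space "\<lambda>_::nat. \<mu>" "{..<N}" ..
    interpret PQ: pair_sigma_finite ?P Q ..
    have comp [measurable]: "(\<lambda>\<tau>. \<tau> j) \<in> measurable ?P \<mu>" if "j < N" for j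
      using that by (intro measurable_component_singleton) auto
    define D1 where "D1 \<tau> x = ennreal \<bar>(\<Sum>j<N. b (\<tau> j, x)) / N - (\<integral>t. b (t, x) \<partial>\<mu>)\<bar>" for \<tau> x
    define D2 where "D2 \<tau> x = (\<Sum>j<N. ennreal (1 / N) * ennreal \<bar>w (\<tau> j, x)\<bar>)" for \<tau> x
    define D3 where "D3 x = (\<integral>\<^sup>+t. ennreal \<bar>w (t, x)\<bar> \<partial>\<mu>)" for x
    have [measurable]: "(\<lambda>p. D1 (fst p) (snd p)) \<in> borel_measurable (?P \<Otimes>\<^sub>M Q)"
      "(\<lambda>p. D2 (fst p) (snd p)) \<in> borel_measurable (?P \<Otimes>\<^sub>M Q)"
      "D3 \<in> borel_measurable Q"
      unfolding D1_def D2_def D3_def by measurable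
    have [measurable]: "case_prod D1 \<in> borel_measurable (?P \<Otimes>\<^sub>M Q)"
      "case_prod D2 \<in> borel_measurable (?P \<Otimes>\<^sub>M Q)"
      using \<open>(\<lambda>p. D1 (fst p) (snd p)) \<in> _\<close> \<open>(\<lambda>p. D2 (fst p) (snd p)) \<in> _\<close>
      by (simp_all add: case_prod_beta')
    \<comment> \<open>Off the integrable x the Bochner integral of \<open>v\<close> is 0 by
      convention and need not split into the parts for \<open>b\<close> and
      \<open>w\<close>.\<close>
    have AEint: "AE x in Q. integrable \<mu> (\<lambda>t. v (t, x))"
      using \<mu>Q.AE_integrable_snd[of "\<lambda>t x. v (t, x)"] int by simp
    have le: "AE x in Q. ennreal \<bar>(\<Sum>j<N. v (\<tau> j, x)) / N - (\<integral>t. v (t, x) \<partial>\<mu>)\<bar> \<le>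
        D1 \<tau> x + (D2 \<tau> x + D3 x)" if "\<tau> \<in> space ?P" for \<tau>
      using AEint AE_space
    proof eventually_elim
      case (elim x)
      have [measurable]: "(\<lambda>t. b (t, x)) \<in> borel_measurable \<mu>" "(\<lambda>t. w (t, x)) \<in> borel_measurable \<mu>"
        using elim(2) by measurable
      have intb: "integrable \<mu> (\<lambda>t. b (t, x))"
        by (rule Bochner_Integration.integrable_bound[OF elim(1)], measurable, auto simp: b_def)
      have intw: "integrable \<mu> (\<lambda>t. w (t, x))"
        by (rule Bochner_Integration.integrable_bound[OF elim(1)], measurable, auto simp: w_def)
      have "\<bar>(\<Sum>j<N. v (\<tau> j, x)) / N - (\<integral>t. v (t, x) \<partial>\<mu>)\<bar> \<le>
          \<bar>(\<Sum>j<N. b (\<tau> j, x)) / N - (\<integral>t. b (t, x) \<partial>\<mu>)\<bar> +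
          ((\<Sum>j<N. 1 / N * \<bar>w (\<tau> j, x)\<bar>) + (\<integral>t. \<bar>w (t, x)\<bar> \<partial>\<mu>))"
      proof -
        have "(\<integral>t. v (t, x) \<partial>\<mu>) = (\<integral>t. b (t, x) \<partial>\<mu>) + (\<integral>t. w (t, x) \<partial>\<mu>)"
          unfolding vbw using intb intw by (rule Bochner_Integration.integral_add)
        moreover have "(\<Sum>j<N. v (\<tau> j, x)) / N = (\<Sum>j<N. b (\<tau> j, x)) / N + (\<Sum>j<N. 1 / N * w (\<tau> j, x))"
          unfolding vbw by (simp add: sum.distrib add_divide_distrib sum_divide_distrib)
        moreover have "\<bar>\<integral>t. w (t, x) \<partial>\<mu>\<bar> \<le> (\<integral>t. \<bar>w (t, x)\<bar> \<partial>\<mu>)" by (rule integral_abs_bound)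
        moreover have "\<bar>\<Sum>j<N. 1 / N * w (\<tau> j, x)\<bar> \<le> (\<Sum>j<N. 1 / N * \<bar>w (\<tau> j, x)\<bar>)"
          by (rule order_trans[OF sum_abs]) (simp add: abs_mult)
        ultimately show ?thesis by linarith
      qed
      then have "ennreal \<bar>(\<Sum>j<N. v (\<tau> j, x)) / N - (\<integral>t. v (t, x) \<partial>\<mu>)\<bar> \<le>
          ennreal (\<bar>(\<Sum>j<N. b (\<tau> j, x)) / N - (\<integral>t. b (t, x) \<partial>\<mu>)\<bar> +
          ((\<Sum>j<N. 1 / N * \<bar>w (\<tau> j, x)\<bar>) + (\<integral>t. \<bar>w (t, x)\<bar> \<partial>\<mu>)))"
        by (rule ennreal_leI)
      also have "\<dots> = D1 \<tau> x + (ennreal (\<Sum>j<N. 1 / N * \<bar>w (\<tau> j, x)\<bar>) + ennreal (\<integral>t. \<bar>w (t, x)\<bar> \<partial>\<mu>))"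
        unfolding D1_def by (subst ennreal_plus[symmetric] | simp add: sum_nonneg)+
      also have "ennreal (\<Sum>j<N. 1 / N * \<bar>w (\<tau> j, x)\<bar>) = D2 \<tau> x"
      proof -
        have "D2 \<tau> x = (\<Sum>j<N. ennreal (1 / N * \<bar>w (\<tau> j, x)\<bar>))"
          unfolding D2_def by (intro sum.cong refl ennreal_mult'[symmetric]) simp
        then show ?thesis by (simp only: sum_ennreal) (simp add: sum_ennreal)
      qed
      also have "ennreal (\<integral>t. \<bar>w (t, x)\<bar> \<partial>\<mu>) = D3 x"
        unfolding D3_def using intw by (intro nn_integral_eq_integral[symmetric]) auto
      finally show ?case .
    qed
    have "(\<integral>\<^sup>+\<tau>. (\<integral>\<^sup>+x. ennreal \<bar>(\<Sum>j<N. v (\<tau> j, x)) / N - (\<integral>t. v (t, x) \<partial>\<mu>)\<bar> \<partial>Q) \<partial>?P) \<le>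
        (\<integral>\<^sup>+\<tau>. (\<integral>\<^sup>+x. D1 \<tau> x + (D2 \<tau> x + D3 x) \<partial>Q) \<partial>?P)"
      using le by (intro nn_integral_mono nn_integral_mono_AE)
    also have "\<dots> = (\<integral>\<^sup>+\<tau>. (\<integral>\<^sup>+x. D1 \<tau> x \<partial>Q) + ((\<integral>\<^sup>+x. D2 \<tau> x \<partial>Q) + (\<integral>\<^sup>+x. D3 x \<partial>Q)) \<partial>?P)"
    proof (rule nn_integral_cong)
      fix \<tau> assume \<tau>: "\<tau> \<in> space ?P"
      have [measurable]: "D1 \<tau> \<in> borel_measurable Q" "D2 \<tau> \<in> borel_measurable Q"
        using measurable_Pair2[OF \<open>case_prod D1 \<in> _\<close> \<tau>] measurable_Pair2[OF \<open>case_prod D2 \<in> _\<close> \<tau>] by simp_all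
      show "(\<integral>\<^sup>+x. D1 \<tau> x + (D2 \<tau> x + D3 x) \<partial>Q) =
          (\<integral>\<^sup>+x. D1 \<tau> x \<partial>Q) + ((\<integral>\<^sup>+x. D2 \<tau> x \<partial>Q) + (\<integral>\<^sup>+x. D3 x \<partial>Q))"
        by (simp add: nn_integral_add)
    qed
    also have "\<dots> = (\<integral>\<^sup>+\<tau>. (\<integral>\<^sup>+x. D1 \<tau> x \<partial>Q) \<partial>?P) + ((\<integral>\<^sup>+\<tau>. (\<integral>\<^sup>+x. D2 \<tau> x \<partial>Q) \<partial>?P) + (\<integral>\<^sup>+x. D3 x \<partial>Q))"
      by (simp add: nn_integral_add PP.emeasure_space_1)
    also have "(\<integral>\<^sup>+x. D3 x \<partial>Q) = W"
      unfolding D3_def W_def by (rule \<mu>Q.nn_integral_snd) simp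
    also have "(\<integral>\<^sup>+\<tau>. (\<integral>\<^sup>+x. D2 \<tau> x \<partial>Q) \<partial>?P) = W"
    proof -
      have "(\<integral>\<^sup>+\<tau>. (\<integral>\<^sup>+x. D2 \<tau> x \<partial>Q) \<partial>?P) =
          (\<integral>\<^sup>+\<tau>. (\<Sum>j<N. ennreal (1 / N) * (\<integral>\<^sup>+x. ennreal \<bar>w (\<tau> j, x)\<bar> \<partial>Q)) \<partial>?P)"
      proof (rule nn_integral_cong)
        fix \<tau> assume \<tau>: "\<tau> \<in> space ?P"
        have [measurable]: "(\<lambda>x. w (\<tau> j, x)) \<in> borel_measurable Q" if "j < N" for j
        proof -
          have "\<tau> j \<in> space \<mu>" using \<tau> that by (auto simp: space_PiM)
          then show ?thesis by measurable
        qed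
        show "(\<integral>\<^sup>+x. D2 \<tau> x \<partial>Q) = (\<Sum>j<N. ennreal (1 / N) * (\<integral>\<^sup>+x. ennreal \<bar>w (\<tau> j, x)\<bar> \<partial>Q))"
          unfolding D2_def by (subst nn_integral_sum) (auto simp: nn_integral_cmult)
      qed
      also have "\<dots> = (\<Sum>j<N. ennreal (1 / N) * (\<integral>\<^sup>+\<tau>. (\<integral>\<^sup>+x. ennreal \<bar>w (\<tau> j, x)\<bar> \<partial>Q) \<partial>?P))"
        by (subst nn_integral_sum) (auto simp: nn_integral_cmult intro!: sum.cong)
      also have "\<dots> = (\<Sum>j<N. ennreal (1 / N) * W)"
      proof (intro sum.cong refl arg_cong2[where f="(*)"])
        fix j assume "j \<in> {..<N}"
        then have j: "j < N" by simp
        have "(\<integral>\<^sup>+\<tau>. (\<integral>\<^sup>+x. ennreal \<bar>w (\<tau> j, x)\<bar> \<partial>Q) \<partial>?P) =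
            (\<integral>\<^sup>+t. (\<integral>\<^sup>+x. ennreal \<bar>w (t, x)\<bar> \<partial>Q) \<partial>distr ?P \<mu> (\<lambda>\<tau>. \<tau> j))"
          using j by (subst nn_integral_distr) auto
        also have "distr ?P \<mu> (\<lambda>\<tau>. \<tau> j) = \<mu>" using j by (intro P.PiM_component) simp
        also have "(\<integral>\<^sup>+t. (\<integral>\<^sup>+x. ennreal \<bar>w (t, x)\<bar> \<partial>Q) \<partial>\<mu>) = W"
          unfolding W_def by (rule Q.nn_integral_fst) simp
        finally show "(\<integral>\<^sup>+\<tau>. (\<integral>\<^sup>+x. ennreal \<bar>w (\<tau> j, x)\<bar> \<partial>Q) \<partial>?P) = W" .
      qed
      also have "\<dots> = W"
      proof -
        have "of_nat N * ennreal (1 / N) = 1"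
          using elim(2) by (simp add: ennreal_of_nat_eq_real_of_nat flip: ennreal_mult')
        then show ?thesis by (simp add: mult.assoc[symmetric])
      qed
      finally show ?thesis .
    qed
    also have "(\<integral>\<^sup>+\<tau>. (\<integral>\<^sup>+x. D1 \<tau> x \<partial>Q) \<partial>?P) \<le> ennreal (B N)"
    proof -
      have "(\<integral>\<^sup>+\<tau>. (\<integral>\<^sup>+x. D1 \<tau> x \<partial>Q) \<partial>?P) = (\<integral>\<^sup>+x. (\<integral>\<^sup>+\<tau>. D1 \<tau> x \<partial>?P) \<partial>Q)"
        by (rule PQ.Fubini'[symmetric]) simp
      also have "\<dots> \<le> (\<integral>\<^sup>+x. ennreal ((1 + 4 * (real m)\<^sup>2) / sqrt N) \<partial>Q)"
      proof (rule nn_integral_mono)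
        fix x assume "x \<in> space Q"
        then have "(\<lambda>t. b (t, x)) \<in> borel_measurable \<mu>" by measurable
        then show "(\<integral>\<^sup>+\<tau>. D1 \<tau> x \<partial>?P) \<le> ennreal ((1 + 4 * (real m)\<^sup>2) / sqrt N)"
          unfolding D1_def using elim(2)
          by (intro \<mu>.iid_average_deviation_le) (auto simp: b_def)
      qed
      also have "\<dots> = ennreal (B N)"
        unfolding B_def by (subst ennreal_mult') (simp_all add: Q.emeasure_eq_measure mult.commute)
      finally show ?thesis .
    qed
    also have "ennreal (B N) + (W + W) \<le> ennreal (e / 3) + (ennreal (e / 3) + ennreal (e / 3))"
      using elim(1) W by (intro add_mono ennreal_leI) auto
    also have "\<dots> = ennreal e" using \<open>e > 0\<close> by (simp flip: ennreal_plus)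
    finally show ?case by simp
  qed
qed

text \<open>Weighting by \<open>h x / (1 + \<integral>\<bar>v(t,x)\<bar> d\<mu>(t))\<close> reduces an almost everywhere statement to
  an integrable function without changing null sets.\<close>

lemma exists_integrating_density:
  fixes v :: "'b \<times> 'c \<Rightarrow> real"
  assumes "prob_space \<mu>" "sigma_finite_measure P" and [measurable]: "v \<in> borel_measurable (\<mu> \<Otimes>\<^sub>M P)"
    and int: "AE x in P. integrable \<mu> (\<lambda>t. v (t, x))"
  obtains Q where "finite_measure Q" "sets Q = sets P" "integrable (\<mu> \<Otimes>\<^sub>M Q) v"
    "\<And>\<phi>. (AE x in Q. \<phi> x) \<Longrightarrow> (AE x in P. \<phi> x)"
proof -
  interpret \<mu>: prob_space \<mu> by fact
  interpret P: sigma_finite_measure P by fact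
  interpret \<mu>P: pair_sigma_finite \<mu> P ..
  obtain h :: "'c \<Rightarrow> real" where h [measurable]: "h \<in> borel_measurable P"
    and h0: "\<And>x. 0 < h x" and hi: "integrable P h"
    using P.obtain_positive_integrable_function by metis
  define A where "A x = (\<integral>\<^sup>+t. ennreal \<bar>v (t, x)\<bar> \<partial>\<mu>)" for x
  have [measurable]: "A \<in> borel_measurable P" unfolding A_def by measurable
  \<comment> \<open>In \<open>ennreal\<close> the quotient is 0 where \<open>A x = \<top>\<close>
    and positive elsewhere, so Q forgets only a set that \<open>int\<close> makes null for P. The
    bound \<open>w x * A x \<le> h x\<close> is what makes the double integral finite.\<close>
  define w where "w x = ennreal (h x) / (1 + A x)" for x
  have [measurable]: "w \<in> borel_measurable P" unfolding w_def by measurable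
  have w_eq: "w x = (if A x = \<top> then 0 else ennreal (h x / (1 + enn2real (A x))))" for x
  proof (cases "A x")
    case (real a)
    then have "1 + A x = ennreal (1 + a)" by (simp add: ennreal_plus)
    then have "w x = ennreal (h x) / ennreal (1 + a)" by (simp only: w_def)
    also have "\<dots> = ennreal (h x / (1 + a))"
      using real h0[of x] by (intro divide_ennreal) auto
    finally show ?thesis using real by simp
  qed (simp add: w_def)
  have wh: "w x \<le> ennreal (h x)" for x
  proof -
    have "h x \<le> h x * (1 + enn2real (A x))" using h0[of x] by (simp add: algebra_simps)
    then have "h x / (1 + enn2real (A x)) \<le> h x"
      by (intro mult_imp_div_pos_le) (auto intro: add_pos_nonneg)
    then show ?thesis by (auto simp: w_eq intro: ennreal_leI)
  qed
  have wA: "w x * A x \<le> ennreal (h x)" for x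
  proof (cases "A x")
    case (real a)
    then have "w x * A x = ennreal (h x / (1 + a)) * ennreal a" by (simp add: w_eq)
    also have "\<dots> = ennreal (h x / (1 + a) * a)"
      using h0[of x] real by (intro ennreal_mult[symmetric]) auto
    finally have 1: "w x * A x = ennreal (h x / (1 + a) * a)" .
    have "h x / (1 + a) * a \<le> h x"
      using h0[of x] real by (simp add: field_simps)
    then show ?thesis unfolding 1 by (rule ennreal_leI)
  qed (simp add: w_eq)
  have hfin: "(\<integral>\<^sup>+x. ennreal (h x) \<partial>P) < \<infinity>"
    using hi h0 by (simp add: integrable_iff_bounded less_imp_le)
  define Q where "Q = density P w"
  have [measurable_cong, simp]: "sets Q = sets P" by (simp add: Q_def)
  have "emeasure Q (space Q) < \<infinity>"
  proof -
    have "emeasure Q (space Q) = (\<integral>\<^sup>+x. w x \<partial>P)"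
      unfolding Q_def by (simp add: emeasure_density cong: nn_integral_cong)
    also have "\<dots> \<le> (\<integral>\<^sup>+x. ennreal (h x) \<partial>P)" by (intro nn_integral_mono wh)
    finally show ?thesis using hfin by (rule le_less_trans)
  qed
  then interpret Q: finite_measure Q
    by (intro finite_measureI) (simp only: less_top infinity_ennreal_def)
  interpret \<mu>Q: pair_sigma_finite \<mu> Q ..
  show ?thesis
  proof (rule that[of Q])
    show "finite_measure Q" by unfold_locales
    have "(\<integral>\<^sup>+p. ennreal (norm (v p)) \<partial>(\<mu> \<Otimes>\<^sub>M Q)) = (\<integral>\<^sup>+x. A x \<partial>Q)"
      unfolding A_def by (subst \<mu>Q.nn_integral_snd[symmetric]) auto
    also have "\<dots> = (\<integral>\<^sup>+x. w x * A x \<partial>P)" unfolding Q_def by (rule nn_integral_density) auto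
    also have "\<dots> \<le> (\<integral>\<^sup>+x. ennreal (h x) \<partial>P)" by (intro nn_integral_mono wA)
    finally have "(\<integral>\<^sup>+p. ennreal (norm (v p)) \<partial>(\<mu> \<Otimes>\<^sub>M Q)) < \<infinity>" using hfin by (rule le_less_trans)
    then show "integrable (\<mu> \<Otimes>\<^sub>M Q) v" by (simp add: integrable_iff_bounded)
    fix \<phi> assume "AE x in Q. \<phi> x"
    then have "AE x in P. 0 < w x \<longrightarrow> \<phi> x" unfolding Q_def by (simp add: AE_density)
    with int show "AE x in P. \<phi> x"
    proof eventually_elim
      case (elim x)
      have "A x < \<infinity>" using elim(1) by (simp add: A_def integrable_iff_bounded)
      then have "0 < w x" using h0[of x] by (auto simp: w_def ennreal_zero_less_divide)
      then show ?case using elim(2) by simp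
    qed
  qed simp
qed

section \<open>From mean errors to deterministic sampling points\<close>

lemma exists_small_of_nn_integral:
  assumes "prob_space P" "(\<integral>\<^sup>+x. f x \<partial>P) < c"
  obtains x where "x \<in> space P" "f x < c"
proof -
  interpret prob_space P by fact
  have "\<exists>x\<in>space P. f x < c"
  proof (rule ccontr)
    assume "\<not> ?thesis"
    then have "(\<integral>\<^sup>+x. c \<partial>P) \<le> (\<integral>\<^sup>+x. f x \<partial>P)" by (intro nn_integral_mono) (auto simp: not_less)
    then show False using assms(2) by (simp add: emeasure_space_1)
  qed
  then show ?thesis using that by blast
qed

text \<open>The sum of the errors has finite integral, hence is finite almost everywhere and its
  terms tend to 0. The geometric rate gives this for the whole sequence, without passing to a
  subsequence.\<close>

lemma AE_tendsto_of_summable_L1: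
  fixes f :: "nat \<Rightarrow> 'b \<Rightarrow> real"
  assumes [measurable]: "\<And>k. (\<lambda>x. f k x - g x) \<in> borel_measurable Q"
    and le: "\<And>k. (\<integral>\<^sup>+x. ennreal \<bar>f k x - g x\<bar> \<partial>Q) \<le> ennreal (C * (1/2) ^ k)" and "C \<ge> 0"
  shows "AE x in Q. (\<lambda>k. f k x) \<longlonglongrightarrow> g x"
proof -
  have "(\<integral>\<^sup>+x. (\<Sum>k. ennreal \<bar>f k x - g x\<bar>) \<partial>Q) = (\<Sum>k. \<integral>\<^sup>+x. ennreal \<bar>f k x - g x\<bar> \<partial>Q)"
    by (rule nn_integral_suminf) simp
  also have "\<dots> \<le> (\<Sum>k. ennreal (C * (1/2) ^ k))"
    by (intro suminf_le le) auto
  also have "\<dots> = ennreal (\<Sum>k. C * (1/2) ^ k)"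
    using \<open>C \<ge> 0\<close> by (intro suminf_ennreal_eq summable_sums summable_mult summable_geometric) auto
  finally have fin: "(\<integral>\<^sup>+x. (\<Sum>k. ennreal \<bar>f k x - g x\<bar>) \<partial>Q) \<noteq> \<infinity>"
    by (auto simp: top_unique)
  have "AE x in Q. (\<Sum>k. ennreal \<bar>f k x - g x\<bar>) \<noteq> \<infinity>"
    by (rule nn_integral_PInf_AE[OF _ fin]) measurable
  then show ?thesis
  proof eventually_elim
    case (elim x)
    have "summable (\<lambda>k. \<bar>f k x - g x\<bar>)"
      by (rule summable_suminf_not_top[OF _ elim[unfolded infinity_ennreal_def]]) simp
    then have "(\<lambda>k. \<bar>f k x - g x\<bar>) \<longlonglongrightarrow> 0" by (rule summable_LIMSEQ_zero)
    then show ?case by (simp add: tendsto_rabs_zero_iff LIM_zero_iff)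
  qed
qed

text \<open>The two \<open>L\<^sup>1\<close> errors have summable means over random sampling points, so some
  deterministic points work for both parameter spaces at once.\<close>

lemma exists_sampling:
  fixes v :: "'b \<times> 'c \<Rightarrow> real" and v' :: "'b \<times> 'd \<Rightarrow> real"
  assumes \<mu>: "prob_space \<mu>"
    and P: "sigma_finite_measure P" "v \<in> borel_measurable (\<mu> \<Otimes>\<^sub>M P)"
      "AE x in P. integrable \<mu> (\<lambda>t. v (t, x))"
    and P': "sigma_finite_measure P'" "v' \<in> borel_measurable (\<mu> \<Otimes>\<^sub>M P')"
      "AE x in P'. integrable \<mu> (\<lambda>t. v' (t, x))"
  obtains N :: "nat \<Rightarrow> nat" and \<tau> :: "nat \<Rightarrow> nat \<Rightarrow> 'b"
  where "AE x in P. (\<lambda>k. (\<Sum>j<N k. v (\<tau> k j, x)) / N k) \<longlonglongrightarrow> (\<integral>t. v (t, x) \<partial>\<mu>)"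
    and "AE x in P'. (\<lambda>k. (\<Sum>j<N k. v' (\<tau> k j, x)) / N k) \<longlonglongrightarrow> (\<integral>t. v' (t, x) \<partial>\<mu>)"
proof -
  interpret \<mu>: prob_space \<mu> by fact
  obtain Q where Q: "finite_measure Q" "sets Q = sets P" "integrable (\<mu> \<Otimes>\<^sub>M Q) v"
    "\<And>\<phi>. (AE x in Q. \<phi> x) \<Longrightarrow> (AE x in P. \<phi> x)"
    using exists_integrating_density[OF \<mu> P] by blast
  obtain Q' where Q': "finite_measure Q'" "sets Q' = sets P'" "integrable (\<mu> \<Otimes>\<^sub>M Q') v'"
    "\<And>\<phi>. (AE x in Q'. \<phi> x) \<Longrightarrow> (AE x in P'. \<phi> x)"
    using exists_integrating_density[OF \<mu> P'] by blast
  define D where "D N \<tau> = (\<integral>\<^sup>+x. ennreal \<bar>(\<Sum>j<N. v (\<tau> j, x)) / N - (\<integral>t. v (t, x) \<partial>\<mu>)\<bar> \<partial>Q)"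
    for N :: nat and \<tau>
  define D' where "D' N \<tau> = (\<integral>\<^sup>+x. ennreal \<bar>(\<Sum>j<N. v' (\<tau> j, x)) / N - (\<integral>t. v' (t, x) \<partial>\<mu>)\<bar> \<partial>Q')"
    for N :: nat and \<tau>
  have meas: "(\<lambda>x. (\<Sum>j<N. u (\<tau> j, x)) / N - (\<integral>t. u (t, x) \<partial>\<mu>)) \<in> borel_measurable R"
    if "\<tau> \<in> space (PiM {..<N} (\<lambda>_. \<mu>))" "u \<in> borel_measurable (\<mu> \<Otimes>\<^sub>M R)"
    for N :: nat and \<tau> and u :: "'b \<times> 'e \<Rightarrow> real" and R
  proof -
    have [measurable]: "(\<lambda>x. u (\<tau> j, x)) \<in> borel_measurable R" if "j < N" for j
      using that \<open>\<tau> \<in> _\<close> \<open>u \<in> _\<close> by (intro measurable_Pair2[of u]) (auto simp: space_PiM)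
    have [measurable]: "(\<lambda>x. \<integral>t. u (t, x) \<partial>\<mu>) \<in> borel_measurable R"
      using that(2) by (intro \<mu>.borel_measurable_lebesgue_integral) simp
    show ?thesis by measurable
  qed
  have "\<exists>N \<tau>. \<tau> \<in> space (PiM {..<N} (\<lambda>_. \<mu>)) \<and> D N \<tau> + D' N \<tau> \<le> ennreal (3 * (1/2) ^ k)" for k
  proof -
    have "\<forall>\<^sub>F N in sequentially. (\<integral>\<^sup>+\<tau>. D N \<tau> \<partial>PiM {..<N} (\<lambda>_. \<mu>)) \<le> ennreal ((1/2) ^ k)"
      unfolding D_def by (rule iid_average_L1) (use \<mu> Q in auto)
    moreover have "\<forall>\<^sub>F N in sequentially. (\<integral>\<^sup>+\<tau>. D' N \<tau> \<partial>PiM {..<N} (\<lambda>_. \<mu>)) \<le> ennreal ((1/2) ^ k)"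
      unfolding D'_def by (rule iid_average_L1) (use \<mu> Q' in auto)
    ultimately have "\<forall>\<^sub>F N in sequentially.
        (\<integral>\<^sup>+\<tau>. D N \<tau> \<partial>PiM {..<N} (\<lambda>_. \<mu>)) \<le> ennreal ((1/2) ^ k) \<and>
        (\<integral>\<^sup>+\<tau>. D' N \<tau> \<partial>PiM {..<N} (\<lambda>_. \<mu>)) \<le> ennreal ((1/2) ^ k)"
      by (rule eventually_conj)
    then obtain N where N: "(\<integral>\<^sup>+\<tau>. D N \<tau> \<partial>PiM {..<N} (\<lambda>_. \<mu>)) \<le> ennreal ((1/2) ^ k)"
        "(\<integral>\<^sup>+\<tau>. D' N \<tau> \<partial>PiM {..<N} (\<lambda>_. \<mu>)) \<le> ennreal ((1/2) ^ k)"
      by (auto simp: eventually_sequentially)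
    interpret PP: product_prob_space "\<lambda>_::nat. \<mu>" "{..<N}" ..
    interpret Q: finite_measure Q by (rule Q)
    interpret Q': finite_measure Q' by (rule Q')
    have [measurable]: "v \<in> borel_measurable (\<mu> \<Otimes>\<^sub>M Q)" "v' \<in> borel_measurable (\<mu> \<Otimes>\<^sub>M Q')"
      using Q(3) Q'(3) by auto
    have [measurable]: "D N \<in> borel_measurable (PiM {..<N} (\<lambda>_. \<mu>))"
        "D' N \<in> borel_measurable (PiM {..<N} (\<lambda>_. \<mu>))"
      unfolding D_def D'_def by measurable
    have "(\<integral>\<^sup>+\<tau>. D N \<tau> + D' N \<tau> \<partial>PiM {..<N} (\<lambda>_. \<mu>)) \<le> ennreal ((1/2) ^ k) + ennreal ((1/2) ^ k)"
      using N by (simp add: nn_integral_add add_mono)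
    also have "\<dots> = ennreal (2 * (1/2) ^ k)" by (simp flip: ennreal_plus)
    \<comment> \<open>The constant is 3 and not 2 because picking a point from the mean needs a
      strict inequality.\<close>
    also have "\<dots> < ennreal (3 * (1/2) ^ k)" by (simp add: ennreal_less_iff)
    finally have less: "(\<integral>\<^sup>+\<tau>. D N \<tau> + D' N \<tau> \<partial>PiM {..<N} (\<lambda>_. \<mu>)) < ennreal (3 * (1/2) ^ k)" .
    have "prob_space (PiM {..<N} (\<lambda>_. \<mu>))" by (intro prob_space_PiM \<mu>)
    then obtain \<tau> where "\<tau> \<in> space (PiM {..<N} (\<lambda>_. \<mu>))" "D N \<tau> + D' N \<tau> < ennreal (3 * (1/2) ^ k)"
      using less by (rule exists_small_of_nn_integral)
    then show ?thesis by (auto intro: less_imp_le)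
  qed
  then obtain N \<tau> where sp: "\<And>k. \<tau> k \<in> space (PiM {..<N k} (\<lambda>_. \<mu>))"
      and le: "\<And>k. D (N k) (\<tau> k) + D' (N k) (\<tau> k) \<le> ennreal (3 * (1/2) ^ k)"
    by metis
  have le1: "D (N k) (\<tau> k) \<le> ennreal (3 * (1/2) ^ k)" "D' (N k) (\<tau> k) \<le> ennreal (3 * (1/2) ^ k)" for k
    using le[of k] by (meson add_increasing add_increasing2 order_trans order_refl zero_le)+
  show ?thesis
  proof (rule that[where N=N and \<tau>=\<tau>])
    have "AE x in Q. (\<lambda>k. (\<Sum>j<N k. v (\<tau> k j, x)) / N k) \<longlonglongrightarrow> (\<integral>t. v (t, x) \<partial>\<mu>)"
      by (rule AE_tendsto_of_summable_L1[where C=3])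
        (use le1(1) sp Q(3) in \<open>auto simp: D_def intro!: meas\<close>)
    then show "AE x in P. (\<lambda>k. (\<Sum>j<N k. v (\<tau> k j, x)) / N k) \<longlonglongrightarrow> (\<integral>t. v (t, x) \<partial>\<mu>)" by (rule Q(4))
    have "AE x in Q'. (\<lambda>k. (\<Sum>j<N k. v' (\<tau> k j, x)) / N k) \<longlonglongrightarrow> (\<integral>t. v' (t, x) \<partial>\<mu>)"
      by (rule AE_tendsto_of_summable_L1[where C=3])
        (use le1(2) sp Q'(3) in \<open>auto simp: D'_def intro!: meas\<close>)
    then show "AE x in P'. (\<lambda>k. (\<Sum>j<N k. v' (\<tau> k j, x)) / N k) \<longlonglongrightarrow> (\<integral>t. v' (t, x) \<partial>\<mu>)" by (rule Q'(4))
  qed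
qed

section \<open>Characteristic functions of Poisson integrals\<close>

text \<open>The Poisson weights of the natural values add up to 1 by the exponential series, so
  every other value, including infinity, has probability 0. This is how integrality of the counts is
  obtained: \<open>poisson_random_measure\<close> only prescribes these probabilities.\<close>

lemma (in prob_space) poisson_rv_AE_nat:
  assumes [measurable]: "N \<in> borel_measurable M" and "l \<ge> 0"
    and P: "\<And>k::nat. measure M {\<omega> \<in> space M. N \<omega> = (of_nat k :: ennreal)} = l ^ k / fact k * exp (- l)"
  shows "AE \<omega> in M. \<exists>k::nat. N \<omega> = of_nat k"
proof -
  define E where "E k = {\<omega> \<in> space M. N \<omega> = of_nat k}" for k :: nat
  have "range E \<subseteq> events" "disjoint_family E"
    by (auto simp: E_def disjoint_family_on_def)
  then have "(\<lambda>k. measure M (E k)) sums measure M (\<Union>k. E k)"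
    by (rule finite_measure_UNION)
  moreover have "(\<lambda>k. measure M (E k)) sums 1"
  proof -
    have "(\<lambda>k. l ^ k /\<^sub>R fact k * exp (- l)) sums (exp l * exp (- l))"
      by (intro sums_mult2 exp_converges)
    then show ?thesis by (simp add: E_def P exp_minus field_simps)
  qed
  ultimately have "prob (\<Union>k. E k) = 1" by (rule sums_unique2)
  then have "AE \<omega> in M. \<omega> \<in> (\<Union>k. E k)" by (rule AE_prob_1)
  then show ?thesis by eventually_elim (auto simp: E_def)
qed

text \<open>Splitting along the events \<open>N \<omega> = of_nat k\<close> turns the expectation
  into an exponential series. \<open>enn2real\<close> does no harm, as the value infinity has
  probability 0.\<close>

lemma (in prob_space) poisson_rv_char:
  assumes N [measurable]: "N \<in> borel_measurable M" and l: "l \<ge> 0"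
    and P: "\<And>k::nat. measure M {\<omega> \<in> space M. N \<omega> = (of_nat k :: ennreal)} = l ^ k / fact k * exp (- l)"
  shows "(CLINT \<omega>|M. iexp (c * enn2real (N \<omega>))) = exp (l * (iexp c - 1))"
proof -
  define E where "E k = {\<omega> \<in> space M. N \<omega> = of_nat k}" for k :: nat
  have [measurable]: "E k \<in> events" for k by (simp add: E_def)
  define f :: "nat \<Rightarrow> 'a \<Rightarrow> complex" where "f k \<omega> = indicator (E k) \<omega> *\<^sub>R iexp (c * k)" for k \<omega>
  have f_sums: "f k \<omega> = (if k = j then iexp (c * j) else 0)" if "N \<omega> = of_nat j" "\<omega> \<in> space M" for j k \<omega>
    using that by (auto simp: f_def E_def)
  have AE: "AE \<omega> in M. \<exists>k::nat. N \<omega> = of_nat k" by (rule poisson_rv_AE_nat[OF N l P])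
  have int: "integrable M (f k)" for k
    unfolding f_def by (rule integrable_const_bound[where B=1]) auto
  have normf: "(LINT \<omega>|M. norm (f k \<omega>)) = l ^ k / fact k * exp (- l)" for k
  proof -
    have "norm (f k \<omega>) = indicator (E k) \<omega>" for \<omega> by (simp add: f_def)
    then show ?thesis using P[of k] by (simp add: E_def)
  qed
  have "(\<lambda>k. integral\<^sup>L M (f k)) sums (\<integral>\<omega>. (\<Sum>k. f k \<omega>) \<partial>M)"
  proof (rule sums_integral[OF int])
    show "AE \<omega> in M. summable (\<lambda>k. norm (f k \<omega>))"
      using AE AE_space
    proof eventually_elim
      case (elim \<omega>)
      then obtain j where "N \<omega> = of_nat j" by blast
      with elim have "norm (f k \<omega>) = (if k = j then norm (iexp (c * j)) else 0)" for k
        using f_sums[of \<omega> j k] by simp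
      then show ?case by (simp only: summable_single)
    qed
    show "summable (\<lambda>k. LINT \<omega>|M. norm (f k \<omega>))"
      unfolding normf using summable_exp[of l]
      by (intro summable_mult2) (simp add: divide_inverse mult.commute)
  qed
  also have "(\<integral>\<omega>. (\<Sum>k. f k \<omega>) \<partial>M) = (CLINT \<omega>|M. iexp (c * enn2real (N \<omega>)))"
  proof (rule integral_cong_AE)
    show "AE \<omega> in M. (\<Sum>k. f k \<omega>) = iexp (c * enn2real (N \<omega>))"
      using AE AE_space
    proof eventually_elim
      case (elim \<omega>)
      then obtain j where j: "N \<omega> = of_nat j" by blast
      have "(\<lambda>k. f k \<omega>) sums iexp (c * j)"
        unfolding f_sums[OF j elim(2)] by (rule sums_single)
      then show ?case using j by (simp add: sums_unique[symmetric])
    qed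
  qed (auto simp: f_def)
  finally have 1: "(\<lambda>k. integral\<^sup>L M (f k)) sums (CLINT \<omega>|M. iexp (c * enn2real (N \<omega>)))" .
  have "integral\<^sup>L M (f k) = (l * iexp c) ^ k /\<^sub>R fact k * exp (- l)" for k
  proof -
    have "integral\<^sup>L M (f k) = measure M (E k) *\<^sub>R iexp (c * k)"
      unfolding f_def using integrable_const_bound[of "indicat_real (E k)" 1]
      by (subst integral_scaleR_left) auto
    also have "iexp (c * k) = iexp c ^ k" by (simp add: exp_of_nat2_mult[symmetric] mult_ac)
    finally show ?thesis
      using P[of k] by (simp add: E_def scaleR_conv_of_real power_mult_distrib field_simps
          flip: exp_of_real)
  qed
  moreover have "(\<lambda>k. (l * iexp c) ^ k /\<^sub>R fact k * exp (- l)) sums (exp (l * iexp c) * exp (- complex_of_real l))"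
    by (simp only: exp_of_real of_real_minus[symmetric]) (intro sums_mult2 exp_converges)
  ultimately have "(CLINT \<omega>|M. iexp (c * enn2real (N \<omega>))) = exp (l * iexp c) * exp (- complex_of_real l)"
    using 1 by (simp add: sums_unique2)
  then show ?thesis by (simp add: exp_add[symmetric] algebra_simps exp_diff exp_minus divide_inverse)
qed

text \<open>Applied twice with the same level sets, to the identity for the Poisson integral and to
  \<open>iexp y - 1\<close> for the exponent. Both vanish at 0, so the level set of 0, which may
  have infinite measure, can be left out.\<close>

lemma eq_sum_level_sets:
  fixes h :: "real \<Rightarrow> 'z::real_normed_vector"
  assumes "inj_on c {..<n::nat}" "y = 0 \<or> y \<in> c ` {..<n}" "\<And>i. i < n \<Longrightarrow> c i \<noteq> 0" "h 0 = 0"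
  shows "h y = (\<Sum>i<n. indicator {c i} y *\<^sub>R h (c i))"
proof (cases "y = 0")
  case True
  then show ?thesis using assms by (auto intro!: sum.neutral[symmetric])
next
  case False
  then obtain j where j: "j < n" "y = c j" using assms(2) by auto
  have "(\<Sum>i<n. indicator {c i} y *\<^sub>R h (c i)) = (\<Sum>i<n. if i = j then h (c j) else 0)"
    using j assms(1) by (intro sum.cong) (auto simp: indicator_def inj_on_def)
  then show ?thesis using j by simp
qed

section \<open>Integrals against a Poisson random measure\<close>

locale poisson_measure = prob_space M for M :: "'w measure" +
  fixes \<mu> :: "'b measure" and J :: "'w \<Rightarrow> 'b measure"
  assumes prm: "poisson_random_measure M \<mu> J"
begin

lemma sets_J: "\<omega> \<in> space M \<Longrightarrow> sets (J \<omega>) = sets \<mu>"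
  using prm by (simp add: poisson_random_measure_def)

lemma space_J: "\<omega> \<in> space M \<Longrightarrow> space (J \<omega>) = space \<mu>"
  using sets_J sets_eq_imp_space_eq by blast

lemma measurable_emeasure_J [measurable]:
  "A \<in> sets \<mu> \<Longrightarrow> (\<lambda>\<omega>. emeasure (J \<omega>) A) \<in> borel_measurable M"
  using prm by (simp add: poisson_random_measure_def)

lemma prob_J:
  "A \<in> sets \<mu> \<Longrightarrow> emeasure \<mu> A < \<infinity> \<Longrightarrow>
    measure M {\<omega> \<in> space M. emeasure (J \<omega>) A = of_nat k} =
      measure \<mu> A ^ k / fact k * exp (- measure \<mu> A)"
  using prm by (simp add: poisson_random_measure_def)

lemma AE_emeasure_J_nat:
  "A \<in> sets \<mu> \<Longrightarrow> emeasure \<mu> A < \<infinity> \<Longrightarrow> AE \<omega> in M. \<exists>k::nat. emeasure (J \<omega>) A = of_nat k"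
  by (rule poisson_rv_AE_nat[OF _ _ prob_J]) auto

lemma AE_emeasure_J_finite:
  assumes "A \<in> sets \<mu>" "emeasure \<mu> A < \<infinity>"
  shows "AE \<omega> in M. emeasure (J \<omega>) A < \<infinity>"
  using AE_emeasure_J_nat[OF assms] by eventually_elim (auto simp: less_top of_nat_less_top)

text \<open>\<open>poisson_random_measure\<close> states independence for infinite disjoint
  sequences, so the sets are indexed by all natural numbers although only the first n are
  summed.\<close>

lemma char_J_family:
  fixes C :: "nat \<Rightarrow> 'b set"
  assumes C: "\<And>i. C i \<in> sets \<mu>" "disjoint_family C" "\<And>i. emeasure \<mu> (C i) < \<infinity>"
  shows "(CLINT \<omega>|M. iexp (\<Sum>i<n. c i * measure (J \<omega>) (C i))) =
    exp (\<Sum>i<n. measure \<mu> (C i) * (iexp (c i) - 1))"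
proof -
  have "\<forall>A::nat \<Rightarrow> 'b set. range A \<subseteq> sets \<mu> \<longrightarrow> disjoint_family A \<longrightarrow>
      indep_vars (\<lambda>_. borel) (\<lambda>i \<omega>. emeasure (J \<omega>) (A i)) UNIV"
    using prm unfolding poisson_random_measure_def by (elim conjE)
  then have ind: "indep_vars (\<lambda>_. borel) (\<lambda>i \<omega>. emeasure (J \<omega>) (C i)) UNIV"
    using C by auto
  have ind': "indep_vars (\<lambda>_. borel) (\<lambda>i \<omega>. c i * enn2real (emeasure (J \<omega>) (C i))) {..<n}"
    by (rule indep_vars_compose2[OF indep_vars_subset[OF ind]]) auto
  have ch: "char (distr M borel Y) 1 = (CLINT \<omega>|M. iexp (Y \<omega>))"
    if "Y \<in> borel_measurable M" for Y
    using that by (simp add: char_def integral_distr)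
  have "(CLINT \<omega>|M. iexp (\<Sum>i<n. c i * measure (J \<omega>) (C i))) =
      (\<Prod>i<n. CLINT \<omega>|M. iexp (c i * enn2real (emeasure (J \<omega>) (C i))))"
    using char_distr_sum[OF ind', of 1] C(1)
    by (subst (asm) ch, measurable, subst (asm) ch, measurable) (simp add: measure_def)
  also have "\<dots> = (\<Prod>i<n. exp (measure \<mu> (C i) * (iexp (c i) - 1)))"
    by (intro prod.cong refl poisson_rv_char prob_J) (simp_all add: C C(3)[unfolded infinity_ennreal_def] measurable_emeasure_J)
  also have "\<dots> = exp (\<Sum>i<n. measure \<mu> (C i) * (iexp (c i) - 1))"
    by (simp add: exp_sum)
  finally show ?thesis .
qed

text \<open>The definition gives measurability of the evaluations
  \<open>emeasure (J \<omega>) A\<close> only; the standard induction on nonnegative measurable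
  functions extends it. Each step uses that \<open>J \<omega>\<close> has the same measurable sets
  as \<open>\<mu>\<close>.\<close>

lemma measurable_nn_integral_J [measurable (raw)]:
  assumes "h \<in> borel_measurable \<mu>"
  shows "(\<lambda>\<omega>. \<integral>\<^sup>+x. h x \<partial>J \<omega>) \<in> borel_measurable M"
  using assms
proof (induct rule: borel_measurable_induct)
  case (cong f g)
  then have "(\<integral>\<^sup>+x. f x \<partial>J \<omega>) = (\<integral>\<^sup>+x. g x \<partial>J \<omega>)" if "\<omega> \<in> space M" for \<omega>
    using that by (intro nn_integral_cong) (simp add: space_J)
  then show ?case using cong measurable_cong by force
next
  case (set A)
  then have "(\<integral>\<^sup>+x. indicator A x \<partial>J \<omega>) = emeasure (J \<omega>) A" if "\<omega> \<in> space M" for \<omega>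
    using that by (simp add: sets_J)
  moreover have "(\<lambda>\<omega>. emeasure (J \<omega>) A) \<in> borel_measurable M" using set by simp
  ultimately show ?case by (simp cong: measurable_cong)
next
  case (mult u c)
  then have "(\<integral>\<^sup>+x. c * u x \<partial>J \<omega>) = c * (\<integral>\<^sup>+x. u x \<partial>J \<omega>)" if "\<omega> \<in> space M" for \<omega>
    using that by (intro nn_integral_cmult) (simp cong: measurable_cong_sets add: sets_J)
  moreover have "(\<lambda>\<omega>. c * (\<integral>\<^sup>+x. u x \<partial>J \<omega>)) \<in> borel_measurable M" using mult by simp
  ultimately show ?case by (simp cong: measurable_cong)
next
  case (add u v)
  then have "(\<integral>\<^sup>+x. v x + u x \<partial>J \<omega>) = (\<integral>\<^sup>+x. v x \<partial>J \<omega>) + (\<integral>\<^sup>+x. u x \<partial>J \<omega>)"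
    if "\<omega> \<in> space M" for \<omega>
    using that by (intro nn_integral_add) (simp_all cong: measurable_cong_sets add: sets_J)
  moreover have "(\<lambda>\<omega>. (\<integral>\<^sup>+x. v x \<partial>J \<omega>) + (\<integral>\<^sup>+x. u x \<partial>J \<omega>)) \<in> borel_measurable M"
    using add by simp
  ultimately show ?case by (simp cong: measurable_cong)
next
  case (seq U)
  have "(\<integral>\<^sup>+x. (SUP i. U i) x \<partial>J \<omega>) = (SUP i. \<integral>\<^sup>+x. U i x \<partial>J \<omega>)" if "\<omega> \<in> space M" for \<omega>
    unfolding SUP_apply using that seq
    by (intro nn_integral_monotone_convergence_SUP) (simp_all cong: measurable_cong_sets add: sets_J)
  moreover have "(\<lambda>\<omega>. SUP i. \<integral>\<^sup>+x. U i x \<partial>J \<omega>) \<in> borel_measurable M"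
    using seq by simp
  ultimately show ?case by (simp cong: measurable_cong)
qed

text \<open>The Bochner integral is 0 for a nonintegrable function, and integrability may depend on
  \<omega>; \<open>R\<close> spells this out through nonnegative integrals, whose measurability is
  known.\<close>

lemma measurable_integral_J [measurable (raw)]:
  fixes G :: "'b \<Rightarrow> real"
  assumes [measurable]: "G \<in> borel_measurable \<mu>"
  shows "(\<lambda>\<omega>. \<integral>x. G x \<partial>J \<omega>) \<in> borel_measurable M"
proof -
  define R where "R \<omega> = (if (\<integral>\<^sup>+x. ennreal \<bar>G x\<bar> \<partial>J \<omega>) < \<infinity> then
      enn2real (\<integral>\<^sup>+x. ennreal (G x) \<partial>J \<omega>) - enn2real (\<integral>\<^sup>+x. ennreal (- G x) \<partial>J \<omega>) else 0)" for \<omega>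
  have "(\<integral>x. G x \<partial>J \<omega>) = R \<omega>" if "\<omega> \<in> space M" for \<omega>
  proof -
    have G: "G \<in> borel_measurable (J \<omega>)"
      using assms that by (simp cong: measurable_cong_sets add: sets_J)
    show ?thesis
    proof (cases "integrable (J \<omega>) G")
      case True
      then show ?thesis
        by (auto simp: R_def real_lebesgue_integral_def integrable_iff_bounded)
    next
      case False
      then have "\<not> (\<integral>\<^sup>+x. ennreal \<bar>G x\<bar> \<partial>J \<omega>) < \<infinity>"
        using G by (simp add: integrable_iff_bounded)
      then show ?thesis using False by (simp add: R_def not_integrable_integral_eq)
    qed
  qed
  moreover have "R \<in> borel_measurable M" unfolding R_def by measurable
  ultimately show ?thesis by (simp cong: measurable_cong)
qed

text \<open>Integrability of \<open>G\<close> against \<open>\<mu>\<close> is not asked for: almost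
  surely J puts finite mass on the support of \<open>G\<close> and \<open>G\<close> is bounded there
  up to a null set of \<open>J \<omega>\<close>. Indeed the sets \<open>D m\<close> decrease to the
  empty set, so the mass of \<open>D m\<close> tends to 0, and a natural number below 1 is
  0.\<close>

lemma AE_integrable_J:
  fixes G :: "'b \<Rightarrow> real"
  assumes [measurable]: "G \<in> borel_measurable \<mu>"
    and fin: "emeasure \<mu> {x \<in> space \<mu>. G x \<noteq> 0} < \<infinity>"
  shows "AE \<omega> in M. integrable (J \<omega>) G"
proof -
  define D where "D m = {x \<in> space \<mu>. real m < \<bar>G x\<bar>}" for m :: nat
  have [measurable]: "D m \<in> sets \<mu>" for m by (simp add: D_def)
  have D0: "{x \<in> space \<mu>. G x \<noteq> 0} = D 0" by (auto simp: D_def)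
  have "emeasure \<mu> (D m) \<le> emeasure \<mu> (D 0)" for m
    by (rule emeasure_mono) (auto simp: D_def)
  then have "emeasure \<mu> (D m) < \<infinity>" for m using fin unfolding D0 by (rule le_less_trans)
  then have "AE \<omega> in M. \<forall>m. \<exists>k::nat. emeasure (J \<omega>) (D m) = of_nat k"
    by (simp add: AE_all_countable AE_emeasure_J_nat)
  then show ?thesis using AE_space
  proof eventually_elim
    case (elim \<omega>)
    have G: "G \<in> borel_measurable (J \<omega>)"
      using assms elim(2) by (simp cong: measurable_cong_sets add: sets_J)
    have DJ: "D m \<in> sets (J \<omega>)" for m using elim(2) by (simp add: sets_J)
    have Dfin: "emeasure (J \<omega>) (D m) \<noteq> \<infinity>" for m
      using elim(1) by (metis infinity_ennreal_def of_nat_less_top less_irrefl)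
    have "(\<lambda>m. emeasure (J \<omega>) (D m)) \<longlonglongrightarrow> emeasure (J \<omega>) (\<Inter>m. D m)"
    proof (rule Lim_emeasure_decseq)
      show "decseq D" by (rule decseq_SucI) (auto simp: D_def)
    qed (use DJ Dfin in auto)
    moreover have "(\<Inter>m. D m) = {}"
    proof -
      have "\<exists>m. \<not> real m < \<bar>G x\<bar>" for x using reals_Archimedean2[of "\<bar>G x\<bar>"] by (auto intro: less_asym)
      then show ?thesis by (auto simp: D_def)
    qed
    ultimately have "(\<lambda>m. emeasure (J \<omega>) (D m)) \<longlonglongrightarrow> 0" by simp
    then have "\<forall>\<^sub>F m in sequentially. emeasure (J \<omega>) (D m) < 1" by (rule order_tendstoD) simp
    then obtain m where m: "emeasure (J \<omega>) (D m) < 1" by (auto simp: eventually_sequentially)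
    obtain k :: nat where k: "emeasure (J \<omega>) (D m) = of_nat k" using elim(1) by blast
    with m have "emeasure (J \<omega>) (D m) = 0" by (cases k) auto
    then have "AE x in J \<omega>. x \<notin> D m" by (intro AE_not_in null_setsI DJ)
    then have AE: "AE x in J \<omega>. norm (G x) \<le> real m"
      using AE_space by eventually_elim (use elim(2) in \<open>auto simp: D_def space_J\<close>)
    show ?case
    proof (rule integrableI_bounded_set[where A="D 0" and B="real m"])
      show "AE x\<in>D 0 in J \<omega>. norm (G x) \<le> real m" using AE by eventually_elim simp
      show "AE x in J \<omega>. x \<notin> D 0 \<longrightarrow> G x = 0"
        using AE_space by eventually_elim (use elim(2) in \<open>auto simp: D_def space_J\<close>)
    qed (use G DJ Dfin in \<open>auto simp: less_top\<close>)
  qed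
qed

text \<open>The integral is a linear combination of the independent Poisson counts on the nonzero
  level sets of \<open>G\<close>, so the characteristic functions multiply and the exponents add up
  to an integral against \<open>\<mu>\<close>.\<close>

lemma char_integral_J_simple:
  fixes G :: "'b \<Rightarrow> real"
  assumes G: "simple_function \<mu> G" and fin: "emeasure \<mu> {x \<in> space \<mu>. G x \<noteq> 0} < \<infinity>"
  shows "(CLINT \<omega>|M. iexp (\<integral>x. G x \<partial>J \<omega>)) = exp (CLINT x|\<mu>. iexp (G x) - 1)"
proof -
  have [measurable]: "G \<in> borel_measurable \<mu>" using G by (rule borel_measurable_simple_function)
  define V where "V = G ` space \<mu> - {0}"
  have "finite V" using G by (simp add: V_def simple_function_def)
  then obtain c where c: "bij_betw c {..<card V} V"
    using ex_bij_betw_nat_finite lessThan_atLeast0 by metis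
  define n where "n = card V"
  \<comment> \<open>Empty sets pad the finite family to the infinite disjoint sequence that
    \<open>char_J_family\<close> expects.\<close>
  define C where "C i = (if i < n then {x \<in> space \<mu>. G x = c i} else {})" for i
  have c0: "c i \<noteq> 0" if "i < n" for i
    using c that by (auto simp: n_def V_def bij_betw_def)
  have C [measurable]: "C i \<in> sets \<mu>" for i unfolding C_def by simp
  have disj: "disjoint_family C"
    using c unfolding disjoint_family_on_def C_def n_def bij_betw_def inj_on_def by auto
  have "emeasure \<mu> (C i) \<le> emeasure \<mu> {x \<in> space \<mu>. G x \<noteq> 0}" for i
    by (rule emeasure_mono) (auto simp: C_def c0)
  then have Cfin: "emeasure \<mu> (C i) < \<infinity>" for i using fin by (rule le_less_trans)
  have ind_C: "(indicator (C i) x :: real) = indicator {c i} (G x)" if "x \<in> space \<mu>" "i < n" for i x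
    using that by (simp add: C_def indicator_def)
  have range: "G x = 0 \<or> G x \<in> c ` {..<n}" if "x \<in> space \<mu>" for x
    using that bij_betw_imp_surj_on[OF c] by (auto simp: V_def n_def)
  have inj: "inj_on c {..<n}" using c by (simp add: n_def bij_betw_def)
  have expand_G: "G x = (\<Sum>i<n. indicator (C i) x *\<^sub>R c i)" if x: "x \<in> space \<mu>" for x
  proof -
    have "G x = (\<Sum>i<n. indicator {c i} (G x) *\<^sub>R c i)"
      by (rule eq_sum_level_sets[OF inj range[OF x] c0]) auto
    then show ?thesis using x by (simp add: ind_C)
  qed
  have expand_iexp: "iexp (G x) - 1 = (\<Sum>i<n. indicator (C i) x *\<^sub>R (iexp (c i) - 1))"
    if x: "x \<in> space \<mu>" for x
  proof -
    have "iexp (G x) - 1 = (\<Sum>i<n. indicator {c i} (G x) *\<^sub>R (iexp (c i) - 1))"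
      by (rule eq_sum_level_sets[OF inj range[OF x] c0]) auto
    then show ?thesis using x by (simp add: ind_C)
  qed
  have "AE \<omega> in M. \<forall>i. emeasure (J \<omega>) (C i) < \<infinity>"
    by (simp add: AE_all_countable AE_emeasure_J_finite Cfin del: infinity_ennreal_def)
  then have "AE \<omega> in M. (\<integral>x. G x \<partial>J \<omega>) = (\<Sum>i<n. c i * measure (J \<omega>) (C i))"
    using AE_space
  proof eventually_elim
    case (elim \<omega>)
    have "(\<integral>x. G x \<partial>J \<omega>) = (\<integral>x. (\<Sum>i<n. indicator (C i) x *\<^sub>R c i) \<partial>J \<omega>)"
      by (intro Bochner_Integration.integral_cong refl expand_G) (simp add: space_J elim)
    also have "\<dots> = (\<Sum>i<n. \<integral>x. indicator (C i) x *\<^sub>R c i \<partial>J \<omega>)"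
      by (rule Bochner_Integration.integral_sum)
        (use elim in \<open>auto simp: sets_J intro!: integrable_scaleR_left\<close>)
    also have "\<dots> = (\<Sum>i<n. c i * measure (J \<omega>) (C i))"
      using elim by (intro sum.cong refl)
        (auto simp: sets_J space_J Int_absorb2 sets.sets_into_space[OF C])
    finally show ?case .
  qed
  then have "(CLINT \<omega>|M. iexp (\<integral>x. G x \<partial>J \<omega>)) = (CLINT \<omega>|M. iexp (\<Sum>i<n. c i * measure (J \<omega>) (C i)))"
    unfolding measure_def by (intro integral_cong_AE) auto
  also have "\<dots> = exp (\<Sum>i<n. measure \<mu> (C i) * (iexp (c i) - 1))"
    by (rule char_J_family[OF C disj Cfin])
  also have "(\<Sum>i<n. measure \<mu> (C i) * (iexp (c i) - 1)) =
      (\<Sum>i<n. CLINT x|\<mu>. indicator (C i) x *\<^sub>R (iexp (c i) - 1))"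
    using Cfin by (intro sum.cong refl)
      (auto simp: scaleR_conv_of_real Int_absorb2 sets.sets_into_space[OF C])
  also have "\<dots> = (CLINT x|\<mu>. (\<Sum>i<n. indicator (C i) x *\<^sub>R (iexp (c i) - 1)))"
    using Cfin by (intro Bochner_Integration.integral_sum[symmetric]) (auto intro!: integrable_scaleR_left)
  also have "\<dots> = (CLINT x|\<mu>. iexp (G x) - 1)"
    by (intro Bochner_Integration.integral_cong refl expand_iexp[symmetric])
  finally show ?thesis .
qed

text \<open>Approximation by simple functions bounded by 2|G|, which therefore vanish wherever
  \<open>G\<close> does. On the side of J the function 2|G| is almost surely an integrable majorant;
  on the side of \<open>\<mu>\<close> the majorant is 2 on the support of \<open>G\<close>, a set of
  finite measure.\<close>

lemma char_integral_J:
  fixes G :: "'b \<Rightarrow> real"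
  assumes [measurable]: "G \<in> borel_measurable \<mu>"
    and fin: "emeasure \<mu> {x \<in> space \<mu>. G x \<noteq> 0} < \<infinity>"
  shows "(CLINT \<omega>|M. iexp (\<integral>x. G x \<partial>J \<omega>)) = exp (CLINT x|\<mu>. iexp (G x) - 1)"
proof -
  from borel_measurable_implies_sequence_metric[OF assms(1), of 0]
  obtain F where "\<forall>i. simple_function \<mu> (F i)" "\<forall>x\<in>space \<mu>. (\<lambda>i. F i x) \<longlonglongrightarrow> G x"
      "\<forall>i. \<forall>x\<in>space \<mu>. dist (F i x) 0 \<le> 2 * dist (G x) 0" by blast
  then have F: "\<And>i. simple_function \<mu> (F i)"
      "\<And>x. x \<in> space \<mu> \<Longrightarrow> (\<lambda>i. F i x) \<longlonglongrightarrow> G x"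
      "\<And>i x. x \<in> space \<mu> \<Longrightarrow> \<bar>F i x\<bar> \<le> 2 * \<bar>G x\<bar>"
    by auto
  have [measurable]: "F i \<in> borel_measurable \<mu>" for i using F(1) by (rule borel_measurable_simple_function)
  have finF: "emeasure \<mu> {x \<in> space \<mu>. F i x \<noteq> 0} < \<infinity>" for i
  proof -
    have "emeasure \<mu> {x \<in> space \<mu>. F i x \<noteq> 0} \<le> emeasure \<mu> {x \<in> space \<mu>. G x \<noteq> 0}"
    proof (rule emeasure_mono)
      have "F i x = 0" if "x \<in> space \<mu>" "G x = 0" for x
        using F(3)[OF that(1), of i] that(2) by simp
      then show "{x \<in> space \<mu>. F i x \<noteq> 0} \<subseteq> {x \<in> space \<mu>. G x \<noteq> 0}" by auto
    qed simp
    then show ?thesis using fin by (rule le_less_trans)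
  qed
  have "(\<lambda>i. CLINT \<omega>|M. iexp (\<integral>x. F i x \<partial>J \<omega>)) \<longlonglongrightarrow> (CLINT \<omega>|M. iexp (\<integral>x. G x \<partial>J \<omega>))"
  proof (rule integral_dominated_convergence[where w="\<lambda>_. 1"])
    show "AE \<omega> in M. (\<lambda>i. iexp (\<integral>x. F i x \<partial>J \<omega>)) \<longlonglongrightarrow> iexp (\<integral>x. G x \<partial>J \<omega>)"
      using AE_integrable_J[OF assms] AE_space
    proof eventually_elim
      case (elim \<omega>)
      have "(\<lambda>i. \<integral>x. F i x \<partial>J \<omega>) \<longlonglongrightarrow> (\<integral>x. G x \<partial>J \<omega>)"
      proof (rule integral_dominated_convergence[where w="\<lambda>x. 2 * \<bar>G x\<bar>"])
        show "AE x in J \<omega>. (\<lambda>i. F i x) \<longlonglongrightarrow> G x" "AE x in J \<omega>. norm (F i x) \<le> 2 * \<bar>G x\<bar>" for i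
          using F(2,3) elim(2) by (auto simp: space_J)
        show "G \<in> borel_measurable (J \<omega>)" "F i \<in> borel_measurable (J \<omega>)" for i
          using elim(2) by (simp_all cong: measurable_cong_sets add: sets_J)
      qed (use elim in auto)
      then show ?case by (intro tendsto_intros)
    qed
  qed auto
  moreover have "(\<lambda>i. CLINT \<omega>|M. iexp (\<integral>x. F i x \<partial>J \<omega>)) \<longlonglongrightarrow> exp (CLINT x|\<mu>. iexp (G x) - 1)"
    unfolding char_integral_J_simple[OF F(1) finF]
  proof (intro tendsto_exp integral_dominated_convergence[where w="\<lambda>x. 2 * indicator {x \<in> space \<mu>. G x \<noteq> 0} x"])
    show "AE x in \<mu>. (\<lambda>i. iexp (F i x) - 1) \<longlonglongrightarrow> iexp (G x) - 1"
      using F(2) by (intro AE_I2 tendsto_intros)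
    show "AE x in \<mu>. norm (iexp (F i x) - 1) \<le> 2 * indicator {x \<in> space \<mu>. G x \<noteq> 0} x" for i
    proof (rule AE_I2)
      fix x assume x: "x \<in> space \<mu>"
      have "norm (iexp (F i x) - 1) \<le> norm (iexp (F i x)) + norm (1::complex)"
        by (rule norm_triangle_ineq4)
      then have "norm (iexp (F i x) - 1) \<le> 2" by simp
      moreover have "F i x = 0" if "G x = 0" using F(3)[OF x, of i] that by simp
      ultimately show "norm (iexp (F i x) - 1) \<le> 2 * indicator {x \<in> space \<mu>. G x \<noteq> 0} x"
        using x by (auto simp: indicator_def)
    qed
  qed (use fin in auto)
  ultimately show ?thesis by (rule LIMSEQ_unique)
qed

end

section \<open>Integrals of simple functions\<close>

lemma ennreal_tendsto_0_le:
  fixes f g :: "nat \<Rightarrow> ennreal"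
  assumes "\<And>n. f n \<le> g n" "g \<longlonglongrightarrow> 0"
  shows "f \<longlonglongrightarrow> 0"
  by (rule tendsto_sandwich[OF _ _ tendsto_const assms(2)]) (simp_all add: assms(1))

section \<open>The noise and its intensity measure\<close>

locale levy_noise = prob_space M for M :: "'w measure" +
  fixes S :: "'a::euclidean_space set" and \<nu> :: "real measure"
    and J :: "'w \<Rightarrow> ('a \<times> real) measure" and X :: "'a set \<Rightarrow> 'w \<Rightarrow> real"
  assumes S_borel [measurable]: "S \<in> sets borel"
    and noise: "levy_white_noise M S \<nu> J X"
begin

sublocale poisson_measure M "intensity S \<nu>" J
  using noise by unfold_locales (simp add: levy_white_noise_def)

lemma sets_nu [simp, measurable_cong]: "sets \<nu> = sets borel"
  and nu_0: "emeasure \<nu> {0} = 0"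
  and nu_min: "(\<integral>\<^sup>+z. ennreal (min (z\<^sup>2) 1) \<partial>\<nu>) < \<infinity>"
  and nu_sym: "distr \<nu> borel uminus = \<nu>"
  using noise by (auto simp: levy_white_noise_def symmetric_levy_measure_def)

lemma space_nu [simp]: "space \<nu> = UNIV"
  using sets_eq_imp_space_eq[OF sets_nu] by simp

lemma nu_tail_finite:
  assumes "e > 0"
  shows "emeasure \<nu> {z. e < \<bar>z\<bar>} < \<infinity>"
proof -
  define c where "c = min (e\<^sup>2) 1"
  have c: "c > 0" using assms by (simp add: c_def)
  have [measurable]: "{z::real. e < \<bar>z\<bar>} \<in> sets borel" by measurable
  have "ennreal c * emeasure \<nu> {z. e < \<bar>z\<bar>} = (\<integral>\<^sup>+z. ennreal c * indicator {z. e < \<bar>z\<bar>} z \<partial>\<nu>)"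
    by (subst nn_integral_cmult_indicator) auto
  also have "\<dots> \<le> (\<integral>\<^sup>+z. ennreal (min (z\<^sup>2) 1) \<partial>\<nu>)"
  proof (rule nn_integral_mono)
    fix z :: real
    have "c \<le> min (z\<^sup>2) 1" if "e < \<bar>z\<bar>"
    proof -
      have "e\<^sup>2 \<le> z\<^sup>2" using that assms by (intro abs_le_square_iff[THEN iffD1]) auto
      then show ?thesis by (auto simp: c_def)
    qed
    then show "ennreal c * indicator {z. e < \<bar>z\<bar>} z \<le> ennreal (min (z\<^sup>2) 1)"
      by (auto simp: indicator_def intro: ennreal_leI)
  qed
  finally have "ennreal c * emeasure \<nu> {z. e < \<bar>z\<bar>} < \<infinity>" using nu_min by (rule le_less_trans)
  then show ?thesis using c by (auto simp: ennreal_mult_less_top less_top)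
qed

text \<open>A Levy measure is finite away from 0, and the one point not covered by the tails is
  null.\<close>

sublocale nu: sigma_finite_measure \<nu>
proof
  define A where "A n = {z::real. 1 / Suc n < \<bar>z\<bar>}" for n :: nat
  have A: "A n \<in> sets borel" for n unfolding A_def by measurable
  have "z \<in> (\<Union>n. A n)" if "z \<noteq> 0" for z
    using nat_approx_posE[of "\<bar>z\<bar>"] that by (auto simp: A_def)
  then have "(\<Union>n. A n) \<union> {0} = UNIV" by blast
  moreover have "emeasure \<nu> (A n) \<noteq> \<infinity>" for n
    using nu_tail_finite[of "1 / Suc n"] by (simp add: A_def)
  ultimately show "\<exists>A. countable A \<and> A \<subseteq> sets \<nu> \<and> \<Union> A = space \<nu> \<and> (\<forall>a\<in>A. emeasure \<nu> a \<noteq> \<infinity>)"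
    using A nu_0 by (intro exI[of _ "range A \<union> {{0}}"]) auto
qed

abbreviation "borel_S \<equiv> restrict_space borel S"

abbreviation "lborel_S \<equiv> restrict_space lborel S"

abbreviation "simple_int \<equiv> simple_integral X S"

abbreviation "has_noise_integral \<equiv> is_stochastic_integral M S X"

sublocale R: sigma_finite_measure "lborel_S"
  by (rule sigma_finite_measure_restrict_space[OF sigma_finite_lborel]) simp

sublocale R_nu: pair_sigma_finite "lborel_S" \<nu> ..

sublocale mu: sigma_finite_measure "intensity S \<nu>"
  unfolding intensity_def by unfold_locales

lemma sets_R [measurable_cong]: "sets lborel_S = sets borel_S"
  by (simp add: sets_restrict_space)

lemma sets_intensity [measurable_cong]:
  "sets (intensity S \<nu>) = sets (borel_S \<Otimes>\<^sub>M borel)"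
  unfolding intensity_def by (intro sets_pair_measure_cong sets_R sets_nu)

lemma space_intensity: "space (intensity S \<nu>) = S \<times> UNIV"
  by (simp add: intensity_def space_pair_measure space_restrict_space)

text \<open>A null set of S times the whole line stays null even if \<nu> is infinite, because 0
  times infinity is 0 in \<open>ennreal\<close>.\<close>

lemma AE_intensity_fst:
  assumes "AE s in lborel_S. P s"
  shows "AE p in intensity S \<nu>. P (fst p)"
proof -
  obtain N where N: "N \<in> null_sets lborel_S"
      "{s \<in> space lborel_S. \<not> P s} \<subseteq> N"
    using assms by (auto elim!: AE_E simp: null_sets_def)
  have "N \<times> UNIV \<in> null_sets (intensity S \<nu>)"
    using N(1) nu.emeasure_pair_measure_Times[of N "lborel_S" UNIV]
    by (auto simp: intensity_def null_sets_def)
  then show ?thesis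
    by (rule AE_I') (use N(2) in \<open>auto simp: space_intensity space_restrict_space\<close>)
qed

text \<open>The symmetry of \<nu> is used here, to make compensators and the imaginary parts of
  exponents vanish. For a nonintegrable function the claim holds by the convention that its Bochner
  integral is 0.\<close>

lemma integral_odd_eq_0:
  fixes f :: "'a \<times> real \<Rightarrow> real"
  assumes "\<And>s z. f (s, - z) = - f (s, z)"
  shows "(\<integral>p. f p \<partial>intensity S \<nu>) = 0"
proof (cases "integrable (intensity S \<nu>) f")
  case True
  then have int: "integrable (lborel_S \<Otimes>\<^sub>M \<nu>) f" by (simp add: intensity_def)
  have "(\<integral>p. f p \<partial>intensity S \<nu>) = (\<integral>s. (\<integral>z. f (s, z) \<partial>\<nu>) \<partial>lborel_S)"
    unfolding intensity_def by (rule R_nu.integral_fst'[OF int, symmetric])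
  also have "\<dots> = (\<integral>s. 0 \<partial>lborel_S)"
  proof (rule Bochner_Integration.integral_cong[OF refl])
    fix s assume "s \<in> space lborel_S"
    then have m: "(\<lambda>z. f (s, z)) \<in> borel_measurable borel"
      using borel_measurable_integrable[OF int] measurable_Pair2 by (metis measurable_cong_sets sets_nu)
    have "(\<integral>z. f (s, z) \<partial>\<nu>) = (\<integral>z. f (s, z) \<partial>distr \<nu> borel uminus)" by (simp add: nu_sym)
    also have "\<dots> = (\<integral>z. f (s, - z) \<partial>\<nu>)" by (rule integral_distr) (use m in auto)
    also have "\<dots> = - (\<integral>z. f (s, z) \<partial>\<nu>)" by (simp add: assms)
    finally show "(\<integral>z. f (s, z) \<partial>\<nu>) = 0" by simp
  qed
  finally show ?thesis by simp
qed (simp add: not_integrable_integral_eq)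

section \<open>The jump modular and simple integrands\<close>

definition jump_modular :: "('a \<Rightarrow> real) \<Rightarrow> ennreal" where
  "jump_modular f = modular (intensity S \<nu>) (\<lambda>(s, z). f s * z)"

lemma measurable_jump [measurable]:
  assumes [measurable]: "f \<in> borel_measurable borel_S"
  shows "(\<lambda>(s, z). f s * z) \<in> borel_measurable (intensity S \<nu>)"
  by measurable

lemma noise_integrable_iff:
  "f \<in> noise_integrable S \<nu> \<longleftrightarrow>
    f \<in> borel_measurable borel_S \<and> jump_modular f < \<infinity>"
  by (simp add: noise_integrable_def jump_modular_def modular_def case_prod_beta')

definition noise_list :: "(real \<times> 'a set) list \<Rightarrow> bool" where
  "noise_list F \<longleftrightarrow> set F \<subseteq> UNIV \<times> noise_sets S"

lemma noise_list_simps [simp]: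
  "noise_list []" "noise_list ((a, A) # F) \<longleftrightarrow> A \<in> noise_sets S \<and> noise_list F"
  "noise_list (F @ G) \<longleftrightarrow> noise_list F \<and> noise_list G"
  by (auto simp: noise_list_def)

lemma noise_setsD:
  assumes "A \<in> noise_sets S"
  shows "A \<in> sets borel" "A \<subseteq> S" "emeasure lborel A < \<infinity>" "A \<in> sets borel_S"
    "A \<in> sets lborel_S" "emeasure lborel_S A < \<infinity>" "A \<inter> S = A"
    "X A \<in> borel_measurable M"
  using assms noise
  by (auto simp: noise_sets_def sets_restrict_space_iff emeasure_restrict_space levy_white_noise_def)

lemma simple_fun_simps [simp]:
  "simple_fun [] s = 0" "simple_fun ((a, A) # F) s = a * indicator A s + simple_fun F s"
  by (simp_all add: simple_fun_def)

lemma simple_integral_simps [simp]: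
  "simple_integral X B [] \<omega> = 0"
  "simple_integral X B ((a, A) # F) \<omega> = a * X (A \<inter> B) \<omega> + simple_integral X B F \<omega>"
  by (simp_all add: simple_integral_def)

lemma measurable_simple_fun [measurable]:
  "noise_list F \<Longrightarrow> simple_fun F \<in> borel_measurable borel_S"
proof (induction F)
  case (Cons p F)
  obtain a A where p: "p = (a, A)" by force
  have [measurable]: "A \<in> sets borel_S" using Cons.prems by (simp add: p noise_setsD)
  have [measurable]: "simple_fun F \<in> borel_measurable borel_S" using Cons by (simp add: p)
  have "(\<lambda>s. a * indicator A s + simple_fun F s) \<in> borel_measurable borel_S" by measurable
  then show ?case by (simp add: p cong: measurable_cong)
qed (simp cong: measurable_cong)

lemma measurable_simple_integral [measurable]:
  "noise_list F \<Longrightarrow> B \<in> sets borel \<Longrightarrow> simple_integral X B F \<in> borel_measurable M"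
proof (induction F)
  case (Cons p F)
  obtain a A where p: "p = (a, A)" by force
  have "A \<inter> B \<in> noise_sets S"
    using Cons.prems emeasure_mono[of "A \<inter> B" A lborel]
    by (auto simp: p noise_sets_def intro: le_less_trans)
  then have [measurable]: "X (A \<inter> B) \<in> borel_measurable M" by (rule noise_setsD)
  have [measurable]: "simple_integral X B F \<in> borel_measurable M" using Cons by (simp add: p)
  have "(\<lambda>\<omega>. a * X (A \<inter> B) \<omega> + simple_integral X B F \<omega>) \<in> borel_measurable M" by measurable
  then show ?case by (simp add: p cong: measurable_cong)
qed (simp cong: measurable_cong)

text \<open>The cut is on the jump size |z|, not on |f(s) z|, which keeps the expression linear in
  \<open>f\<close>. For an indicator function and small jumps both cuts agree, so it matches the
  truncation in \<open>is_compensated_integral\<close>.\<close>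

definition truncated_jump :: "nat \<Rightarrow> ('a \<Rightarrow> real) \<Rightarrow> 'a \<times> real \<Rightarrow> real" where
  "truncated_jump n f p = (if 1 / real (Suc n) < \<bar>snd p\<bar> then f (fst p) * snd p else 0)"

lemma measurable_truncated_jump [measurable]:
  assumes [measurable]: "f \<in> borel_measurable borel_S"
  shows "truncated_jump n f \<in> borel_measurable (intensity S \<nu>)"
  unfolding truncated_jump_def by measurable

lemma intensity_tail_finite:
  assumes "A \<in> noise_sets S"
  shows "emeasure (intensity S \<nu>) (A \<times> {z. 1 / real (Suc n) < \<bar>z\<bar>}) < \<infinity>"
  unfolding intensity_def using noise_setsD[OF assms] nu_tail_finite[of "1 / real (Suc n)"]
  by (subst nu.emeasure_pair_measure_Times) (auto simp: ennreal_mult_less_top)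

lemma tail_support_finite:
  assumes "A \<in> noise_sets S" "g \<in> borel_measurable (intensity S \<nu>)"
    "\<And>s z. g (s, z) \<noteq> 0 \<Longrightarrow> s \<in> A \<and> 1 / real (Suc n) < \<bar>z\<bar>"
  shows "emeasure (intensity S \<nu>) {p \<in> space (intensity S \<nu>). g p \<noteq> (0::real)} < \<infinity>"
proof -
  have [measurable]: "A \<in> sets borel_S" using assms(1) by (rule noise_setsD)
  have "{z::real. 1 / real (Suc n) < \<bar>z\<bar>} \<in> sets borel" by measurable
  then have "A \<times> {z. 1 / real (Suc n) < \<bar>z\<bar>} \<in> sets (intensity S \<nu>)"
    by (simp add: sets_intensity)
  then have "emeasure (intensity S \<nu>) {p \<in> space (intensity S \<nu>). g p \<noteq> 0} \<le>
      emeasure (intensity S \<nu>) (A \<times> {z. 1 / real (Suc n) < \<bar>z\<bar>})"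
    using assms(3) by (intro emeasure_mono) auto
  then show ?thesis using intensity_tail_finite[OF assms(1)] by (rule le_less_trans)
qed

lemma simple_fun_support:
  assumes "noise_list F"
  obtains A where "A \<in> noise_sets S" "\<And>s. simple_fun F s \<noteq> 0 \<Longrightarrow> s \<in> A"
proof -
  have "\<exists>A\<in>noise_sets S. \<forall>s. simple_fun F s \<noteq> 0 \<longrightarrow> s \<in> A"
    using assms
  proof (induction F)
    case Nil
    then show ?case by (intro bexI[of _ "{}"]) (auto simp: noise_sets_def)
  next
    case (Cons p F)
    obtain a A where p: "p = (a, A)" by force
    obtain A' where A': "A' \<in> noise_sets S" "\<forall>s. simple_fun F s \<noteq> 0 \<longrightarrow> s \<in> A'"
      using Cons by (auto simp: p)
    have "A \<in> noise_sets S" using Cons.prems by (simp add: p)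
    with A'(1) have "A \<union> A' \<in> noise_sets S"
      using emeasure_subadditive[of A lborel A']
      by (auto simp: noise_sets_def intro: le_less_trans)
    then show ?case using A'(2) by (intro bexI[of _ "A \<union> A'"]) (auto simp: p indicator_def)
  qed
  then show ?thesis using that by blast
qed

lemma simple_fun_bounded: "\<exists>C. \<forall>s. \<bar>simple_fun F s\<bar> \<le> C"
proof (induction F)
  case (Cons p F)
  then obtain C where C: "\<bar>simple_fun F s\<bar> \<le> C" for s by blast
  obtain a A where p: "p = (a, A)" by force
  have "\<bar>simple_fun (p # F) s\<bar> \<le> \<bar>a\<bar> + C" for s
    using C[of s] by (auto simp: p indicator_def)
  then show ?case by blast
qed (auto intro: exI[of _ 0])

text \<open>A simple function is bounded by some C and lives on a set A of finite measure, so
  Tonelli reduces the claim to the product of the measure of A and the finite Levy integral of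
  \<open>min (z\<^sup>2) 1\<close>.\<close>

lemma jump_modular_simple_fun:
  assumes F: "noise_list F"
  shows "jump_modular (simple_fun F) < \<infinity>"
proof -
  obtain A where A: "A \<in> noise_sets S" "\<And>s. simple_fun F s \<noteq> 0 \<Longrightarrow> s \<in> A"
    using simple_fun_support[OF F] by blast
  obtain C where C: "\<bar>simple_fun F s\<bar> \<le> C" for s using simple_fun_bounded by blast
  have [measurable]: "A \<in> sets borel_S" using A(1) by (rule noise_setsD)
  have "jump_modular (simple_fun F) \<le>
      (\<integral>\<^sup>+p. (ennreal (max (C\<^sup>2) 1) * indicator A (fst p)) * ennreal (min ((snd p)\<^sup>2) 1) \<partial>intensity S \<nu>)"
    unfolding jump_modular_def modular_def
  proof (intro nn_integral_mono, clarsimp)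
    fix s z
    show "ennreal (min ((simple_fun F s * z)\<^sup>2) 1) \<le>
        ennreal (max (C\<^sup>2) 1) * indicator A s * ennreal (min (z\<^sup>2) 1)"
    proof (cases "s \<in> A")
      case True
      have "(simple_fun F s)\<^sup>2 \<le> C\<^sup>2" using C[of s] by (metis abs_ge_zero power2_abs power_mono)
      then have "max ((simple_fun F s)\<^sup>2) 1 \<le> max (C\<^sup>2) 1" by auto
      then have "min ((simple_fun F s * z)\<^sup>2) 1 \<le> max (C\<^sup>2) 1 * min (z\<^sup>2) 1"
        using min_sq_mult_le[of "simple_fun F s" z]
        by (meson mult_right_mono order_trans min.boundedI zero_le_power2 zero_le_one)
      then have "ennreal (min ((simple_fun F s * z)\<^sup>2) 1) \<le> ennreal (max (C\<^sup>2) 1 * min (z\<^sup>2) 1)"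
        by (rule ennreal_leI)
      also have "\<dots> = ennreal (max (C\<^sup>2) 1) * ennreal (min (z\<^sup>2) 1)" by (rule ennreal_mult') auto
      finally show ?thesis using True by simp
    next
      case False
      then have "simple_fun F s = 0" using A(2) by blast
      then show ?thesis by simp
    qed
  qed
  also have "\<dots> = (\<integral>\<^sup>+s. \<integral>\<^sup>+z. (ennreal (max (C\<^sup>2) 1) * indicator A s) * ennreal (min (z\<^sup>2) 1) \<partial>\<nu> \<partial>lborel_S)"
    unfolding intensity_def by (subst nu.nn_integral_fst[symmetric]) auto
  also have "\<dots> = (\<integral>\<^sup>+s. (ennreal (max (C\<^sup>2) 1) * (\<integral>\<^sup>+z. ennreal (min (z\<^sup>2) 1) \<partial>\<nu>)) * indicator A s \<partial>lborel_S)"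
    by (subst nn_integral_cmult) (auto simp: mult_ac)
  also have "\<dots> = (ennreal (max (C\<^sup>2) 1) * (\<integral>\<^sup>+z. ennreal (min (z\<^sup>2) 1) \<partial>\<nu>)) * emeasure lborel_S A"
    using noise_setsD(5)[OF A(1)] by (rule nn_integral_cmult_indicator)
  also have "\<dots> < \<infinity>"
    using noise_setsD(6)[OF A(1)] nu_min by (simp add: ennreal_mult_less_top)
  finally show ?thesis .
qed

lemma truncated_support_finite:
  assumes "noise_list F"
  shows "emeasure (intensity S \<nu>)
    {p \<in> space (intensity S \<nu>). truncated_jump n (simple_fun F) p \<noteq> 0} < \<infinity>"
proof -
  obtain A where A: "A \<in> noise_sets S" "\<And>s. simple_fun F s \<noteq> 0 \<Longrightarrow> s \<in> A"
    using simple_fun_support[OF assms] by blast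
  show ?thesis
    by (rule tail_support_finite[OF A(1)])
      (use assms A(2) in \<open>auto simp: truncated_jump_def split: if_splits intro!: measurable_truncated_jump\<close>)
qed

text \<open>By symmetry the compensator of the small jumps is 0, so small and large jumps merge into
  a single Poisson integral over |z| > 1/(n+1). The L2 convergence in the definition of the noise
  dominates the modular because a truncated square is at most the square.\<close>

lemma X_approx:
  assumes A: "A \<in> noise_sets S"
  shows "(\<lambda>n. modular M (\<lambda>\<omega>. X A \<omega> - (\<integral>p. truncated_jump n (indicator A) p \<partial>J \<omega>))) \<longlonglongrightarrow> 0"
proof -
  have [measurable]: "A \<in> sets borel_S" "X A \<in> borel_measurable M"
    using A by (auto simp: noise_setsD)
  define g :: "'a \<times> real \<Rightarrow> real" where "g = (\<lambda>(s, z). if s \<in> A \<and> \<bar>z\<bar> \<le> 1 then z else 0)"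
  define big :: "'a \<times> real \<Rightarrow> real" where "big = (\<lambda>(s, z). if s \<in> A \<and> 1 < \<bar>z\<bar> then z else 0)"
  define g' where "g' n p = (if 1 / real (Suc n) < \<bar>g p\<bar> then g p else 0)" for n p
  obtain Y where Y: "is_compensated_integral M (intensity S \<nu>) J g Y"
      and XY: "AE \<omega> in M. X A \<omega> = Y \<omega> + (\<integral>p. big p \<partial>J \<omega>)"
    using noise A by (auto simp: levy_white_noise_def g_def big_def)
  have [measurable]: "Y \<in> borel_measurable M" using Y by (simp add: is_compensated_integral_def)
  have lim: "(\<lambda>n. \<integral>\<^sup>+\<omega>. ennreal ((((\<integral>p. g' n p \<partial>J \<omega>) - (\<integral>p. g' n p \<partial>intensity S \<nu>)) - Y \<omega>)\<^sup>2) \<partial>M) \<longlonglongrightarrow> 0"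
    using Y by (simp add: is_compensated_integral_def g'_def[abs_def] Let_def)
  have [measurable]: "g \<in> borel_measurable (intensity S \<nu>)" "big \<in> borel_measurable (intensity S \<nu>)"
    unfolding g_def big_def by measurable
  have [measurable]: "g' n \<in> borel_measurable (intensity S \<nu>)" for n
    unfolding g'_def by measurable
  have comp0: "(\<integral>p. g' n p \<partial>intensity S \<nu>) = 0" for n
    by (rule integral_odd_eq_0) (auto simp: g'_def g_def)
  have big_g': "truncated_jump n (indicator A) p = g' n p + big p" for n p
  proof -
    \<comment> \<open>Thresholds never exceed 1, so the large jumps survive every truncation, also
      for n = 0, where the threshold equals 1 and the small part is 0.\<close>
    have "1 / real (Suc n) < \<bar>z\<bar>" if "1 < \<bar>z\<bar>" for z :: real
      by (rule le_less_trans[OF _ that]) simp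
    then show ?thesis
      by (cases p) (auto simp: truncated_jump_def g'_def g_def big_def indicator_def simp del: of_nat_Suc)
  qed
  have "modular M (\<lambda>\<omega>. X A \<omega> - (\<integral>p. truncated_jump n (indicator A) p \<partial>J \<omega>)) \<le>
      (\<integral>\<^sup>+\<omega>. ennreal ((((\<integral>p. g' n p \<partial>J \<omega>) - (\<integral>p. g' n p \<partial>intensity S \<nu>)) - Y \<omega>)\<^sup>2) \<partial>M)" for n
  proof -
    have "AE \<omega> in M. integrable (J \<omega>) (g' n)"
      by (intro AE_integrable_J tail_support_finite[OF A, of _ n])
        (auto simp: g'_def g_def split: if_splits)
    moreover have "AE \<omega> in M. integrable (J \<omega>) big"
      by (intro AE_integrable_J tail_support_finite[OF A, of _ 0])
        (auto simp: big_def split: if_splits)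
    ultimately have "AE \<omega> in M. X A \<omega> - (\<integral>p. truncated_jump n (indicator A) p \<partial>J \<omega>) =
        Y \<omega> - (\<integral>p. g' n p \<partial>J \<omega>)"
      using XY by eventually_elim (simp add: big_g')
    then have "modular M (\<lambda>\<omega>. X A \<omega> - (\<integral>p. truncated_jump n (indicator A) p \<partial>J \<omega>)) =
        modular M (\<lambda>\<omega>. Y \<omega> - (\<integral>p. g' n p \<partial>J \<omega>))"
      by (rule modular_cong_AE)
    also have "\<dots> \<le> (\<integral>\<^sup>+\<omega>. ennreal ((((\<integral>p. g' n p \<partial>J \<omega>) - (\<integral>p. g' n p \<partial>intensity S \<nu>)) - Y \<omega>)\<^sup>2) \<partial>M)"
      unfolding modular_def comp0
      by (intro nn_integral_mono ennreal_leI) (simp add: power2_commute)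
    finally show ?thesis .
  qed
  then show ?thesis using lim by (rule ennreal_tendsto_0_le)
qed

text \<open>Linearity of \<open>truncated_jump\<close> carries the approximation along the list.
  Almost sure integrability against J is checked for each summand, since Bochner integrals are
  added.\<close>

lemma simple_integral_approx:
  assumes "noise_list F"
  shows "(\<lambda>n. modular M (\<lambda>\<omega>. simple_int F \<omega> -
    (\<integral>p. truncated_jump n (simple_fun F) p \<partial>J \<omega>))) \<longlonglongrightarrow> 0"
  using assms
proof (induction F)
  case Nil
  have "truncated_jump n (simple_fun []) = (\<lambda>_. 0)" for n by (simp add: truncated_jump_def fun_eq_iff)
  then show ?case by (simp add: modular_def del: simple_fun_simps)
next
  case (Cons q F)
  obtain a A where q: "q = (a, A)" by force
  have A: "A \<in> noise_sets S" and F: "noise_list F" using Cons.prems by (auto simp: q)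
  have [measurable]: "A \<in> sets borel_S" "X A \<in> borel_measurable M"
    using A by (auto simp: noise_setsD)
  have mF [measurable]: "simple_fun F \<in> borel_measurable borel_S"
      "simple_int F \<in> borel_measurable M"
    using F by auto
  define u where "u n \<omega> = X A \<omega> - (\<integral>p. truncated_jump n (indicator A) p \<partial>J \<omega>)" for n \<omega>
  define v where "v n \<omega> = simple_int F \<omega> - (\<integral>p. truncated_jump n (simple_fun F) p \<partial>J \<omega>)" for n \<omega>
  have [measurable]: "u n \<in> borel_measurable M" "v n \<in> borel_measurable M" for n
    unfolding u_def v_def by measurable
  have lin: "truncated_jump n (simple_fun (q # F)) =
      (\<lambda>p. a * truncated_jump n (indicator A) p + truncated_jump n (simple_fun F) p)" for n
    by (simp add: truncated_jump_def q fun_eq_iff algebra_simps)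
  have int_q: "simple_int (q # F) \<omega> = a * X A \<omega> + simple_int F \<omega>" for \<omega>
    by (simp add: q noise_setsD(7)[OF A])
  have "modular M (\<lambda>\<omega>. simple_int (q # F) \<omega> - (\<integral>p. truncated_jump n (simple_fun (q # F)) p \<partial>J \<omega>)) \<le>
      2 * (ennreal (max (a\<^sup>2) 1) * modular M (u n)) + 2 * modular M (v n)" for n
  proof -
    have "AE \<omega> in M. integrable (J \<omega>) (truncated_jump n (indicator A))"
      by (intro AE_integrable_J tail_support_finite[OF A, of _ n])
        (auto simp: truncated_jump_def indicator_def split: if_splits)
    moreover have "AE \<omega> in M. integrable (J \<omega>) (truncated_jump n (simple_fun F))"
      by (intro AE_integrable_J truncated_support_finite F) simp
    ultimately have "AE \<omega> in M. simple_int (q # F) \<omega> - (\<integral>p. truncated_jump n (simple_fun (q # F)) p \<partial>J \<omega>) =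
        a * u n \<omega> + v n \<omega>"
      by eventually_elim (simp add: lin int_q u_def v_def algebra_simps)
    then have "modular M (\<lambda>\<omega>. simple_int (q # F) \<omega> - (\<integral>p. truncated_jump n (simple_fun (q # F)) p \<partial>J \<omega>)) =
        modular M (\<lambda>\<omega>. a * u n \<omega> + v n \<omega>)"
      by (rule modular_cong_AE)
    also have "\<dots> \<le> 2 * modular M (\<lambda>\<omega>. a * u n \<omega>) + 2 * modular M (v n)"
      by (rule modular_add_le) auto
    also have "\<dots> \<le> 2 * (ennreal (max (a\<^sup>2) 1) * modular M (u n)) + 2 * modular M (v n)"
      by (intro add_right_mono mult_left_mono modular_cmult_le) auto
    finally show ?thesis .
  qed
  moreover have "(\<lambda>n. 2 * (ennreal (max (a\<^sup>2) 1) * modular M (u n)) + 2 * modular M (v n)) \<longlonglongrightarrow>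
      2 * (ennreal (max (a\<^sup>2) 1) * 0) + 2 * 0"
    using X_approx[OF A] Cons.IH[OF F]
    by (intro tendsto_add ennreal_tendsto_cmult) (auto simp: u_def[abs_def] v_def[abs_def])
  ultimately show ?case by - (rule ennreal_tendsto_0_le, assumption, simp)
qed

text \<open>The imaginary part of the exponent is the integral of a sine, odd in z, and vanishes;
  the expectation of the cosine is then the exponential of the real part.\<close>

lemma cos_integral_J_truncated:
  assumes F: "noise_list F"
  shows "(\<integral>\<omega>. cos (\<theta> * (\<integral>p. truncated_jump n (simple_fun F) p \<partial>J \<omega>)) \<partial>M) =
    exp (- (\<integral>p. 1 - cos (\<theta> * truncated_jump n (simple_fun F) p) \<partial>intensity S \<nu>))"
proof -
  define G where "G p = \<theta> * truncated_jump n (simple_fun F) p" for p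
  have [measurable]: "simple_fun F \<in> borel_measurable borel_S" using F by simp
  have [measurable]: "G \<in> borel_measurable (intensity S \<nu>)" unfolding G_def by measurable
  have "emeasure (intensity S \<nu>) {p \<in> space (intensity S \<nu>). G p \<noteq> 0} \<le>
      emeasure (intensity S \<nu>) {p \<in> space (intensity S \<nu>). truncated_jump n (simple_fun F) p \<noteq> 0}"
    by (intro emeasure_mono) (auto simp: G_def)
  then have fin: "emeasure (intensity S \<nu>) {p \<in> space (intensity S \<nu>). G p \<noteq> 0} < \<infinity>"
    using truncated_support_finite[OF F] by (rule le_less_trans)
  let ?c = "CLINT p|intensity S \<nu>. iexp (G p) - 1"
  have int: "complex_integrable (intensity S \<nu>) (\<lambda>p. iexp (G p) - 1)"
  proof (rule integrableI_bounded_set[where A="{p \<in> space (intensity S \<nu>). G p \<noteq> 0}" and B=2])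
    have "norm (iexp (G p) - 1) \<le> norm (iexp (G p)) + norm (1::complex)" for p
      by (rule norm_triangle_ineq4)
    then show "AE p\<in>{p \<in> space (intensity S \<nu>). G p \<noteq> 0} in intensity S \<nu>. norm (iexp (G p) - 1) \<le> 2"
      by simp
  qed (use fin in auto)
  have "Im ?c = (\<integral>p. sin (G p) \<partial>intensity S \<nu>)"
    using integral_Im[OF int] by (simp add: Im_exp)
  also have "\<dots> = 0" by (rule integral_odd_eq_0) (simp add: G_def truncated_jump_def)
  finally have Im: "Im ?c = 0" .
  have Re: "Re ?c = - (\<integral>p. 1 - cos (G p) \<partial>intensity S \<nu>)"
  proof -
    have "Re ?c = (\<integral>p. - (1 - cos (G p)) \<partial>intensity S \<nu>)"
      using integral_Re[OF int] by (simp add: Re_exp)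
    also have "\<dots> = - (\<integral>p. 1 - cos (G p) \<partial>intensity S \<nu>)" by (rule Bochner_Integration.integral_minus)
    finally show ?thesis .
  qed
  have "complex_integrable M (\<lambda>\<omega>. iexp (\<integral>p. G p \<partial>J \<omega>))"
    by (rule integrable_const_bound[where B=1]) auto
  then have "(\<integral>\<omega>. cos (\<integral>p. G p \<partial>J \<omega>) \<partial>M) = Re (CLINT \<omega>|M. iexp (\<integral>p. G p \<partial>J \<omega>))"
    by (subst integral_Re[symmetric]) (simp_all add: Re_exp)
  also have "\<dots> = exp (- (\<integral>p. 1 - cos (G p) \<partial>intensity S \<nu>))"
    by (subst char_integral_J[OF _ fin]) (simp_all add: Re_exp Im Re)
  finally show ?thesis by (simp add: G_def)
qed

section \<open>The cosine transform of simple integrals and the two modular bounds\<close>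

lemma integrable_one_minus_cos:
  assumes [measurable]: "f \<in> borel_measurable borel_S"
    and "jump_modular f < \<infinity>" and \<theta>: "\<theta> \<in> {0..1}"
  shows "integrable (intensity S \<nu>) (\<lambda>(s, z). 1 - cos (\<theta> * (f s * z)))"
proof (rule integrableI_nonneg)
  have "(\<integral>\<^sup>+p. ennreal (1 - cos (\<theta> * (case p of (s, z) \<Rightarrow> f s * z))) \<partial>intensity S \<nu>) \<le> 2 * jump_modular f"
    unfolding jump_modular_def by (rule nn_integral_one_minus_cos_le[OF _ \<theta>]) simp
  also have "\<dots> < \<infinity>" using assms(2) by (simp add: ennreal_mult_less_top)
  finally show "(\<integral>\<^sup>+p. ennreal (case p of (s, z) \<Rightarrow> 1 - cos (\<theta> * (f s * z))) \<partial>intensity S \<nu>) < \<infinity>"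
    by (simp add: case_prod_beta')
qed (measurable, auto)

lemma cos_simple_integral:
  assumes F: "noise_list F" and \<theta>: "\<theta> \<in> {0..1}"
  shows "(\<integral>\<omega>. cos (\<theta> * simple_int F \<omega>) \<partial>M) =
    exp (- (\<integral>(s, z). 1 - cos (\<theta> * (simple_fun F s * z)) \<partial>intensity S \<nu>))"
proof -
  have [measurable]: "simple_fun F \<in> borel_measurable borel_S"
      "simple_int F \<in> borel_measurable M"
    using F by auto
  define Y where "Y n \<omega> = (\<integral>p. truncated_jump n (simple_fun F) p \<partial>J \<omega>)" for n \<omega>
  have [measurable]: "Y n \<in> borel_measurable M" for n unfolding Y_def by measurable
  \<comment> \<open>The truncated integrals are known to converge only for the modular; an almost
    surely convergent subsequence makes dominated convergence applicable.\<close>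
  obtain r :: "nat \<Rightarrow> nat" where r: "strict_mono r"
      "AE \<omega> in M. (\<lambda>n. simple_int F \<omega> - Y (r n) \<omega>) \<longlonglongrightarrow> 0"
    using modular_subseq_AE[of "\<lambda>n \<omega>. simple_int F \<omega> - Y n \<omega>" M]
      simple_integral_approx[OF F] by (auto simp: Y_def)
  have "(\<lambda>n. \<integral>\<omega>. cos (\<theta> * Y (r n) \<omega>) \<partial>M) \<longlonglongrightarrow> (\<integral>\<omega>. cos (\<theta> * simple_int F \<omega>) \<partial>M)"
  proof (rule integral_dominated_convergence[where w="\<lambda>_. 1"])
    show "AE \<omega> in M. (\<lambda>n. cos (\<theta> * Y (r n) \<omega>)) \<longlonglongrightarrow> cos (\<theta> * simple_int F \<omega>)"
      using r(2)
    proof eventually_elim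
      case (elim \<omega>)
      have "(\<lambda>n. simple_int F \<omega> - (simple_int F \<omega> - Y (r n) \<omega>)) \<longlonglongrightarrow>
          simple_int F \<omega> - 0"
        by (intro tendsto_diff tendsto_const elim)
      then have "(\<lambda>n. Y (r n) \<omega>) \<longlonglongrightarrow> simple_int F \<omega>" by simp
      then show ?case by (intro tendsto_intros)
    qed
  qed auto
  moreover have "(\<lambda>n. \<integral>\<omega>. cos (\<theta> * Y (r n) \<omega>) \<partial>M) \<longlonglongrightarrow>
      exp (- (\<integral>(s, z). 1 - cos (\<theta> * (simple_fun F s * z)) \<partial>intensity S \<nu>))"
    unfolding Y_def cos_integral_J_truncated[OF F]
  proof (intro tendsto_exp tendsto_minus integral_dominated_convergence
      [where w="\<lambda>(s, z). 1 - cos (\<theta> * (simple_fun F s * z))"])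
    show "integrable (intensity S \<nu>) (\<lambda>(s, z). 1 - cos (\<theta> * (simple_fun F s * z)))"
      by (rule integrable_one_minus_cos) (use F \<theta> jump_modular_simple_fun in auto)
    show "AE p in intensity S \<nu>. (\<lambda>n. 1 - cos (\<theta> * truncated_jump (r n) (simple_fun F) p)) \<longlonglongrightarrow>
        (case p of (s, z) \<Rightarrow> 1 - cos (\<theta> * (simple_fun F s * z)))"
    proof (rule AE_I2)
      fix p :: "'a \<times> real"
      obtain s z where p: "p = (s, z)" by force
      have "\<forall>\<^sub>F n in sequentially. truncated_jump (r n) (simple_fun F) p = simple_fun F s * z"
      proof (cases "z = 0")
        case False
        then obtain k where k: "1 / real (Suc k) < \<bar>z\<bar>" using nat_approx_posE[of "\<bar>z\<bar>"] by auto
        have "1 / real (Suc (r n)) < \<bar>z\<bar>" if "n \<ge> k" for n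
        proof -
          have "k \<le> r n" using that seq_suble[OF r(1), of n] by linarith
          then have "1 / real (Suc (r n)) \<le> 1 / real (Suc k)" by (simp add: frac_le)
          then show ?thesis using k by linarith
        qed
        then show ?thesis unfolding eventually_sequentially
          by (intro exI[of _ k]) (simp add: truncated_jump_def p)
      qed (simp add: truncated_jump_def p)
      then have "\<forall>\<^sub>F n in sequentially. 1 - cos (\<theta> * truncated_jump (r n) (simple_fun F) p) =
          1 - cos (\<theta> * (simple_fun F s * z))"
        by eventually_elim simp
      then show "(\<lambda>n. 1 - cos (\<theta> * truncated_jump (r n) (simple_fun F) p)) \<longlonglongrightarrow>
          (case p of (s, z) \<Rightarrow> 1 - cos (\<theta> * (simple_fun F s * z)))"
        unfolding p prod.case by (rule tendsto_eventually)
    qed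
    \<comment> \<open>A truncated jump is either the full jump or 0, and
      \<open>1 - cos 0 = 0\<close>, so the untruncated integrand is a majorant.\<close>
    show "AE p in intensity S \<nu>. norm (1 - cos (\<theta> * truncated_jump (r n) (simple_fun F) p)) \<le>
        (case p of (s, z) \<Rightarrow> 1 - cos (\<theta> * (simple_fun F s * z)))" for n
      by (intro AE_I2) (auto simp: truncated_jump_def)
  qed auto
  ultimately show ?thesis by (rule LIMSEQ_unique)
qed

text \<open>The exponent is provided as a real number: its finiteness lets
  \<open>exp (- \<Psi>)\<close> be estimated in the reals, while both neighbouring quantities stay
  in \<open>ennreal\<close> as the averaging bounds need them.\<close>

lemma one_minus_cos_simple_integral:
  assumes F: "noise_list F" and \<theta>: "\<theta> \<in> {0..1}"
  obtains \<Psi> where "\<Psi> \<ge> 0"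
    "(\<integral>\<^sup>+\<omega>. ennreal (1 - cos (\<theta> * simple_int F \<omega>)) \<partial>M) = ennreal (1 - exp (- \<Psi>))"
    "(\<integral>\<^sup>+p. ennreal (1 - cos (\<theta> * (case p of (s, z) \<Rightarrow> simple_fun F s * z))) \<partial>intensity S \<nu>) = ennreal \<Psi>"
proof -
  have [measurable]: "simple_fun F \<in> borel_measurable borel_S"
      "simple_int F \<in> borel_measurable M"
    using F by auto
  define \<Psi> where "\<Psi> = (\<integral>(s, z). 1 - cos (\<theta> * (simple_fun F s * z)) \<partial>intensity S \<nu>)"
  have int: "integrable M (\<lambda>\<omega>. cos (\<theta> * simple_int F \<omega>))"
    by (rule integrable_const_bound[where B=1]) auto
  show ?thesis
  proof (rule that[of \<Psi>])
    show "\<Psi> \<ge> 0" unfolding \<Psi>_def by (rule integral_nonneg_AE) auto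
    have "(\<integral>\<^sup>+\<omega>. ennreal (1 - cos (\<theta> * simple_int F \<omega>)) \<partial>M) =
        ennreal (\<integral>\<omega>. 1 - cos (\<theta> * simple_int F \<omega>) \<partial>M)"
      using int by (intro nn_integral_eq_integral) auto
    also have "(\<integral>\<omega>. 1 - cos (\<theta> * simple_int F \<omega>) \<partial>M) = 1 - exp (- \<Psi>)"
      using int by (simp add: prob_space cos_simple_integral[OF F \<theta>] \<Psi>_def)
    finally show "(\<integral>\<^sup>+\<omega>. ennreal (1 - cos (\<theta> * simple_int F \<omega>)) \<partial>M) = ennreal (1 - exp (- \<Psi>))" .
    have "(\<integral>\<^sup>+p. ennreal (case p of (s, z) \<Rightarrow> 1 - cos (\<theta> * (simple_fun F s * z))) \<partial>intensity S \<nu>) = ennreal \<Psi>"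
      unfolding \<Psi>_def
      by (intro nn_integral_eq_integral integrable_one_minus_cos)
        (use F \<theta> jump_modular_simple_fun in auto)
    then show "(\<integral>\<^sup>+p. ennreal (1 - cos (\<theta> * (case p of (s, z) \<Rightarrow> simple_fun F s * z))) \<partial>intensity S \<nu>) = ennreal \<Psi>"
      by (simp add: case_prod_beta')
  qed
qed

text \<open>Rests on \<open>1 - exp (- \<Psi>) \<le> \<Psi>\<close> for each \<theta>. The constant
  is 8 from averaging times 2 from bounding \<open>1 - cos\<close> by truncated squares.\<close>

lemma modular_simple_integral_le:
  assumes F: "noise_list F"
  shows "modular M (simple_int F) \<le> 16 * jump_modular (simple_fun F)"
proof -
  have [measurable]: "simple_fun F \<in> borel_measurable borel_S"
      "simple_int F \<in> borel_measurable M"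
    using F by auto
  have "modular M (simple_int F) \<le> 8 * (\<integral>\<^sup>+\<theta>.
      (\<integral>\<^sup>+\<omega>. ennreal (1 - cos (\<theta> * simple_int F \<omega>)) \<partial>M) * indicator {0..1} \<theta> \<partial>lborel)"
    by (rule modular_le_cos_average) simp
  also have "\<dots> \<le> 8 * (\<integral>\<^sup>+\<theta>. (2 * jump_modular (simple_fun F)) * indicator {0..1::real} \<theta> \<partial>lborel)"
  proof (intro mult_left_mono nn_integral_mono)
    fix \<theta> :: real
    show "(\<integral>\<^sup>+\<omega>. ennreal (1 - cos (\<theta> * simple_int F \<omega>)) \<partial>M) * indicator {0..1} \<theta> \<le>
        (2 * jump_modular (simple_fun F)) * indicator {0..1} \<theta>"
    proof (cases "\<theta> \<in> {0..1}")
      case True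
      obtain \<Psi> where \<Psi>: "\<Psi> \<ge> 0"
        "(\<integral>\<^sup>+\<omega>. ennreal (1 - cos (\<theta> * simple_int F \<omega>)) \<partial>M) = ennreal (1 - exp (- \<Psi>))"
        "(\<integral>\<^sup>+p. ennreal (1 - cos (\<theta> * (case p of (s, z) \<Rightarrow> simple_fun F s * z))) \<partial>intensity S \<nu>) = ennreal \<Psi>"
        using one_minus_cos_simple_integral[OF F True] by blast
      have "1 - exp (- \<Psi>) \<le> \<Psi>" using exp_ge_add_one_self[of "- \<Psi>"] by linarith
      then have "ennreal (1 - exp (- \<Psi>)) \<le> ennreal \<Psi>" by (rule ennreal_leI)
      also have "\<dots> \<le> 2 * jump_modular (simple_fun F)"
        unfolding \<Psi>(3)[symmetric] jump_modular_def
        by (rule nn_integral_one_minus_cos_le[OF _ True]) simp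
      finally show ?thesis using True \<Psi>(2) by simp
    qed simp
  qed simp
  also have "\<dots> = 16 * jump_modular (simple_fun F)"
    by (subst nn_integral_cmult_indicator) (auto simp: mult.assoc[symmetric])
  finally show ?thesis .
qed

text \<open>The threshold 1/4 keeps \<open>1 - exp (- \<Psi>)\<close> below 1/2 for every \<theta>,
  away from its saturation at 1; there \<open>\<Psi> \<le> 2 * (1 - exp (- \<Psi>))\<close> by the
  logarithm inequality. The constant is 8 from averaging, times 2 from the cosine bound, times 2
  from the logarithm.\<close>

lemma jump_modular_simple_fun_le:
  assumes F: "noise_list F" and small: "modular M (simple_int F) \<le> ennreal (1/4)"
  shows "jump_modular (simple_fun F) \<le> 32 * modular M (simple_int F)"
proof -
  have [measurable]: "simple_fun F \<in> borel_measurable borel_S"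
      "simple_int F \<in> borel_measurable M"
    using F by auto
  define m where "m = modular M (simple_int F)"
  have "jump_modular (simple_fun F) \<le> 8 * (\<integral>\<^sup>+\<theta>.
      (\<integral>\<^sup>+p. ennreal (1 - cos (\<theta> * (case p of (s, z) \<Rightarrow> simple_fun F s * z))) \<partial>intensity S \<nu>) * indicator {0..1} \<theta> \<partial>lborel)"
    unfolding jump_modular_def by (rule mu.modular_le_cos_average) simp
  also have "\<dots> \<le> 8 * (\<integral>\<^sup>+\<theta>. (4 * m) * indicator {0..1::real} \<theta> \<partial>lborel)"
  proof (intro mult_left_mono nn_integral_mono)
    fix \<theta> :: real
    show "(\<integral>\<^sup>+p. ennreal (1 - cos (\<theta> * (case p of (s, z) \<Rightarrow> simple_fun F s * z))) \<partial>intensity S \<nu>) * indicator {0..1} \<theta> \<le>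
        (4 * m) * indicator {0..1} \<theta>"
    proof (cases "\<theta> \<in> {0..1}")
      case True
      obtain \<Psi> where \<Psi>: "\<Psi> \<ge> 0"
        "(\<integral>\<^sup>+\<omega>. ennreal (1 - cos (\<theta> * simple_int F \<omega>)) \<partial>M) = ennreal (1 - exp (- \<Psi>))"
        "(\<integral>\<^sup>+p. ennreal (1 - cos (\<theta> * (case p of (s, z) \<Rightarrow> simple_fun F s * z))) \<partial>intensity S \<nu>) = ennreal \<Psi>"
        using one_minus_cos_simple_integral[OF F True] by blast
      define y where "y = exp (- \<Psi>)"
      have le: "ennreal (1 - y) \<le> 2 * m"
        unfolding y_def \<Psi>(2)[symmetric] m_def by (rule nn_integral_one_minus_cos_le[OF _ True]) simp
      have "2 * m \<le> 2 * ennreal (1/4)" using small unfolding m_def by (rule mult_left_mono) simp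
      also have "\<dots> = ennreal (1/2)" by (subst ennreal_numeral[symmetric]) (simp flip: ennreal_mult' ennreal_numeral)
      finally have "ennreal (1 - y) \<le> ennreal (1/2)" using le by (rule order_trans[rotated])
      then have y: "y \<ge> 1/2" by (subst (asm) ennreal_le_iff) auto
      have "1 / y = exp \<Psi>" by (simp add: y_def exp_minus field_simps)
      then have "\<Psi> = ln (1 / y)" by simp
      also have "\<dots> \<le> 1 / y - 1" using y by (intro ln_le_minus_one) simp
      also have "\<dots> = (1 - y) * (1 / y)" using y by (simp add: field_simps)
      also have "\<dots> \<le> (1 - y) * 2"
        using y \<Psi>(1) by (intro mult_left_mono) (auto simp: y_def field_simps)
      finally have "ennreal \<Psi> \<le> ennreal (2 * (1 - y))" by (intro ennreal_leI) simp
      also have "\<dots> = 2 * ennreal (1 - y)" by (subst ennreal_mult') simp_all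
      also have "\<dots> \<le> 2 * (2 * m)" using le by (rule mult_left_mono) simp
      finally show ?thesis using True \<Psi>(3) by (simp add: mult.assoc[symmetric])
    qed simp
  qed simp
  also have "\<dots> = 32 * m"
    by (subst nn_integral_cmult_indicator) (auto simp: mult.assoc[symmetric])
  finally show ?thesis by (simp add: m_def)
qed

end

section \<open>The stochastic integral\<close>

lemma AE_lim_convergent:
  fixes f :: "nat \<Rightarrow> 'b \<Rightarrow> real"
  assumes "AE x in P. convergent (\<lambda>n. f n x)"
  shows "AE x in P. (\<lambda>n. f n x - lim (\<lambda>n. f n x)) \<longlonglongrightarrow> 0"
  using assms
proof eventually_elim
  case (elim x)
  then have "(\<lambda>n. f n x) \<longlonglongrightarrow> lim (\<lambda>n. f n x)" by (simp add: convergent_LIMSEQ_iff)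
  then show ?case by (simp add: LIM_zero_iff)
qed

text \<open>Simple functions are lists, so linear combinations become list operations: appending
  adds, scaling multiplies. The companion \<open>restrict_list\<close> turns an integral over B into
  one over S, so that bounds proved over S apply to every Borel subset.\<close>

definition scale_list :: "real \<Rightarrow> (real \<times> 'b set) list \<Rightarrow> (real \<times> 'b set) list" where
  "scale_list c F = map (\<lambda>(a, A). (c * a, A)) F"

definition restrict_list :: "'b set \<Rightarrow> (real \<times> 'b set) list \<Rightarrow> (real \<times> 'b set) list" where
  "restrict_list B F = map (\<lambda>(a, A). (a, A \<inter> B)) F"

lemma simple_fun_append: "simple_fun (F @ G) s = simple_fun F s + simple_fun G s"
  by (simp add: simple_fun_def)

lemma simple_fun_scale: "simple_fun (scale_list c F) s = c * simple_fun F s"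
  by (induction F) (auto simp: simple_fun_def scale_list_def algebra_simps)

lemma simple_fun_restrict: "simple_fun (restrict_list B F) s = indicator B s * simple_fun F s"
  by (induction F) (auto simp: simple_fun_def restrict_list_def algebra_simps indicator_inter_arith)

lemma simple_integral_append:
  "simple_integral X B (F @ G) \<omega> = simple_integral X B F \<omega> + simple_integral X B G \<omega>"
  by (simp add: simple_integral_def)

lemma simple_integral_scale: "simple_integral X B (scale_list c F) \<omega> = c * simple_integral X B F \<omega>"
  by (induction F) (auto simp: simple_integral_def scale_list_def algebra_simps)

lemma simple_integral_restrict:
  "B \<subseteq> S \<Longrightarrow> simple_integral X S (restrict_list B F) = simple_integral X B F"
  by (induction F)
    (auto simp: simple_integral_def restrict_list_def fun_eq_iff Int_absorb2 Int_assoc)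

context levy_noise
begin

section \<open>Algebra of simple integrands and of jump modulars\<close>

lemma noise_list_scale [simp]: "noise_list F \<Longrightarrow> noise_list (scale_list c F)"
  by (induction F) (auto simp: scale_list_def)

lemma noise_list_restrict:
  assumes "B \<in> sets borel" "noise_list F"
  shows "noise_list (restrict_list B F)"
proof -
  have "A \<inter> B \<in> noise_sets S" if "A \<in> noise_sets S" for A
    using that assms(1) emeasure_mono[of "A \<inter> B" A lborel]
    by (auto simp: noise_sets_def intro: le_less_trans)
  with assms(2) show ?thesis by (induction F) (auto simp: restrict_list_def)
qed

lemma jump_modular_add_le:
  assumes [measurable]: "f \<in> borel_measurable borel_S"
    "g \<in> borel_measurable borel_S"
  shows "jump_modular (\<lambda>s. f s + g s) \<le> 2 * jump_modular f + 2 * jump_modular g"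
  using modular_add_le[of "\<lambda>(s, z). f s * z" "intensity S \<nu>" "\<lambda>(s, z). g s * z"]
  by (simp add: jump_modular_def case_prod_beta' algebra_simps)

lemma jump_modular_diff_le:
  assumes [measurable]: "f \<in> borel_measurable borel_S"
    "g \<in> borel_measurable borel_S" "h \<in> borel_measurable borel_S"
  shows "jump_modular (\<lambda>s. f s - h s) \<le>
    2 * jump_modular (\<lambda>s. f s - g s) + 2 * jump_modular (\<lambda>s. g s - h s)"
  using jump_modular_add_le[of "\<lambda>s. f s - g s" "\<lambda>s. g s - h s"] by simp

lemma jump_modular_commute: "jump_modular (\<lambda>s. f s - g s) = jump_modular (\<lambda>s. g s - f s)"
  unfolding jump_modular_def modular_def
  by (intro nn_integral_cong) (auto simp: power_mult_distrib power2_commute)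

lemma jump_modular_mono:
  assumes "\<And>s. s \<in> S \<Longrightarrow> \<bar>f s\<bar> \<le> \<bar>g s\<bar>"
  shows "jump_modular f \<le> jump_modular g"
  unfolding jump_modular_def
  by (rule modular_mono) (auto simp: space_intensity abs_mult intro!: mult_right_mono assms)

lemma AE_jump_tendsto:
  assumes "AE s in lborel_S. (\<lambda>n. f n s) \<longlonglongrightarrow> g s"
  shows "AE p in intensity S \<nu>. (\<lambda>n. case p of (s, z) \<Rightarrow> f n s * z) \<longlonglongrightarrow> (case p of (s, z) \<Rightarrow> g s * z)"
  using AE_intensity_fst[OF assms]
  by eventually_elim (auto simp: case_prod_beta' intro: tendsto_mult_right)

lemma simple_diff:
  "simple_fun (F @ scale_list (-1) G) = (\<lambda>s. simple_fun F s - simple_fun G s)"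
  "simple_int (F @ scale_list (-1) G) = (\<lambda>\<omega>. simple_int F \<omega> - simple_int G \<omega>)"
  by (simp_all add: fun_eq_iff simple_fun_append simple_fun_scale simple_integral_append simple_integral_scale)

lemma simple_integral_diff_le:
  assumes "noise_list F" "noise_list G"
  shows "modular M (\<lambda>\<omega>. simple_int F \<omega> - simple_int G \<omega>) \<le>
    16 * jump_modular (\<lambda>s. simple_fun F s - simple_fun G s)"
  using modular_simple_integral_le[of "F @ scale_list (-1) G"] assms by (simp add: simple_diff)

lemma jump_modular_simple_diff_le:
  assumes "noise_list F" "noise_list G"
    and "modular M (\<lambda>\<omega>. simple_int F \<omega> - simple_int G \<omega>) \<le> ennreal (1/4)"
  shows "jump_modular (\<lambda>s. simple_fun F s - simple_fun G s) \<le>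
    32 * modular M (\<lambda>\<omega>. simple_int F \<omega> - simple_int G \<omega>)"
  using jump_modular_simple_fun_le[of "F @ scale_list (-1) G"] assms by (simp add: simple_diff)

lemma is_stochastic_integral_iff:
  "has_noise_integral f Y \<longleftrightarrow>
    (\<exists>F. (\<forall>n. noise_list (F n)) \<and>
      (AE s in lborel_S. (\<lambda>n. simple_fun (F n) s) \<longlonglongrightarrow> f s) \<and>
      (\<forall>B\<in>sets borel. B \<subseteq> S \<longrightarrow>
        (\<exists>Z. converges_in_prob M (\<lambda>n. simple_integral X B (F n)) Z)) \<and>
      converges_in_prob M (\<lambda>n. simple_int (F n)) Y)"
  by (simp add: is_stochastic_integral_def noise_list_def)

lemma is_stochastic_integral_measurable:
  "has_noise_integral f Y \<Longrightarrow> Y \<in> borel_measurable M"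
  by (auto simp: is_stochastic_integral_def converges_in_prob_def)

text \<open>Convergence of the simple integrals over \<open>S\<close> alone makes the integrands a Cauchy
  sequence for \<^term>\<open>jump_modular\<close>, and Fatou's lemma identifies the limit.\<close>

lemma is_stochastic_integral_approx:
  assumes "has_noise_integral f Y"
  obtains F where "\<And>n. noise_list (F n)"
    "(\<lambda>n. modular M (\<lambda>\<omega>. simple_int (F n) \<omega> - Y \<omega>)) \<longlonglongrightarrow> 0"
    "(\<lambda>n. jump_modular (\<lambda>s. simple_fun (F n) s - f s)) \<longlonglongrightarrow> 0"
proof -
  obtain F where F: "\<And>n. noise_list (F n)"
      "AE s in lborel_S. (\<lambda>n. simple_fun (F n) s) \<longlonglongrightarrow> f s"
      "converges_in_prob M (\<lambda>n. simple_int (F n)) Y"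
    using assms by (auto simp: is_stochastic_integral_iff)
  have lim: "(\<lambda>n. modular M (\<lambda>\<omega>. simple_int (F n) \<omega> - Y \<omega>)) \<longlonglongrightarrow> 0"
    and [measurable]: "Y \<in> borel_measurable M"
    using F(3) by (auto simp: converges_in_prob_iff_modular)
  have [measurable]: "simple_fun (F n) \<in> borel_measurable borel_S"
      "simple_int (F n) \<in> borel_measurable M" for n
    using F(1) by auto
  have "(\<lambda>n. jump_modular (\<lambda>s. simple_fun (F n) s - f s)) \<longlonglongrightarrow> 0"
    unfolding tendsto_0_ennreal_iff
  proof (intro allI impI)
    fix e :: real assume "e > 0"
    \<comment> \<open>Two differences to Y cost 4d, which must stay below the threshold 1/4 of
      \<open>jump_modular_simple_diff_le\<close>; its factor 32 then gives 128 d.\<close>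
    define d where "d = min (1/16) (e / 128)"
    have d: "d > 0" "4 * d \<le> 1/4" "128 * d \<le> e" using \<open>e > 0\<close> by (auto simp: d_def)
    obtain N where N: "modular M (\<lambda>\<omega>. simple_int (F n) \<omega> - Y \<omega>) \<le> ennreal d" if "n \<ge> N" for n
      using lim[unfolded tendsto_0_ennreal_iff] d(1) by (auto simp: eventually_sequentially)
    have diff: "jump_modular (\<lambda>s. simple_fun (F n) s - simple_fun (F m) s) \<le> ennreal e"
      if "n \<ge> N" "m \<ge> N" for n m
    proof -
      have "modular M (\<lambda>\<omega>. simple_int (F n) \<omega> - simple_int (F m) \<omega>) \<le>
          2 * modular M (\<lambda>\<omega>. simple_int (F n) \<omega> - Y \<omega>) +
          2 * modular M (\<lambda>\<omega>. Y \<omega> - simple_int (F m) \<omega>)"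
        by (rule modular_diff_le) auto
      also have "\<dots> \<le> 2 * ennreal d + 2 * ennreal d"
        using N[OF that(1)] N[OF that(2)]
        by (intro add_mono mult_left_mono) (auto simp: modular_minus_commute[of M Y])
      also have "\<dots> = ennreal (4 * d)"
        using d(1) by (simp add: ennreal_mult' flip: mult_2 mult.assoc distrib_right)
      finally have le: "modular M (\<lambda>\<omega>. simple_int (F n) \<omega> - simple_int (F m) \<omega>) \<le> ennreal (4 * d)" .
      also have "\<dots> \<le> ennreal (1/4)" using d by (intro ennreal_leI)
      finally have "jump_modular (\<lambda>s. simple_fun (F n) s - simple_fun (F m) s) \<le>
          32 * modular M (\<lambda>\<omega>. simple_int (F n) \<omega> - simple_int (F m) \<omega>)"
        by (intro jump_modular_simple_diff_le F)
      also have "\<dots> \<le> 32 * ennreal (4 * d)" using le by (rule mult_left_mono) simp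
      also have "\<dots> = ennreal (128 * d)" by (simp add: ennreal_mult' flip: mult.assoc)
      also have "\<dots> \<le> ennreal e" using d by (intro ennreal_leI)
      finally show ?thesis .
    qed
    have "jump_modular (\<lambda>s. simple_fun (F n) s - f s) \<le> ennreal e" if "n \<ge> N" for n
      unfolding jump_modular_def
    proof (rule modular_Fatou)
      show "AE p in intensity S \<nu>. (\<lambda>m. case p of (s, z) \<Rightarrow> (simple_fun (F n) s - simple_fun (F m) s) * z)
          \<longlonglongrightarrow> (case p of (s, z) \<Rightarrow> (simple_fun (F n) s - f s) * z)"
        by (rule AE_jump_tendsto) (use F(2) in eventually_elim, intro tendsto_intros)
      show "\<forall>\<^sub>F m in sequentially. modular (intensity S \<nu>)
          (\<lambda>(s, z). (simple_fun (F n) s - simple_fun (F m) s) * z) \<le> ennreal e"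
        using diff[OF that] unfolding jump_modular_def eventually_sequentially by blast
    qed simp
    then show "\<forall>\<^sub>F n in sequentially. jump_modular (\<lambda>s. simple_fun (F n) s - f s) \<le> ennreal e"
      unfolding eventually_sequentially by blast
  qed
  with that F(1) lim show ?thesis by blast
qed

lemma is_stochastic_integral_linear:
  assumes Y: "has_noise_integral f Y" and Z: "has_noise_integral g Z"
  shows "has_noise_integral (\<lambda>s. a * f s + b * g s) (\<lambda>\<omega>. a * Y \<omega> + b * Z \<omega>)"
proof -
  obtain F where F: "\<And>n. noise_list (F n)"
      "AE s in lborel_S. (\<lambda>n. simple_fun (F n) s) \<longlonglongrightarrow> f s"
      "\<And>B. B \<in> sets borel \<Longrightarrow> B \<subseteq> S \<Longrightarrow> \<exists>Z. converges_in_prob M (\<lambda>n. simple_integral X B (F n)) Z"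
      "converges_in_prob M (\<lambda>n. simple_int (F n)) Y"
    using Y unfolding is_stochastic_integral_iff by blast
  obtain G where G: "\<And>n. noise_list (G n)"
      "AE s in lborel_S. (\<lambda>n. simple_fun (G n) s) \<longlonglongrightarrow> g s"
      "\<And>B. B \<in> sets borel \<Longrightarrow> B \<subseteq> S \<Longrightarrow> \<exists>Z. converges_in_prob M (\<lambda>n. simple_integral X B (G n)) Z"
      "converges_in_prob M (\<lambda>n. simple_int (G n)) Z"
    using Z unfolding is_stochastic_integral_iff by blast
  define H where "H n = scale_list a (F n) @ scale_list b (G n)" for n
  \<comment> \<open>Stated for every B because the definition of the integral asks for a limit over
    each Borel subset of S, not only over S.\<close>
  have lin: "converges_in_prob M (\<lambda>n. simple_integral X B (H n)) (\<lambda>\<omega>. a * U \<omega> + b * V \<omega>)"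
    if U: "converges_in_prob M (\<lambda>n. simple_integral X B (F n)) U"
      and V: "converges_in_prob M (\<lambda>n. simple_integral X B (G n)) V" for B U V
  proof -
    have [measurable]: "U \<in> borel_measurable M" "V \<in> borel_measurable M"
        "simple_integral X B (F n) \<in> borel_measurable M" "simple_integral X B (G n) \<in> borel_measurable M" for n
      using U V by (auto simp: converges_in_prob_def)
    have H: "simple_integral X B (H n) = (\<lambda>\<omega>. a * simple_integral X B (F n) \<omega> + b * simple_integral X B (G n) \<omega>)" for n
      by (simp add: H_def simple_integral_append simple_integral_scale fun_eq_iff)
    define u where "u n = modular M (\<lambda>\<omega>. simple_integral X B (F n) \<omega> - U \<omega>)" for n
    define v where "v n = modular M (\<lambda>\<omega>. simple_integral X B (G n) \<omega> - V \<omega>)" for n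
    have le: "modular M (\<lambda>\<omega>. simple_integral X B (H n) \<omega> - (a * U \<omega> + b * V \<omega>)) \<le>
        2 * (ennreal (max (a\<^sup>2) 1) * u n) + 2 * (ennreal (max (b\<^sup>2) 1) * v n)" for n
    proof -
      have "modular M (\<lambda>\<omega>. simple_integral X B (H n) \<omega> - (a * U \<omega> + b * V \<omega>)) =
          modular M (\<lambda>\<omega>. a * (simple_integral X B (F n) \<omega> - U \<omega>) + b * (simple_integral X B (G n) \<omega> - V \<omega>))"
        by (simp add: H algebra_simps)
      also have "\<dots> \<le> 2 * modular M (\<lambda>\<omega>. a * (simple_integral X B (F n) \<omega> - U \<omega>)) +
          2 * modular M (\<lambda>\<omega>. b * (simple_integral X B (G n) \<omega> - V \<omega>))"
        by (rule modular_add_le) auto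
      also have "\<dots> \<le> 2 * (ennreal (max (a\<^sup>2) 1) * u n) + 2 * (ennreal (max (b\<^sup>2) 1) * v n)"
        unfolding u_def v_def by (intro add_mono mult_left_mono modular_cmult_le) auto
      finally show ?thesis .
    qed
    have "(\<lambda>n. 2 * (ennreal (max (a\<^sup>2) 1) * u n) + 2 * (ennreal (max (b\<^sup>2) 1) * v n)) \<longlonglongrightarrow>
        2 * (ennreal (max (a\<^sup>2) 1) * 0) + 2 * (ennreal (max (b\<^sup>2) 1) * 0)"
      using U V by (intro tendsto_add ennreal_tendsto_cmult)
        (auto simp: converges_in_prob_iff_modular u_def[abs_def] v_def[abs_def])
    then have "(\<lambda>n. modular M (\<lambda>\<omega>. simple_integral X B (H n) \<omega> - (a * U \<omega> + b * V \<omega>))) \<longlonglongrightarrow> 0"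
      by (intro ennreal_tendsto_0_le[OF le]) simp
    then show ?thesis by (simp add: converges_in_prob_iff_modular H)
  qed
  show ?thesis unfolding is_stochastic_integral_iff
  proof (intro exI[of _ H] conjI allI ballI impI)
    show "noise_list (H n)" for n using F(1) G(1) by (simp add: H_def)
    show "AE s in lborel_S. (\<lambda>n. simple_fun (H n) s) \<longlonglongrightarrow> a * f s + b * g s"
      using F(2) G(2)
      by eventually_elim (simp add: H_def simple_fun_append simple_fun_scale tendsto_add tendsto_mult_left)
    show "\<exists>Z. converges_in_prob M (\<lambda>n. simple_integral X B (H n)) Z" if "B \<in> sets borel" "B \<subseteq> S" for B
      using F(3)[OF that] G(3)[OF that] lin by blast
    show "converges_in_prob M (\<lambda>n. simple_int (H n)) (\<lambda>\<omega>. a * Y \<omega> + b * Z \<omega>)"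
      by (rule lin[OF F(4) G(4)])
  qed
qed

lemma is_stochastic_integral_diff:
  assumes "has_noise_integral f Y" "has_noise_integral g Z"
  shows "has_noise_integral (\<lambda>s. f s - g s) (\<lambda>\<omega>. Y \<omega> - Z \<omega>)"
  using is_stochastic_integral_linear[OF assms, of 1 "- 1"] by simp

text \<open>Passes the bound for simple functions to the limit. The constant is 16 with two factors
  2, one for replacing Y by simple integrals and one for replacing simple functions by
  \<open>f\<close>.\<close>

lemma modular_stochastic_integral_le:
  assumes Y: "has_noise_integral f Y"
    and [measurable]: "f \<in> borel_measurable borel_S"
  shows "modular M Y \<le> 64 * jump_modular f"
proof -
  obtain F where F: "\<And>n. noise_list (F n)"
    "(\<lambda>n. modular M (\<lambda>\<omega>. simple_int (F n) \<omega> - Y \<omega>)) \<longlonglongrightarrow> 0"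
    "(\<lambda>n. jump_modular (\<lambda>s. simple_fun (F n) s - f s)) \<longlonglongrightarrow> 0"
    using is_stochastic_integral_approx[OF Y] by blast
  have [measurable]: "simple_fun (F n) \<in> borel_measurable borel_S"
      "simple_int (F n) \<in> borel_measurable M" "Y \<in> borel_measurable M" for n
    using F(1) is_stochastic_integral_measurable[OF Y] by auto
  define a where "a n = modular M (\<lambda>\<omega>. simple_int (F n) \<omega> - Y \<omega>)" for n
  define b where "b n = jump_modular (\<lambda>s. simple_fun (F n) s - f s)" for n
  have le: "modular M Y \<le> 2 * a n + 2 * (16 * (2 * b n + 2 * jump_modular f))" for n
  proof -
    have "modular M Y \<le> 2 * a n + 2 * modular M (simple_int (F n))"
      using modular_diff_le[of Y M "simple_int (F n)" "\<lambda>_. 0"]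
      by (simp add: a_def modular_minus_commute[of M Y])
    also have "\<dots> \<le> 2 * a n + 2 * (16 * jump_modular (simple_fun (F n)))"
      by (intro add_left_mono mult_left_mono modular_simple_integral_le F) simp
    also have "\<dots> \<le> 2 * a n + 2 * (16 * (2 * b n + 2 * jump_modular f))"
      using jump_modular_diff_le[of "simple_fun (F n)" f "\<lambda>_. 0"]
      by (intro add_left_mono mult_left_mono) (simp_all add: b_def)
    finally show ?thesis .
  qed
  have "(\<lambda>n. 2 * a n + 2 * (16 * (2 * b n + 2 * jump_modular f))) \<longlonglongrightarrow>
      2 * 0 + 2 * (16 * (2 * 0 + 2 * jump_modular f))"
    unfolding a_def b_def by (intro tendsto_add ennreal_tendsto_cmult tendsto_const F) auto
  from LIMSEQ_le_const[OF this, of "modular M Y"] le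
  show ?thesis by (auto simp: mult.assoc[symmetric])
qed

text \<open>A simple integral within d of Y has modular at most 4d, and d \<le> 1/16 keeps this
  below 1/4, where the reverse bound with factor 32 holds. Returning to \<open>f\<close> gives 258 =
  2 + 2 * 32 * 4.\<close>

lemma jump_modular_le_of_modular:
  assumes Y: "has_noise_integral f Y"
    and [measurable]: "f \<in> borel_measurable borel_S"
    and d: "0 < d" "d \<le> 1/16" and le: "modular M Y \<le> ennreal d"
  shows "jump_modular f \<le> ennreal (258 * d)"
proof -
  obtain F where F: "\<And>n. noise_list (F n)"
    "(\<lambda>n. modular M (\<lambda>\<omega>. simple_int (F n) \<omega> - Y \<omega>)) \<longlonglongrightarrow> 0"
    "(\<lambda>n. jump_modular (\<lambda>s. simple_fun (F n) s - f s)) \<longlonglongrightarrow> 0"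
    using is_stochastic_integral_approx[OF Y] by blast
  have [measurable]: "simple_fun (F n) \<in> borel_measurable borel_S"
      "simple_int (F n) \<in> borel_measurable M" "Y \<in> borel_measurable M" for n
    using F(1) is_stochastic_integral_measurable[OF Y] by auto
  have "\<forall>\<^sub>F n in sequentially.
      modular M (\<lambda>\<omega>. simple_int (F n) \<omega> - Y \<omega>) \<le> ennreal d \<and>
      jump_modular (\<lambda>s. simple_fun (F n) s - f s) \<le> ennreal d"
    using F(2,3) d(1) unfolding tendsto_0_ennreal_iff by (intro eventually_conj) auto
  then obtain n where n: "modular M (\<lambda>\<omega>. simple_int (F n) \<omega> - Y \<omega>) \<le> ennreal d"
      "jump_modular (\<lambda>s. simple_fun (F n) s - f s) \<le> ennreal d"
    by (auto simp: eventually_sequentially)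
  have "modular M (simple_int (F n)) \<le>
      2 * modular M (\<lambda>\<omega>. simple_int (F n) \<omega> - Y \<omega>) + 2 * modular M Y"
    using modular_diff_le[of "simple_int (F n)" M Y "\<lambda>_. 0"] by simp
  also have "\<dots> \<le> 2 * ennreal d + 2 * ennreal d" by (intro add_mono mult_left_mono n le) auto
  also have "\<dots> = ennreal (4 * d)" using d(1) by (simp add: ennreal_mult' flip: distrib_right)
  finally have le4: "modular M (simple_int (F n)) \<le> ennreal (4 * d)" .
  also have "\<dots> \<le> ennreal (1/4)" using d by (intro ennreal_leI) simp
  finally have "jump_modular (simple_fun (F n)) \<le> 32 * modular M (simple_int (F n))"
    by (intro jump_modular_simple_fun_le F)
  also have "\<dots> \<le> 32 * ennreal (4 * d)" using le4 by (rule mult_left_mono) simp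
  finally have 3: "jump_modular (simple_fun (F n)) \<le> 32 * ennreal (4 * d)" .
  have "jump_modular f \<le> 2 * jump_modular (\<lambda>s. f s - simple_fun (F n) s) + 2 * jump_modular (simple_fun (F n))"
    using jump_modular_diff_le[of f "simple_fun (F n)" "\<lambda>_. 0"] by simp
  also have "\<dots> \<le> 2 * ennreal d + 2 * (32 * ennreal (4 * d))"
    using n(2) 3 by (intro add_mono mult_left_mono) (auto simp: jump_modular_commute[of f])
  also have "\<dots> = ennreal (258 * d)" using d(1) by (simp add: ennreal_mult' flip: distrib_right)
  finally show ?thesis .
qed

text \<open>Y and Z may come from different approximating sequences, but their difference is an
  integral of \<open>f - f = 0\<close>, whose jump modular is 0.\<close>

lemma stochastic_integral_AE_unique:
  assumes Y: "has_noise_integral f Y" and Z: "has_noise_integral f Z"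
  shows "AE \<omega> in M. Y \<omega> = Z \<omega>"
proof -
  have [measurable]: "Y \<in> borel_measurable M" "Z \<in> borel_measurable M"
    using Y Z by (auto intro: is_stochastic_integral_measurable)
  have "modular M (\<lambda>\<omega>. Y \<omega> - Z \<omega>) \<le> 64 * jump_modular (\<lambda>s. 0)"
    using modular_stochastic_integral_le[OF is_stochastic_integral_diff[OF Y Z]] by simp
  also have "\<dots> = 0" by (simp add: jump_modular_def modular_def)
  finally have "modular M (\<lambda>\<omega>. Y \<omega> - Z \<omega>) = 0" by simp
  then show ?thesis by (subst (asm) modular_eq_0_iff) auto
qed

text \<open>Some simple function has jump modular distance at most 1 from \<open>f\<close>, and
  simple functions have finite jump modular. Borel measurability of \<open>f\<close> is a separate
  assumption, as the definition of the integral only provides an almost everywhere limit.\<close>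

lemma is_stochastic_integral_noise_integrable:
  assumes Y: "has_noise_integral f Y" and f: "f \<in> borel_measurable borel_S"
  shows "f \<in> noise_integrable S \<nu>"
proof -
  obtain F where F: "\<And>n. noise_list (F n)"
    "(\<lambda>n. jump_modular (\<lambda>s. simple_fun (F n) s - f s)) \<longlonglongrightarrow> 0"
    using is_stochastic_integral_approx[OF Y] by blast
  obtain n where n: "jump_modular (\<lambda>s. simple_fun (F n) s - f s) \<le> ennreal 1"
    using F(2)[unfolded tendsto_0_ennreal_iff, rule_format, of 1] by (auto simp: eventually_sequentially)
  have "jump_modular f \<le> 2 * jump_modular (\<lambda>s. f s - simple_fun (F n) s) + 2 * jump_modular (simple_fun (F n))"
    using jump_modular_diff_le[of f "simple_fun (F n)" "\<lambda>_. 0"] f F(1) by simp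
  also have "\<dots> < \<infinity>"
    using n jump_modular_simple_fun[OF F(1), of n]
    by (auto simp: jump_modular_commute[of f] ennreal_mult_less_top intro: le_less_trans)
  finally show ?thesis using f by (simp add: noise_integrable_iff)
qed

section \<open>Finite sums and existence of the integral\<close>

lemma is_stochastic_integral_zero: "has_noise_integral (\<lambda>_. 0) (\<lambda>_. 0)"
  unfolding is_stochastic_integral_iff
proof (intro exI[of _ "\<lambda>_. []"] conjI allI ballI impI)
  have "converges_in_prob M (\<lambda>n. simple_integral X B []) (\<lambda>_. 0)" for B
  proof -
    have "simple_integral X B [] = (\<lambda>_. 0)" by (simp add: fun_eq_iff)
    then show ?thesis by (simp add: converges_in_prob_iff_modular modular_def)
  qed
  then show "converges_in_prob M (\<lambda>n. simple_int []) (\<lambda>_. 0)"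
    "\<exists>Z. converges_in_prob M (\<lambda>n. simple_integral X B []) Z" for B
    by blast+
qed simp_all

lemma is_stochastic_integral_sum:
  assumes "\<And>j. j < n \<Longrightarrow> has_noise_integral (f j) (Y j)"
  shows "has_noise_integral (\<lambda>s. \<Sum>j<n. c j * f j s) (\<lambda>\<omega>. \<Sum>j<(n::nat). c j * Y j \<omega>)"
  using assms
proof (induction n)
  case (Suc n)
  then show ?case
    using is_stochastic_integral_linear[of "\<lambda>s. \<Sum>j<n. c j * f j s" "\<lambda>\<omega>. \<Sum>j<n. c j * Y j \<omega>" "f n" "Y n" 1 "c n"]
    by simp
qed (simp add: is_stochastic_integral_zero)

lemma is_stochastic_integral_AE_cong:
  assumes Y: "has_noise_integral f Y" and Z [measurable]: "Z \<in> borel_measurable M"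
    and eq: "AE \<omega> in M. Y \<omega> = Z \<omega>"
  shows "has_noise_integral f Z"
proof -
  have "converges_in_prob M U Z" if "converges_in_prob M U Y" for U
  proof -
    have "modular M (\<lambda>\<omega>. U n \<omega> - Z \<omega>) = modular M (\<lambda>\<omega>. U n \<omega> - Y \<omega>)" for n
      using eq by (intro modular_cong_AE) auto
    then show ?thesis using that by (simp add: converges_in_prob_iff_modular)
  qed
  then show ?thesis using Y unfolding is_stochastic_integral_iff by blast
qed

text \<open>Level sets of a simple function on S may have infinite Lebesgue measure, so the i-th
  approximation is also cut to the ball of radius i. It is bounded by 2|f|, which makes 3|f| a
  majorant of the error.\<close>

lemma exists_simple_approx:
  assumes f: "f \<in> noise_integrable S \<nu>"
  obtains F where "\<And>n. noise_list (F n)" "\<And>s. s \<in> S \<Longrightarrow> (\<lambda>n. simple_fun (F n) s) \<longlonglongrightarrow> f s"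
    "(\<lambda>n. jump_modular (\<lambda>s. simple_fun (F n) s - f s)) \<longlonglongrightarrow> 0"
proof -
  have mf [measurable]: "f \<in> borel_measurable borel_S" and fin: "jump_modular f < \<infinity>"
    using f by (auto simp: noise_integrable_iff)
  from borel_measurable_implies_sequence_metric[OF mf, of 0]
  obtain G where "\<forall>i. simple_function borel_S (G i)"
      "\<forall>s\<in>space borel_S. (\<lambda>i. G i s) \<longlonglongrightarrow> f s"
      "\<forall>i. \<forall>s\<in>space borel_S. dist (G i s) 0 \<le> 2 * dist (f s) 0" by blast
  then have G: "\<And>i. simple_function borel_S (G i)"
      "\<And>s. s \<in> S \<Longrightarrow> (\<lambda>i. G i s) \<longlonglongrightarrow> f s"
      "\<And>i s. s \<in> S \<Longrightarrow> \<bar>G i s\<bar> \<le> 2 * \<bar>f s\<bar>"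
    by (auto simp: space_restrict_space)
  define A where "A i c = {s \<in> S. G i s = c} \<inter> cball 0 (real i)" for i c
  define F where "F i = map (\<lambda>c. (c, A i c)) (sorted_list_of_set (G i ` S))" for i
  have A: "A i c \<in> noise_sets S" for i c
  proof -
    have [measurable]: "G i \<in> borel_measurable borel_S"
      using G(1) by (rule borel_measurable_simple_function)
    have "{s \<in> space borel_S. G i s = c} \<in> sets borel_S" by measurable
    then have "{s \<in> S. G i s = c} \<in> sets borel"
      by (simp add: space_restrict_space sets_restrict_space_iff)
    moreover have "emeasure lborel (A i c) \<le> emeasure lborel (cball (0::'a) (real i))"
      by (rule emeasure_mono) (auto simp: A_def)
    moreover have "emeasure lborel (cball (0::'a) (real i)) < \<infinity>" by (rule emeasure_bounded_finite) simp
    ultimately show ?thesis by (auto simp: noise_sets_def A_def)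
  qed
  have Ff: "simple_fun (F i) s = indicator (cball 0 (real i)) s * G i s" if "s \<in> S" for i s
  proof -
    have fin: "finite (G i ` S)" using G(1)[of i] by (simp add: simple_function_def space_restrict_space)
    have "simple_fun (F i) s = (\<Sum>c\<in>G i ` S. c * indicator (A i c) s)"
      unfolding simple_fun_def F_def
      by (simp add: comp_def sum_list_distinct_conv_sum_set fin)
    also have "\<dots> = (\<Sum>c\<in>G i ` S. if c = G i s then indicator (cball 0 (real i)) s * G i s else 0)"
      using that by (intro sum.cong) (auto simp: A_def indicator_def)
    also have "\<dots> = indicator (cball 0 (real i)) s * G i s" using that fin by simp
    finally show ?thesis .
  qed
  have noise: "noise_list (F i)" for i using A by (auto simp: noise_list_def F_def)
  then have [measurable]: "simple_fun (F i) \<in> borel_measurable borel_S" for i by simp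
  have lim: "(\<lambda>n. simple_fun (F n) s) \<longlonglongrightarrow> f s" if "s \<in> S" for s
  proof -
    obtain k :: nat where "norm s \<le> k" using real_arch_simple by blast
    then have "\<forall>\<^sub>F n in sequentially. G n s = simple_fun (F n) s"
      using that unfolding eventually_sequentially by (intro exI[of _ k]) (auto simp: Ff)
    with G(2)[OF that] show ?thesis by (rule Lim_transform_eventually)
  qed
  have "(\<lambda>n. jump_modular (\<lambda>s. simple_fun (F n) s - f s)) \<longlonglongrightarrow> 0"
    unfolding jump_modular_def
  proof (rule modular_dominated_tendsto_0[where w="\<lambda>p. 3 * (case p of (s, z) \<Rightarrow> f s * z)"])
    have "modular (intensity S \<nu>) (\<lambda>p. 3 * (case p of (s, z) \<Rightarrow> f s * z)) \<le>
        ennreal (max (3\<^sup>2) 1) * jump_modular f"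
      unfolding jump_modular_def by (rule modular_cmult_le) simp
    also have "\<dots> < \<infinity>" using fin by (simp add: ennreal_mult_less_top)
    finally show "modular (intensity S \<nu>) (\<lambda>p. 3 * (case p of (s, z) \<Rightarrow> f s * z)) < \<infinity>" .
    show "\<bar>case p of (s, z) \<Rightarrow> (simple_fun (F n) s - f s) * z\<bar> \<le> \<bar>3 * (case p of (s, z) \<Rightarrow> f s * z)\<bar>"
      if p: "p \<in> space (intensity S \<nu>)" for n p
    proof -
      obtain s z where sz: "p = (s, z)" "s \<in> S" using p by (auto simp: space_intensity)
      have "\<bar>simple_fun (F n) s\<bar> \<le> \<bar>G n s\<bar>" using sz by (simp add: Ff indicator_def)
      then have "\<bar>simple_fun (F n) s - f s\<bar> \<le> 3 * \<bar>f s\<bar>" using G(3)[OF sz(2), of n] by linarith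
      then have "\<bar>simple_fun (F n) s - f s\<bar> * \<bar>z\<bar> \<le> 3 * \<bar>f s\<bar> * \<bar>z\<bar>" by (rule mult_right_mono) simp
      then show ?thesis by (simp add: sz abs_mult mult.assoc)
    qed
    have "AE s in lborel_S. (\<lambda>n. simple_fun (F n) s - f s) \<longlonglongrightarrow> 0"
      by (rule AE_I2) (auto simp: space_restrict_space intro!: LIM_zero lim)
    from AE_jump_tendsto[OF this]
    show "AE p in intensity S \<nu>. (\<lambda>n. case p of (s, z) \<Rightarrow> (simple_fun (F n) s - f s) * z) \<longlonglongrightarrow> 0"
      by (simp add: case_prod_beta')
  qed auto
  with that noise lim show ?thesis by blast
qed

text \<open>Approximations are selected at the rate \<open>(1/8) ^ n\<close>, the one for which
  \<open>modular_geometric_convergent\<close> yields almost sure convergence. Restriction to B can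
  only decrease the jump modular, so the same selection works for every Borel subset B of S.\<close>

lemma exists_stochastic_integral:
  assumes f: "f \<in> noise_integrable S \<nu>"
  shows "\<exists>Y. has_noise_integral f Y"
proof -
  have mf [measurable]: "f \<in> borel_measurable borel_S"
    using f by (auto simp: noise_integrable_iff)
  obtain F where F: "\<And>n. noise_list (F n)" "\<And>s. s \<in> S \<Longrightarrow> (\<lambda>n. simple_fun (F n) s) \<longlonglongrightarrow> f s"
      "(\<lambda>n. jump_modular (\<lambda>s. simple_fun (F n) s - f s)) \<longlonglongrightarrow> 0"
    using exists_simple_approx[OF f] by blast
  have "\<exists>k\<ge>n. jump_modular (\<lambda>s. simple_fun (F k) s - f s) \<le> ennreal ((1/8) ^ n)" for n
  proof -
    have "\<forall>\<^sub>F k in sequentially. jump_modular (\<lambda>s. simple_fun (F k) s - f s) \<le> ennreal ((1/8) ^ n)"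
      using F(3)[unfolded tendsto_0_ennreal_iff] by simp
    then obtain K where "jump_modular (\<lambda>s. simple_fun (F k) s - f s) \<le> ennreal ((1/8) ^ n)" if "k \<ge> K" for k
      by (auto simp: eventually_sequentially)
    then show ?thesis by (intro exI[of _ "max n K"]) auto
  qed
  then obtain r where r: "\<And>n. r n \<ge> n"
      "\<And>n. jump_modular (\<lambda>s. simple_fun (F (r n)) s - f s) \<le> ennreal ((1/8) ^ n)"
    by metis
  define H where "H n = F (r n)" for n
  have H: "noise_list (H n)" for n by (simp add: H_def F)
  then have [measurable]: "simple_fun (H n) \<in> borel_measurable borel_S" for n by simp
  have "filterlim r at_top sequentially"
    by (rule filterlim_at_top_mono[OF filterlim_ident]) (simp add: r)
  then have limH: "(\<lambda>n. simple_fun (H n) s) \<longlonglongrightarrow> f s" if "s \<in> S" for s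
    unfolding H_def using F(2)[OF that] by (rule filterlim_compose[rotated])
  have step: "jump_modular (\<lambda>s. simple_fun (H (Suc n)) s - simple_fun (H n) s) \<le> ennreal (4 * (1/8) ^ n)" for n
  proof -
    have "jump_modular (\<lambda>s. simple_fun (H (Suc n)) s - simple_fun (H n) s) \<le>
        2 * jump_modular (\<lambda>s. simple_fun (H (Suc n)) s - f s) + 2 * jump_modular (\<lambda>s. f s - simple_fun (H n) s)"
      by (rule jump_modular_diff_le) auto
    also have "\<dots> \<le> 2 * ennreal ((1/8) ^ n) + 2 * ennreal ((1/8) ^ n)"
    proof (intro add_mono mult_left_mono)
      show "jump_modular (\<lambda>s. simple_fun (H (Suc n)) s - f s) \<le> ennreal ((1/8) ^ n)"
        unfolding H_def by (rule order_trans[OF r(2)]) (auto intro!: ennreal_leI)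
      show "jump_modular (\<lambda>s. f s - simple_fun (H n) s) \<le> ennreal ((1/8) ^ n)"
        unfolding H_def using r(2) by (simp add: jump_modular_commute[of f])
    qed auto
    also have "\<dots> = ennreal (4 * (1/8) ^ n)"
      by (simp add: ennreal_mult' flip: distrib_right)
    finally show ?thesis .
  qed
  have conv: "\<exists>Z. converges_in_prob M (\<lambda>n. simple_integral X B (H n)) Z"
    if B: "B \<in> sets borel" "B \<subseteq> S" for B
  proof -
    have [measurable]: "simple_integral X B (H n) \<in> borel_measurable M" for n using H B by simp
    have "modular M (\<lambda>\<omega>. simple_integral X B (H (Suc n)) \<omega> - simple_integral X B (H n) \<omega>) \<le>
        ennreal (64 * (1/8) ^ n)" for n
    proof -
      have "modular M (\<lambda>\<omega>. simple_integral X B (H (Suc n)) \<omega> - simple_integral X B (H n) \<omega>) \<le>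
          16 * jump_modular (\<lambda>s. simple_fun (restrict_list B (H (Suc n))) s - simple_fun (restrict_list B (H n)) s)"
        using simple_integral_diff_le[OF noise_list_restrict[OF B(1) H] noise_list_restrict[OF B(1) H]]
        by (simp add: simple_integral_restrict[OF B(2)])
      also have "\<dots> \<le> 16 * jump_modular (\<lambda>s. simple_fun (H (Suc n)) s - simple_fun (H n) s)"
        by (intro mult_left_mono jump_modular_mono) (auto simp: simple_fun_restrict indicator_def)
      also have "\<dots> \<le> 16 * ennreal (4 * (1/8) ^ n)" by (intro mult_left_mono step) simp
      also have "\<dots> = ennreal (64 * (1/8) ^ n)" by (simp add: ennreal_mult' flip: mult.assoc)
      finally show ?thesis .
    qed
    then have "AE \<omega> in M. convergent (\<lambda>n. simple_integral X B (H n) \<omega>)"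
      by (rule modular_geometric_convergent[rotated]) auto
    then have "AE \<omega> in M. (\<lambda>n. simple_integral X B (H n) \<omega> - lim (\<lambda>n. simple_integral X B (H n) \<omega>)) \<longlonglongrightarrow> 0"
      by (rule AE_lim_convergent)
    \<comment> \<open>\<open>lim\<close> is defined for all \<omega> and measurable; its value on
      the null set of divergence is irrelevant.\<close>
    moreover have [measurable]: "(\<lambda>\<omega>. lim (\<lambda>n. simple_integral X B (H n) \<omega>)) \<in> borel_measurable M"
      by (rule borel_measurable_lim_metric) simp
    ultimately have "(\<lambda>n. modular M (\<lambda>\<omega>. simple_integral X B (H n) \<omega> - lim (\<lambda>n. simple_integral X B (H n) \<omega>))) \<longlonglongrightarrow> 0"
      by (intro modular_AE_tendsto_0) auto
    then show ?thesis
      unfolding converges_in_prob_iff_modular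
      by (intro exI[of _ "\<lambda>\<omega>. lim (\<lambda>n. simple_integral X B (H n) \<omega>)"]) simp
  qed
  then obtain Y where "converges_in_prob M (\<lambda>n. simple_int (H n)) Y" using S_borel by blast
  moreover have "AE s in lborel_S. (\<lambda>n. simple_fun (H n) s) \<longlonglongrightarrow> f s"
    by (rule AE_I2) (simp add: limH space_restrict_space)
  ultimately show ?thesis unfolding is_stochastic_integral_iff using H conv by blast
qed

lemma is_stochastic_integral_stochastic_integral:
  "f \<in> noise_integrable S \<nu> \<Longrightarrow> has_noise_integral f (stochastic_integral M S X f)"
  unfolding stochastic_integral_def by (rule someI_ex[OF exists_stochastic_integral])

text \<open>The integrals are Cauchy in probability, so the integrands are Cauchy for
  \<^term>\<open>jump_modular\<close>; by Fatou they converge to \<open>h\<close> for it.\<close>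

lemma is_stochastic_integral_AE_limit:
  assumes Y: "\<And>k. has_noise_integral (g k) (Y k)"
    and g: "\<And>k. g k \<in> noise_integrable S \<nu>"
    and h [measurable]: "h \<in> borel_measurable borel_S"
    and U [measurable]: "U \<in> borel_measurable M"
    and g_lim: "AE s in lborel_S. (\<lambda>k. g k s) \<longlonglongrightarrow> h s"
    and Y_lim: "AE \<omega> in M. (\<lambda>k. Y k \<omega>) \<longlonglongrightarrow> U \<omega>"
  shows "h \<in> noise_integrable S \<nu>" "has_noise_integral h U"
proof -
  have gm [measurable]: "g k \<in> borel_measurable borel_S" and gfin: "jump_modular (g k) < \<infinity>" for k
    using g by (auto simp: noise_integrable_iff)
  have [measurable]: "Y k \<in> borel_measurable M" for k
    using Y by (rule is_stochastic_integral_measurable)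
  have lim: "(\<lambda>k. modular M (\<lambda>\<omega>. Y k \<omega> - U \<omega>)) \<longlonglongrightarrow> 0"
    by (rule modular_AE_tendsto_0) (use Y_lim in \<open>auto simp: LIM_zero_iff\<close>)
  have gh: "(\<lambda>k. jump_modular (\<lambda>s. g k s - h s)) \<longlonglongrightarrow> 0"
    unfolding tendsto_0_ennreal_iff
  proof (intro allI impI)
    fix e :: real assume "e > 0"
    \<comment> \<open>1/16 and 258 come from \<open>jump_modular_le_of_modular\<close>; the quarter
      c of d absorbs the two factors 2 when \<open>Y n\<close> and \<open>Y m\<close> are compared
      through U.\<close>
    define d where "d = min (1/16) (e / 258)"
    define c where "c = d / 4"
    have d: "d > 0" "d \<le> 1/16" "258 * d \<le> e" using \<open>e > 0\<close> by (auto simp: d_def)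
    have c: "c > 0" "d = 4 * c" using d(1) by (auto simp: c_def)
    obtain N where N: "modular M (\<lambda>\<omega>. Y n \<omega> - U \<omega>) \<le> ennreal c" if "n \<ge> N" for n
      using lim[unfolded tendsto_0_ennreal_iff, rule_format, of c] c(1)
      by (auto simp: eventually_sequentially)
    have diff: "jump_modular (\<lambda>s. g n s - g m s) \<le> ennreal e" if "n \<ge> N" "m \<ge> N" for n m
    proof -
      have "modular M (\<lambda>\<omega>. Y n \<omega> - Y m \<omega>) \<le>
          2 * modular M (\<lambda>\<omega>. Y n \<omega> - U \<omega>) + 2 * modular M (\<lambda>\<omega>. U \<omega> - Y m \<omega>)"
        by (rule modular_diff_le) auto
      also have "\<dots> \<le> 2 * ennreal c + 2 * ennreal c"
        using N[OF that(1)] N[OF that(2)]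
        by (intro add_mono mult_left_mono) (auto simp: modular_minus_commute[of M U])
      also have "\<dots> = ennreal d"
        using c by (simp add: ennreal_mult' flip: distrib_right)
      finally have "modular M (\<lambda>\<omega>. Y n \<omega> - Y m \<omega>) \<le> ennreal d" .
      then have "jump_modular (\<lambda>s. g n s - g m s) \<le> ennreal (258 * d)"
        by (intro jump_modular_le_of_modular[OF is_stochastic_integral_diff[OF Y Y]] d) simp_all
      also have "\<dots> \<le> ennreal e" using d by (intro ennreal_leI)
      finally show ?thesis .
    qed
    have "jump_modular (\<lambda>s. g n s - h s) \<le> ennreal e" if "n \<ge> N" for n
      unfolding jump_modular_def
    proof (rule modular_Fatou)
      show "AE p in intensity S \<nu>. (\<lambda>m. case p of (s, z) \<Rightarrow> (g n s - g m s) * z)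
          \<longlonglongrightarrow> (case p of (s, z) \<Rightarrow> (g n s - h s) * z)"
        by (rule AE_jump_tendsto) (use g_lim in eventually_elim, intro tendsto_intros)
      show "\<forall>\<^sub>F m in sequentially. modular (intensity S \<nu>) (\<lambda>(s, z). (g n s - g m s) * z) \<le> ennreal e"
        using diff[OF that] unfolding jump_modular_def eventually_sequentially by blast
    qed simp
    then show "\<forall>\<^sub>F n in sequentially. jump_modular (\<lambda>s. g n s - h s) \<le> ennreal e"
      unfolding eventually_sequentially by blast
  qed
  obtain k where k: "jump_modular (\<lambda>s. g k s - h s) \<le> ennreal 1"
    using gh[unfolded tendsto_0_ennreal_iff, rule_format, of 1] by (auto simp: eventually_sequentially)
  have "jump_modular (\<lambda>s. h s - 0) \<le> 2 * jump_modular (\<lambda>s. h s - g k s) + 2 * jump_modular (\<lambda>s. g k s - 0)"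
    by (rule jump_modular_diff_le) auto
  also have "\<dots> < \<infinity>"
    using k gfin[of k] by (auto simp: jump_modular_commute[of h] ennreal_mult_less_top intro: le_less_trans)
  finally show h_int: "h \<in> noise_integrable S \<nu>" by (simp add: noise_integrable_iff)
  \<comment> \<open>No diagonal sequence is extracted: an integral Z of \<open>h\<close> exists by
    integrability, and Z is identified with U by comparing both with \<open>Y k\<close>.\<close>
  obtain Z where Z: "has_noise_integral h Z" using exists_stochastic_integral[OF h_int] by blast
  have [measurable]: "Z \<in> borel_measurable M" using Z by (rule is_stochastic_integral_measurable)
  have le: "modular M (\<lambda>\<omega>. Z \<omega> - U \<omega>) \<le>
      2 * (64 * jump_modular (\<lambda>s. g k s - h s)) + 2 * modular M (\<lambda>\<omega>. Y k \<omega> - U \<omega>)" for k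
  proof -
    have "modular M (\<lambda>\<omega>. Z \<omega> - U \<omega>) \<le> 2 * modular M (\<lambda>\<omega>. Z \<omega> - Y k \<omega>) + 2 * modular M (\<lambda>\<omega>. Y k \<omega> - U \<omega>)"
      by (rule modular_diff_le) auto
    also have "modular M (\<lambda>\<omega>. Z \<omega> - Y k \<omega>) \<le> 64 * jump_modular (\<lambda>s. h s - g k s)"
      by (rule modular_stochastic_integral_le[OF is_stochastic_integral_diff[OF Z Y]]) simp
    finally show ?thesis by (simp add: jump_modular_commute[of h] mult_left_mono add_right_mono)
  qed
  have "(\<lambda>k. 2 * (64 * jump_modular (\<lambda>s. g k s - h s)) + 2 * modular M (\<lambda>\<omega>. Y k \<omega> - U \<omega>)) \<longlonglongrightarrow>
      2 * (64 * 0) + 2 * 0"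
    by (intro tendsto_add ennreal_tendsto_cmult gh lim) auto
  from LIMSEQ_le_const[OF this, of "modular M (\<lambda>\<omega>. Z \<omega> - U \<omega>)"] le
  have "modular M (\<lambda>\<omega>. Z \<omega> - U \<omega>) = 0" by auto
  then have "AE \<omega> in M. Z \<omega> - U \<omega> = 0" by (subst (asm) modular_eq_0_iff) auto
  then show "has_noise_integral h U"
    by (intro is_stochastic_integral_AE_cong[OF Z U]) auto
qed

end

section \<open>Test functions and the stochastic Fubini theorem\<close>

lemma test_function_continuous:
  assumes "\<phi> \<in> test_functions"
  shows "continuous_on UNIV \<phi>"
proof -
  have "smooth \<phi>" using assms by (simp add: test_functions_def)
  from this[unfolded smooth_def, rule_format, of "[]"] have "\<phi> differentiable at x" for x by simp
  then show ?thesis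
    by (auto simp: continuous_on_eq_continuous_at intro: differentiable_imp_continuous_within)
qed

lemma test_function_measurable: "\<phi> \<in> test_functions \<Longrightarrow> \<phi> \<in> borel_measurable borel"
  by (intro borel_measurable_continuous_onI test_function_continuous)

lemma test_function_support:
  fixes \<phi> :: "'a::euclidean_space \<Rightarrow> real"
  assumes "\<phi> \<in> test_functions"
  obtains r where "r > 0" "\<And>x. \<phi> x \<noteq> 0 \<Longrightarrow> x \<in> cball 0 r"
proof -
  have "bounded {x. \<phi> x \<noteq> 0}" using assms by (simp add: test_functions_def compact_closure)
  then obtain r where "r > 0" "\<forall>x\<in>{x. \<phi> x \<noteq> 0}. norm x \<le> r" by (auto simp: bounded_pos)
  then show ?thesis by (intro that[of r]) auto
qed

lemma test_function_bounded:
  fixes \<phi> :: "'a::euclidean_space \<Rightarrow> real"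
  assumes "\<phi> \<in> test_functions"
  obtains B where "\<And>x. \<bar>\<phi> x\<bar> \<le> B"
proof -
  obtain r where r: "r > 0" "\<And>x. \<phi> x \<noteq> 0 \<Longrightarrow> x \<in> cball 0 r"
    using test_function_support[OF assms] by blast
  have "compact (\<phi> ` cball 0 r)"
    using test_function_continuous[OF assms] by (intro compact_continuous_image) (auto intro: continuous_on_subset)
  then obtain B where B: "B > 0" "\<And>x. x \<in> cball 0 r \<Longrightarrow> \<bar>\<phi> x\<bar> \<le> B"
    using compact_imp_bounded by (force simp: bounded_pos)
  then have "\<bar>\<phi> x\<bar> \<le> B" for x using r(2)[of x] by (cases "\<phi> x = 0") auto
  then show ?thesis by (rule that)
qed

text \<open>One chain rule per differentiation; smoothness is what makes each
  \<open>frechet_derivative\<close> an actual derivative.\<close>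

lemma iter_deriv_shift:
  assumes "smooth \<phi>" "set vs \<subseteq> Basis"
  shows "iter_deriv vs (\<lambda>x. \<phi> (s + x)) = (\<lambda>x. iter_deriv vs \<phi> (s + x))"
  using assms(2)
proof (induction vs)
  case (Cons v vs)
  have "frechet_derivative (\<lambda>x. iter_deriv vs \<phi> (s + x)) (at x) = frechet_derivative (iter_deriv vs \<phi>) (at (s + x))" for x
  proof (rule frechet_derivative_at[symmetric])
    have "iter_deriv vs \<phi> differentiable at (s + x)" using assms(1) Cons.prems by (simp add: smooth_def)
    then have "(iter_deriv vs \<phi> has_derivative frechet_derivative (iter_deriv vs \<phi>) (at (s + x))) (at (s + x))"
      by (simp add: frechet_derivative_works)
    moreover have "((\<lambda>x. s + x) has_derivative (\<lambda>x. x)) (at x)" by (auto intro!: derivative_eq_intros)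
    ultimately show "((\<lambda>x. iter_deriv vs \<phi> (s + x)) has_derivative
        frechet_derivative (iter_deriv vs \<phi>) (at (s + x))) (at x)"
      using has_derivative_compose[of "\<lambda>x. s + x" "\<lambda>x. x" x UNIV "iter_deriv vs \<phi>"] by simp
  qed
  then show ?case using Cons by simp
qed simp

lemma test_function_shift:
  fixes \<phi> :: "'a::euclidean_space \<Rightarrow> real"
  assumes "\<phi> \<in> test_functions"
  shows "(\<lambda>x. \<phi> (s + x)) \<in> test_functions"
proof -
  have smooth: "smooth \<phi>" using assms by (simp add: test_functions_def)
  have "smooth (\<lambda>x. \<phi> (s + x))" unfolding smooth_def
  proof (intro allI impI)
    fix vs :: "'a list" and x :: 'a assume vs: "set vs \<subseteq> Basis"
    have "iter_deriv vs \<phi> differentiable at (s + x)" using smooth vs by (simp add: smooth_def)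
    then have "(\<lambda>x. iter_deriv vs \<phi> (s + x)) differentiable at x"
      by (rule differentiable_compose) (auto intro!: derivative_intros)
    then show "iter_deriv vs (\<lambda>x. \<phi> (s + x)) differentiable at x"
      by (simp add: iter_deriv_shift[OF smooth vs])
  qed
  moreover obtain r where r: "\<And>x. \<phi> x \<noteq> 0 \<Longrightarrow> x \<in> cball 0 r"
    using test_function_support[OF assms] by blast
  have "norm x \<le> norm s + r" if "\<phi> (s + x) \<noteq> 0" for x
    using r[OF that] norm_triangle_ineq4[of "s + x" s] by simp
  then have "bounded {x. \<phi> (s + x) \<noteq> 0}" by (auto intro: boundedI)
  ultimately show ?thesis by (simp add: test_functions_def compact_closure)
qed

lemma integrable_test_function_mult:
  fixes \<phi> h :: "'a::euclidean_space \<Rightarrow> real"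
  assumes "\<phi> \<in> test_functions" "locally_integrable h"
  shows "integrable lborel (\<lambda>t. \<phi> t * h t)"
proof -
  obtain r where r: "\<And>x. \<phi> x \<noteq> 0 \<Longrightarrow> x \<in> cball 0 r" using test_function_support[OF assms(1)] by blast
  obtain B where B: "\<And>x. \<bar>\<phi> x\<bar> \<le> B" using test_function_bounded[OF assms(1)] by blast
  have [measurable]: "\<phi> \<in> borel_measurable borel" by (rule test_function_measurable[OF assms(1)])
  have int: "integrable lborel (\<lambda>t. indicator (cball 0 r) t * h t)"
    using assms(2) compact_cball unfolding locally_integrable_def set_integrable_def by auto
  \<comment> \<open>Local integrability provides measurability of \<open>h\<close> only after
    cutting to a compact set, so the indicator is kept until the end, where it is absorbed by the
    support of \<phi>.\<close>
  have "integrable lborel (\<lambda>t. \<phi> t * (indicator (cball 0 r) t * h t))"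
  proof (rule Bochner_Integration.integrable_bound)
    show "integrable lborel (\<lambda>t. B * (indicator (cball 0 r) t * h t))" using int by simp
    show "(\<lambda>t. \<phi> t * (indicator (cball 0 r) t * h t)) \<in> borel_measurable lborel"
      using borel_measurable_integrable[OF int]
      by (intro borel_measurable_times[of \<phi> _ "\<lambda>t. indicator (cball 0 r) t * h t"]) simp_all
    show "AE t in lborel. norm (\<phi> t * (indicator (cball 0 r) t * h t)) \<le> norm (B * (indicator (cball 0 r) t * h t))"
    proof (rule AE_I2)
      fix t
      have "\<bar>\<phi> t\<bar> \<le> \<bar>B\<bar>" using B[of t] by linarith
      then show "norm (\<phi> t * (indicator (cball 0 r) t * h t)) \<le> norm (B * (indicator (cball 0 r) t * h t))"
        by (auto simp: abs_mult intro: mult_right_mono)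
    qed
  qed
  moreover have "\<phi> t * (indicator (cball 0 r) t * h t) = \<phi> t * h t" for t
    using r[of t] by (cases "\<phi> t = 0") (auto simp: indicator_def)
  ultimately show ?thesis by simp
qed

text \<open>Translation invariance: t = s + x turns the convolution into the pairing of \<rho> with
  a translated test function, the form in which \<open>conv_reflected\<close> is given.\<close>

lemma integrable_test_function_convolution:
  fixes \<phi> \<rho> :: "'a::euclidean_space \<Rightarrow> real"
  assumes \<phi>: "\<phi> \<in> test_functions" and [measurable]: "\<rho> \<in> borel_measurable borel"
    and "locally_integrable \<rho>"
  shows "integrable lborel (\<lambda>t. \<phi> t * \<rho> (t - s))"
    and "(\<integral>t. \<phi> t * \<rho> (t - s) \<partial>lborel) = (\<integral>x. \<rho> x * \<phi> (s + x) \<partial>lborel)"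
proof -
  have [measurable]: "\<phi> \<in> borel_measurable borel" by (rule test_function_measurable[OF \<phi>])
  have int: "integrable lborel (\<lambda>x. \<phi> (s + x) * \<rho> x)"
    by (intro integrable_test_function_mult test_function_shift assms)
  have "integrable (distr lborel borel ((+) s)) (\<lambda>t. \<phi> t * \<rho> (t - s))"
    by (subst integrable_distr_eq) (use int in auto)
  then show "integrable lborel (\<lambda>t. \<phi> t * \<rho> (t - s))" by (simp only: lborel_distr_plus)
  have "(\<integral>t. \<phi> t * \<rho> (t - s) \<partial>lborel) = (\<integral>t. \<phi> t * \<rho> (t - s) \<partial>distr lborel borel ((+) s))"
    by (simp only: lborel_distr_plus)
  also have "\<dots> = (\<integral>x. \<rho> x * \<phi> (s + x) \<partial>lborel)"
    by (subst integral_distr) (auto simp: mult.commute)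
  finally show "(\<integral>t. \<phi> t * \<rho> (t - s) \<partial>lborel) = (\<integral>x. \<rho> x * \<phi> (s + x) \<partial>lborel)" .
qed

text \<open>The uniform distribution on the ball, with V the volume. The measure is chosen before
  \<open>h\<close>, so that one and the same \<mu> serves for the paths and for the
  integrands.\<close>

lemma exists_uniform_sampling_measure:
  assumes "r > 0"
  shows "\<exists>(\<mu> :: 'a::euclidean_space measure) (V :: real). prob_space \<mu> \<and> sets \<mu> = sets borel \<and>
    (\<forall>h. integrable lborel h \<longrightarrow> (\<forall>t. h t \<noteq> 0 \<longrightarrow> t \<in> cball 0 r) \<longrightarrow>
      integrable \<mu> (\<lambda>t. V * h t) \<and> (\<integral>t. V * h t \<partial>\<mu>) = (\<integral>t. h t \<partial>lborel))"
proof -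
  define V where "V = measure lborel (cball (0::'a) r)"
  have V: "V > 0" unfolding V_def using assms by (rule content_cball_pos)
  have fin: "emeasure lborel (cball (0::'a) r) = ennreal V"
    unfolding V_def by (rule emeasure_eq_ennreal_measure)
      (use emeasure_bounded_finite[of "cball (0::'a) r"] in auto)
  define w where "w t = indicator (cball 0 r) t / V" for t :: 'a
  have w [measurable]: "w \<in> borel_measurable borel" unfolding w_def[abs_def]
    by (intro borel_measurable_divide borel_measurable_indicator borel_measurable_const borel_closed closed_cball)
  have w0: "w t \<ge> 0" for t using V by (simp add: w_def)
  define \<mu> where "\<mu> = density lborel (\<lambda>t. ennreal (w t))"
  show ?thesis
  proof (intro exI[of _ \<mu>] exI[of _ V] conjI allI impI)
    have "emeasure \<mu> (space \<mu>) = (\<integral>\<^sup>+t. ennreal (w t) \<partial>lborel)"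
      unfolding \<mu>_def by (subst emeasure_density) simp_all
    also have "\<dots> = (\<integral>\<^sup>+t. ennreal (1 / V) * indicator (cball (0::'a) r) t \<partial>lborel)"
      by (intro nn_integral_cong) (auto simp: w_def indicator_def)
    also have "\<dots> = ennreal (1 / V) * ennreal V"
      by (subst nn_integral_cmult_indicator) (auto simp: fin)
    also have "\<dots> = 1" using V by (simp flip: ennreal_mult')
    finally show "prob_space \<mu>" by (rule prob_spaceI)
    show "sets \<mu> = sets borel" by (simp add: \<mu>_def)
    fix h :: "'a \<Rightarrow> real"
    assume h: "integrable lborel h" and supp: "\<forall>t. h t \<noteq> 0 \<longrightarrow> t \<in> cball 0 r"
    have [measurable]: "h \<in> borel_measurable borel" using borel_measurable_integrable[OF h] by simp
    have eq: "w t *\<^sub>R (V * h t) = h t" for t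
      using supp V by (cases "h t = 0") (auto simp: w_def)
    show "integrable \<mu> (\<lambda>t. V * h t)"
      unfolding \<mu>_def using h w0 by (subst integrable_density) (simp_all only: eq, simp_all)
    have "(\<integral>t. V * h t \<partial>\<mu>) = (\<integral>t. w t *\<^sub>R (V * h t) \<partial>lborel)"
      unfolding \<mu>_def using w0 by (intro integral_density) auto
    then show "(\<integral>t. V * h t \<partial>\<mu>) = (\<integral>t. h t \<partial>lborel)" by (simp only: eq)
  qed
qed

section \<open>Interchange of the noise integral with integration in t\<close>

context levy_noise
begin

text \<open>Integrability in t is asked of each side separately, for almost every path and for every
  s; no moment of \<open>u\<close> and no joint bound on the jump modulars of \<open>f t\<close>
  enters. Noise integrability of the averaged integrand is therefore a conclusion.\<close>

lemma stochastic_Fubini: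
  fixes u :: "'a \<Rightarrow> 'w \<Rightarrow> real" and f :: "'a \<Rightarrow> 'a \<Rightarrow> real"
  assumes u [measurable]: "(\<lambda>(t, \<omega>). u t \<omega>) \<in> borel_measurable (borel \<Otimes>\<^sub>M M)"
    and f [measurable]: "(\<lambda>(t, s). f t s) \<in> borel_measurable (borel \<Otimes>\<^sub>M borel_S)"
    and uf: "\<And>t. has_noise_integral (f t) (u t)"
    and \<phi>: "\<phi> \<in> test_functions"
    and int_u: "AE \<omega> in M. integrable lborel (\<lambda>t. \<phi> t * u t \<omega>)"
    and int_f: "\<And>s. s \<in> S \<Longrightarrow> integrable lborel (\<lambda>t. \<phi> t * f t s)"
  shows "has_noise_integral (\<lambda>s. \<integral>t. \<phi> t * f t s \<partial>lborel) (\<lambda>\<omega>. \<integral>t. \<phi> t * u t \<omega> \<partial>lborel)"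
    and "(\<lambda>s. \<integral>t. \<phi> t * f t s \<partial>lborel) \<in> noise_integrable S \<nu>"
proof -
  have [measurable]: "\<phi> \<in> borel_measurable borel" by (rule test_function_measurable[OF \<phi>])
  obtain r where r: "r > 0" "\<And>x. \<phi> x \<noteq> 0 \<Longrightarrow> x \<in> cball 0 r"
    using test_function_support[OF \<phi>] by blast
  from exists_uniform_sampling_measure[OF r(1)]
  obtain \<mu> :: "'a measure" and V :: real where \<mu>: "prob_space \<mu>" and [measurable_cong]: "sets \<mu> = sets borel"
    and \<mu>V: "\<forall>h. integrable lborel h \<longrightarrow> (\<forall>t. h t \<noteq> 0 \<longrightarrow> t \<in> cball 0 r) \<longrightarrow>
      integrable \<mu> (\<lambda>t. V * h t) \<and> (\<integral>t. V * h t \<partial>\<mu>) = (\<integral>t. h t \<partial>lborel)"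
    by (elim exE conjE)
  have \<mu>u: "AE \<omega> in M. integrable \<mu> (\<lambda>t. V * (\<phi> t * u t \<omega>)) \<and>
      (\<integral>t. V * (\<phi> t * u t \<omega>) \<partial>\<mu>) = (\<integral>t. \<phi> t * u t \<omega> \<partial>lborel)"
    using int_u by eventually_elim (rule \<mu>V[rule_format], use r in auto)
  have \<mu>f: "integrable \<mu> (\<lambda>t. V * (\<phi> t * f t s)) \<and>
      (\<integral>t. V * (\<phi> t * f t s) \<partial>\<mu>) = (\<integral>t. \<phi> t * f t s \<partial>lborel)" if "s \<in> S" for s
    by (rule \<mu>V[rule_format, OF int_f[OF that]]) (use r in auto)
  define v where "v p = V * (\<phi> (fst p) * u (fst p) (snd p))" for p :: "'a \<times> 'w"
  define v' where "v' p = V * (\<phi> (fst p) * f (fst p) (snd p))" for p :: "'a \<times> 'a"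
  obtain N \<tau> where
      lim_u: "AE \<omega> in M. (\<lambda>k. (\<Sum>j<N k. v (\<tau> k j, \<omega>)) / real (N k)) \<longlonglongrightarrow> (\<integral>t. v (t, \<omega>) \<partial>\<mu>)"
    and lim_f: "AE s in lborel_S. (\<lambda>k. (\<Sum>j<N k. v' (\<tau> k j, s)) / real (N k)) \<longlonglongrightarrow> (\<integral>t. v' (t, s) \<partial>\<mu>)"
  proof (rule exists_sampling[OF \<mu>, of M v "lborel_S" v'])
    show "sigma_finite_measure M" "sigma_finite_measure lborel_S" by unfold_locales
    have "(\<lambda>p. V * (\<phi> (fst p) * (case p of (t, \<omega>) \<Rightarrow> u t \<omega>))) \<in> borel_measurable (\<mu> \<Otimes>\<^sub>M M)"
      by measurable
    then show "v \<in> borel_measurable (\<mu> \<Otimes>\<^sub>M M)" by (simp add: v_def[abs_def] case_prod_beta')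
    have "(\<lambda>p. V * (\<phi> (fst p) * (case p of (t, s) \<Rightarrow> f t s))) \<in> borel_measurable (\<mu> \<Otimes>\<^sub>M lborel_S)"
      by measurable
    then show "v' \<in> borel_measurable (\<mu> \<Otimes>\<^sub>M lborel_S)" by (simp add: v'_def[abs_def] case_prod_beta')
    show "AE \<omega> in M. integrable \<mu> (\<lambda>t. v (t, \<omega>))" using \<mu>u by eventually_elim (simp add: v_def)
    show "AE s in lborel_S. integrable \<mu> (\<lambda>t. v' (t, s))"
      using \<mu>f by (intro AE_I2) (simp add: v'_def space_restrict_space)
  qed blast
  \<comment> \<open>The same weights and points define \<open>g k\<close> and \<open>Y k\<close>, so
    linearity over finite sums makes \<open>Y k\<close> an integral of \<open>g k\<close>.\<close>
  define c where "c k j = V * \<phi> (\<tau> k j) / real (N k)" for k j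
  define g where "g k s = (\<Sum>j<N k. c k j * f (\<tau> k j) s)" for k s
  define Y where "Y k \<omega> = (\<Sum>j<N k. c k j * u (\<tau> k j) \<omega>)" for k \<omega>
  have gY: "has_noise_integral (g k) (Y k)" for k
    unfolding g_def[abs_def] Y_def[abs_def] by (intro is_stochastic_integral_sum uf)
  have ft [measurable]: "f t \<in> borel_measurable borel_S" for t
    using measurable_Pair2[OF f, of t] by simp
  have "g k \<in> borel_measurable borel_S" for k
    unfolding g_def[abs_def] by measurable
  then have g: "g k \<in> noise_integrable S \<nu>" for k
    using gY by (intro is_stochastic_integral_noise_integrable)
  have g_lim: "AE s in lborel_S. (\<lambda>k. g k s) \<longlonglongrightarrow> (\<integral>t. \<phi> t * f t s \<partial>lborel)"
    using lim_f AE_space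
  proof eventually_elim
    case (elim s)
    have "(\<Sum>j<N k. v' (\<tau> k j, s)) / real (N k) = g k s" for k
      by (simp add: v'_def g_def c_def sum_divide_distrib mult_ac)
    moreover have "(\<integral>t. v' (t, s) \<partial>\<mu>) = (\<integral>t. \<phi> t * f t s \<partial>lborel)"
      using \<mu>f[of s] elim(2) by (simp add: v'_def space_restrict_space)
    ultimately show ?case using elim(1) by simp
  qed
  have Y_lim: "AE \<omega> in M. (\<lambda>k. Y k \<omega>) \<longlonglongrightarrow> (\<integral>t. \<phi> t * u t \<omega> \<partial>lborel)"
    using lim_u \<mu>u
  proof eventually_elim
    case (elim \<omega>)
    have "(\<Sum>j<N k. v (\<tau> k j, \<omega>)) / real (N k) = Y k \<omega>" for k
      by (simp add: v_def Y_def c_def sum_divide_distrib mult_ac)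
    moreover have "(\<integral>t. v (t, \<omega>) \<partial>\<mu>) = (\<integral>t. \<phi> t * u t \<omega> \<partial>lborel)"
      using elim(2) by (simp add: v_def)
    ultimately show ?case using elim(1) by simp
  qed
  have m1: "(\<lambda>s. \<integral>t. \<phi> t * f t s \<partial>lborel) \<in> borel_measurable borel_S"
  proof (rule lborel.borel_measurable_lebesgue_integral)
    have "(\<lambda>p. \<phi> (snd p) * (case (snd p, fst p) of (t, s) \<Rightarrow> f t s)) \<in> borel_measurable (borel_S \<Otimes>\<^sub>M lborel)"
      by measurable
    then show "(\<lambda>(s, t). \<phi> t * f t s) \<in> borel_measurable (borel_S \<Otimes>\<^sub>M lborel)"
      by (simp add: case_prod_beta')
  qed
  have m2: "(\<lambda>\<omega>. \<integral>t. \<phi> t * u t \<omega> \<partial>lborel) \<in> borel_measurable M"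
  proof (rule lborel.borel_measurable_lebesgue_integral)
    have "(\<lambda>p. \<phi> (snd p) * (case (snd p, fst p) of (t, \<omega>) \<Rightarrow> u t \<omega>)) \<in> borel_measurable (M \<Otimes>\<^sub>M lborel)"
      by measurable
    then show "(\<lambda>(\<omega>, t). \<phi> t * u t \<omega>) \<in> borel_measurable (M \<Otimes>\<^sub>M lborel)"
      by (simp add: case_prod_beta')
  qed
  show "has_noise_integral (\<lambda>s. \<integral>t. \<phi> t * f t s \<partial>lborel) (\<lambda>\<omega>. \<integral>t. \<phi> t * u t \<omega> \<partial>lborel)"
    and "(\<lambda>s. \<integral>t. \<phi> t * f t s \<partial>lborel) \<in> noise_integrable S \<nu>"
    by (rule is_stochastic_integral_AE_limit[OF gY g m1 m2 g_lim Y_lim])+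
qed

end

text \<open>After stochastic Fubini with \<open>f t s = \<rho> (t - s)\<close>, both functionals at
  \<phi> are versions of the integral of the single deterministic function
  \<open>conv_reflected \<phi> T\<close>; uniqueness of the integral then identifies them.\<close>

theorem theorem4p5:
  fixes M :: "'w measure"
    and S :: "'a::euclidean_space set"
    and \<nu> :: "real measure"
    and J :: "'w \<Rightarrow> ('a \<times> real) measure"
    and X :: "'a set \<Rightarrow> 'w \<Rightarrow> real"
    and L :: "'a pdo"
    and T :: "('a \<Rightarrow> real) \<Rightarrow> real"
    and \<rho> :: "'a \<Rightarrow> real"
    and u_mild :: "'a \<Rightarrow> 'w \<Rightarrow> real"
  assumes "prob_space M"
    and "S \<in> sets borel"
    and "levy_white_noise M S \<nu> J X"
    and "partial_differential_operator L"
    and "fundamental_solution L T"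
    and "represented_by T \<rho>"
    and "\<And>t. (\<lambda>s. \<rho> (t - s)) \<in> noise_integrable S \<nu>"
    and "measurable_mild_solution M S X \<rho> u_mild"
    and "AE \<omega> in M. locally_integrable (\<lambda>t. u_mild t \<omega>)"
  shows "generalized_solution_defined S \<nu> T \<and>
    eq_generalized_process M (mild_functional u_mild) (generalized_solution M S X T)"
proof -
  interpret prob_space M by fact
  interpret levy_noise M S \<nu> J X by unfold_locales (fact assms)+
  have \<rho> [measurable]: "\<rho> \<in> borel_measurable borel" and \<rho>_loc: "locally_integrable \<rho>"
    and T\<rho>: "\<And>\<phi>. \<phi> \<in> test_functions \<Longrightarrow> T \<phi> = (\<integral>x. \<rho> x * \<phi> x \<partial>lborel)"
    using assms(6) by (auto simp: represented_by_def)
  have u: "(\<lambda>(t, \<omega>). u_mild t \<omega>) \<in> borel_measurable (borel \<Otimes>\<^sub>M M)"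
    and uX: "\<And>t. AE \<omega> in M. u_mild t \<omega> = stochastic_integral M S X (\<lambda>s. \<rho> (t - s)) \<omega>"
    using assms(8) by (auto simp: measurable_mild_solution_def)
  have ut: "u_mild t \<in> borel_measurable M" for t
    using measurable_Pair2[OF u, of t] by simp
  \<comment> \<open>The mild solution agrees only almost surely, for each t, with the version picked
    by \<open>stochastic_integral\<close>; being an integral is invariant under such
    changes.\<close>
  have uI: "is_stochastic_integral M S X (\<lambda>s. \<rho> (t - s)) (u_mild t)" for t
    using uX[of t] by (intro is_stochastic_integral_AE_cong[OF
        is_stochastic_integral_stochastic_integral[OF assms(7)] ut]) (auto elim: AE_mp)
  have conv: "conv_reflected \<phi> T = (\<lambda>s. \<integral>t. \<phi> t * \<rho> (t - s) \<partial>lborel)" if "\<phi> \<in> test_functions" for \<phi>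
    using that by (simp add: conv_reflected_def T\<rho> test_function_shift fun_eq_iff
        integrable_test_function_convolution(2)[OF _ \<rho> \<rho>_loc])
  have mild: "mild_functional u_mild \<phi> = (\<lambda>\<omega>. \<integral>t. \<phi> t * u_mild t \<omega> \<partial>lborel)" for \<phi>
    by (simp add: mild_functional_def fun_eq_iff mult.commute)
  have int_u: "AE \<omega> in M. integrable lborel (\<lambda>t. \<phi> t * u_mild t \<omega>)" if "\<phi> \<in> test_functions" for \<phi>
    using assms(9) by eventually_elim (rule integrable_test_function_mult[OF that])
  have mild_integral: "is_stochastic_integral M S X (conv_reflected \<phi> T) (mild_functional u_mild \<phi>)"
    and conv_integrable: "conv_reflected \<phi> T \<in> noise_integrable S \<nu>" if \<phi>: "\<phi> \<in> test_functions" for \<phi>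
  proof -
    have [measurable]: "snd \<in> borel \<Otimes>\<^sub>M restrict_space borel S \<rightarrow>\<^sub>M (borel :: 'a measure)"
      by (rule measurable_compose[OF measurable_snd measurable_restrict_space1]) simp
    have "(\<lambda>p. \<rho> (fst p - snd p)) \<in> borel_measurable (borel \<Otimes>\<^sub>M restrict_space borel S)"
      by measurable
    then have f: "(\<lambda>(t, s). \<rho> (t - s)) \<in> borel_measurable (borel \<Otimes>\<^sub>M restrict_space borel S)"
      by (simp add: case_prod_beta')
    show "is_stochastic_integral M S X (conv_reflected \<phi> T) (mild_functional u_mild \<phi>)"
      "conv_reflected \<phi> T \<in> noise_integrable S \<nu>"
      unfolding conv[OF \<phi>] mild
      by (rule stochastic_Fubini[OF u f uI \<phi> int_u[OF \<phi>]
            integrable_test_function_convolution(1)[OF \<phi> \<rho> \<rho>_loc]])+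
  qed
  have gen_integral: "is_stochastic_integral M S X (conv_reflected \<phi> T) (generalized_solution M S X T \<phi>)"
    if "\<phi> \<in> test_functions" for \<phi>
    unfolding generalized_solution_def
    by (rule is_stochastic_integral_stochastic_integral[OF conv_integrable[OF that]])
  have conv_meas: "conv_reflected \<phi> T \<in> borel_measurable (restrict_space borel S)" if "\<phi> \<in> test_functions" for \<phi>
    using conv_integrable[OF that] by (simp add: noise_integrable_iff)
  have mild_process: "generalized_process M (mild_functional u_mild)"
    unfolding generalized_process_def
  proof (intro conjI ballI allI)
    show "mild_functional u_mild \<phi> \<in> borel_measurable M" if "\<phi> \<in> test_functions" for \<phi>
      by (rule is_stochastic_integral_measurable[OF mild_integral[OF that]])
    fix \<phi> \<psi> :: "'a \<Rightarrow> real" and a b :: real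
    assume \<phi>: "\<phi> \<in> test_functions" and \<psi>: "\<psi> \<in> test_functions"
    show "AE \<omega> in M. mild_functional u_mild (\<lambda>x. a * \<phi> x + b * \<psi> x) \<omega> =
        a * mild_functional u_mild \<phi> \<omega> + b * mild_functional u_mild \<psi> \<omega>"
      using int_u[OF \<phi>] int_u[OF \<psi>]
      by eventually_elim (simp add: mild distrib_right mult.assoc)
  qed
  have gen_process: "generalized_process M (generalized_solution M S X T)"
    unfolding generalized_process_def
  proof (intro conjI ballI allI)
    show "generalized_solution M S X T \<phi> \<in> borel_measurable M" if "\<phi> \<in> test_functions" for \<phi>
      by (rule is_stochastic_integral_measurable[OF gen_integral[OF that]])
    fix \<phi> \<psi> :: "'a \<Rightarrow> real" and a b :: real
    assume \<phi>: "\<phi> \<in> test_functions" and \<psi>: "\<psi> \<in> test_functions"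
    have "distribution T" using assms(5) by (simp add: fundamental_solution_def)
    then have lin: "conv_reflected (\<lambda>x. a * \<phi> x + b * \<psi> x) T =
        (\<lambda>s. a * conv_reflected \<phi> T s + b * conv_reflected \<psi> T s)"
      using test_function_shift[OF \<phi>] test_function_shift[OF \<psi>]
      by (simp add: conv_reflected_def distribution_def fun_eq_iff)
    have meas: "(\<lambda>s. a * conv_reflected \<phi> T s + b * conv_reflected \<psi> T s) \<in> borel_measurable (restrict_space borel S)"
      using conv_meas[OF \<phi>] conv_meas[OF \<psi>] by simp
    have sum: "is_stochastic_integral M S X (\<lambda>s. a * conv_reflected \<phi> T s + b * conv_reflected \<psi> T s)
        (\<lambda>\<omega>. a * generalized_solution M S X T \<phi> \<omega> + b * generalized_solution M S X T \<psi> \<omega>)"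
      by (intro is_stochastic_integral_linear gen_integral \<phi> \<psi>)
    \<comment> \<open>\<open>stochastic_integral\<close> picks a version separately for each
      integrand, so the picked versions are linear only up to null sets, which uniqueness
      supplies.\<close>
    have "is_stochastic_integral M S X (\<lambda>s. a * conv_reflected \<phi> T s + b * conv_reflected \<psi> T s)
        (generalized_solution M S X T (\<lambda>x. a * \<phi> x + b * \<psi> x))"
      unfolding generalized_solution_def lin
      by (rule is_stochastic_integral_stochastic_integral[OF is_stochastic_integral_noise_integrable[OF sum meas]])
    from stochastic_integral_AE_unique[OF this sum]
    show "AE \<omega> in M. generalized_solution M S X T (\<lambda>x. a * \<phi> x + b * \<psi> x) \<omega> =
        a * generalized_solution M S X T \<phi> \<omega> + b * generalized_solution M S X T \<psi> \<omega>" .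
  qed
  have "AE \<omega> in M. mild_functional u_mild \<phi> \<omega> = generalized_solution M S X T \<phi> \<omega>"
    if "\<phi> \<in> test_functions" for \<phi>
    by (rule stochastic_integral_AE_unique[OF mild_integral gen_integral]) (fact that)+
  then show ?thesis
    using mild_process gen_process conv_integrable
    by (simp add: generalized_solution_defined_def eq_generalized_process_def)
qed

end
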